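(* Let $\beta\ge 1$ be fixed. For each $n$, let $\lambda_1,\dots,\lambda_n$ be distributed according to the Gaussian $\beta$-ensemble of size $n$, let $\tilde\lambda_k=\frac{\lambda_k}{2\sqrt{n\beta}}$ be the rescaled eigenvalues, and let $(r_n)$ be a sequence of positive reals with $r_n\to 0$ and $r_n^{-1}=O(n^{2/3-\epsilon})$ for some $\epsilon>0$. Define $\theta_k$ by $\tilde\lambda_k=1-\theta_k r_n$ for $k=1,\dots,n$, and let $$\mu_n=\frac{1}{n r_n^{3/2}}\sum_{k=1}^n \delta_{\theta_k},$$ a random measure on $\mathbb{R}$ of total mass $r_n^{-3/2}$. Let $\mu$ be the measure on $\mathbb{R}$, concentrated on $\mathbb{R}_+$ and absolutely continuous with respect to Lebesgue measure, with density $$\frac{d\mu}{dx}=\begin{cases}\frac{2\sqrt2}{\pi}\sqrt{x} & \text{if } x>0,\\ 0 & \text{otherwise.}\end{cases}$$ Then, as $n\to\infty$, $\mu_n$ converges weakly in probability to $\mu$ on each finite interval. Moreover, if $r_n>n^{\epsilon-2/3}$ for some $\epsilon>0$, then $\mu_n$ converges vaguely to $\mu$ with probability $1$.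
   Context: The Gaussian $\beta$-ensemble of size $n$ is the probability distribution of $(\lambda_1,\dots,\lambda_n)\in\mathbb{R}^n$ with density $$G_{n,\beta}\prod_{1\le i<j\le n}|\lambda_i-\lambda_j|^\beta\exp\Big(-\frac14\sum_{i=1}^n\lambda_i^2\Big)$$ with respect to Lebesgue measure, where $G_{n,\beta}$ is the normalization constant. (Equivalently, it is the eigenvalue distribution of the $n\times n$ real symmetric tridiagonal random matrix with independent entries on and above the diagonal, with diagonal entries of law $N(0,2)$ (mean $0$, variance $2$) and with $(j,j+1)$ entry of law $\chi_{(n-j)\beta}$ for $1\le j\le n-1$.) Weak convergence in probability on each finite interval means: for every finite interval $[a,b]$ and every continuous $f:[a,b]\to\mathbb{R}$, $\int_{[a,b]} f\,d\mu_n\to\int_{[a,b]} f\,d\mu$ in probability. Vague convergence with probability $1$ means that, with the ensembles for all $n$ defined on a common probability space, almost surely $\int f\,d\mu_n\to\int f\,d\mu$ for every continuous compactly supported $f:\mathbb{R}\to\mathbb{R}$. *)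

theory Defs
  imports "HOL-Probability.Probability" "HOL-Library.Landau_Symbols"
begin

text \<open>Configurations \<open>(x\<^sub>1, \<dots>, x\<^sub>n)\<close> are points of the product space over the index set \<open>{1..n}\<close>,
  equipped with \<open>n\<close>-dimensional Lebesgue measure \<open>\<Pi>\<^sub>M i\<in>{1..n}. lborel\<close>.\<close>

definition gbe_weight :: "nat \<Rightarrow> real \<Rightarrow> (nat \<Rightarrow> real) \<Rightarrow> real" where
  "gbe_weight n \<beta> x =
     (\<Prod>i\<in>{1..n}. \<Prod>j\<in>{i<..n}. \<bar>x i - x j\<bar> powr \<beta>) * exp (- (1/4) * (\<Sum>i\<in>{1..n}. (x i)\<^sup>2))"

definition gbe_const :: "nat \<Rightarrow> real \<Rightarrow> real" where
  "gbe_const n \<beta> = 1 / (\<integral>x. gbe_weight n \<beta> x \<partial>(\<Pi>\<^sub>M i\<in>{1..n}. lborel))"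

definition gbe_density :: "nat \<Rightarrow> real \<Rightarrow> (nat \<Rightarrow> real) \<Rightarrow> real" where
  "gbe_density n \<beta> x = gbe_const n \<beta> * gbe_weight n \<beta> x"

definition gaussian_beta_ensemble ::
    "'a measure \<Rightarrow> nat \<Rightarrow> real \<Rightarrow> ('a \<Rightarrow> nat \<Rightarrow> real) \<Rightarrow> bool" where
  "gaussian_beta_ensemble M n \<beta> \<Lambda> \<longleftrightarrow>
     distributed M (\<Pi>\<^sub>M i\<in>{1..n}. lborel) \<Lambda> (\<lambda>x. ennreal (gbe_density n \<beta> x))"

definition rescaled_eigenvalue :: "nat \<Rightarrow> real \<Rightarrow> (nat \<Rightarrow> real) \<Rightarrow> nat \<Rightarrow> real" where
  "rescaled_eigenvalue n \<beta> x k = x k / (2 * sqrt (real n * \<beta>))"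

text \<open>The solution \<open>\<theta>\<close> of \<open>rescaled_eigenvalue n \<beta> x k = 1 - \<theta> * \<rho>\<close>.\<close>

definition edge_coord :: "nat \<Rightarrow> real \<Rightarrow> real \<Rightarrow> (nat \<Rightarrow> real) \<Rightarrow> nat \<Rightarrow> real" where
  "edge_coord n \<beta> \<rho> x k = (1 - rescaled_eigenvalue n \<beta> x k) / \<rho>"

lemma edge_coord_iff:
  assumes "\<rho> > 0"
  shows "rescaled_eigenvalue n \<beta> x k = 1 - \<theta> * \<rho> \<longleftrightarrow> \<theta> = edge_coord n \<beta> \<rho> x k"
  using assms by (auto simp: edge_coord_def field_simps)

text \<open>The push-forward of counting measure on \<open>{1..n}\<close> is the sum of the Dirac measures at the
  \<open>\<theta>\<^sub>k\<close>, with multiplicity.\<close>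

definition edge_measure :: "nat \<Rightarrow> real \<Rightarrow> real \<Rightarrow> (nat \<Rightarrow> real) \<Rightarrow> real measure" where
  "edge_measure n \<beta> \<rho> x =
     scale_measure (ennreal (1 / (real n * \<rho> powr (3/2))))
       (distr (count_space {1..n}) borel (edge_coord n \<beta> \<rho> x))"

lemma emeasure_edge_measure:
  assumes "A \<in> sets borel"
  shows "emeasure (edge_measure n \<beta> \<rho> x) A =
    ennreal (1 / (real n * \<rho> powr (3/2))) *
      (\<Sum>k\<in>{1..n}. emeasure (return borel (edge_coord n \<beta> \<rho> x k)) A)"
proof -
  let ?\<theta> = "edge_coord n \<beta> \<rho> x"
  have "emeasure (distr (count_space {1..n}) borel ?\<theta>) A =
      emeasure (count_space {1..n}) (?\<theta> -` A \<inter> {1..n})"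
    using assms by (subst emeasure_distr) auto
  also have "\<dots> = of_nat (card (?\<theta> -` A \<inter> {1..n}))"
    by (subst emeasure_count_space_finite) auto
  also have "\<dots> = (\<Sum>k\<in>{1..n}. emeasure (return borel (?\<theta> k)) A)"
    using assms by (simp add: indicator_def sum.If_cases Int_def vimage_def conj_commute)
  finally show ?thesis
    by (simp add: edge_measure_def)
qed

definition edge_limit_measure :: "real measure" where
  "edge_limit_measure =
     density lborel (\<lambda>x. ennreal (if x > 0 then 2 * sqrt 2 / pi * sqrt x else 0))"

definition conv_in_prob :: "(nat \<Rightarrow> 'a measure) \<Rightarrow> (nat \<Rightarrow> 'a \<Rightarrow> real) \<Rightarrow> real \<Rightarrow> bool" where
  "conv_in_prob M X c \<longleftrightarrow>
     (\<forall>e>0. (\<lambda>n. measure (M n) {\<omega>\<in>space (M n). \<bar>X n \<omega> - c\<bar> > e}) \<longlonglongrightarrow> 0)"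

text \<open>In both notions below the random measures are functions \<open>\<nu> n\<close> of the outcome.  In the first,
  the outcomes for different \<open>n\<close> may live on different probability spaces \<open>M n\<close>.\<close>

definition weak_conv_in_prob_on_intervals ::
    "(nat \<Rightarrow> 'a measure) \<Rightarrow> (nat \<Rightarrow> 'a \<Rightarrow> real measure) \<Rightarrow> real measure \<Rightarrow> bool" where
  "weak_conv_in_prob_on_intervals M \<nu> \<mu> \<longleftrightarrow>
     (\<forall>a b. \<forall>f :: real \<Rightarrow> real. a \<le> b \<and> continuous_on {a..b} f \<longrightarrow>
        conv_in_prob M (\<lambda>n \<omega>. LINT x:{a..b}|\<nu> n \<omega>. f x) (LINT x:{a..b}|\<mu>. f x))"

definition vague_conv :: "(nat \<Rightarrow> real measure) \<Rightarrow> real measure \<Rightarrow> bool" where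
  "vague_conv \<nu> \<mu> \<longleftrightarrow>
     (\<forall>f :: real \<Rightarrow> real. continuous_on UNIV f \<and> compact (closure (support_on UNIV f)) \<longrightarrow>
        (\<lambda>n. \<integral>x. f x \<partial>\<nu> n) \<longlonglongrightarrow> (\<integral>x. f x \<partial>\<mu>))"

end

theory Submission
  imports Defs
begin

text \<open>
  Put \<open>S(z) = \<Sum>\<^sub>i 1/(z - \<lambda>\<^sub>i)\<close> and
  \<open>L = \<beta>/2 S\<^sup>2 + (1 - \<beta>/2) \<Sum>\<^sub>i 1/(z - \<lambda>\<^sub>i)\<^sup>2 - z/2 S + n/2\<close>.  Integration by parts against the joint
  density gives the loop equation \<open>E [G L + \<Sum>\<^sub>i \<partial>\<^sub>iG/(z - \<lambda>\<^sub>i)] = 0\<close> for every bounded smooth \<open>G\<close>.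
  The choice \<open>G = cnj L ^ (q+1) * L ^ q\<close> bounds all moments of \<open>L\<close>, and no separate variance or
  rigidity estimate is needed: with \<open>U = z/2 - \<beta> S\<close> the definition of \<open>L\<close> reads
  \<open>U\<^sup>2 = z\<^sup>2/4 - n \<beta> + 2 \<beta> L - \<beta> (2 - \<beta>) \<Sum>\<^sub>i 1/(z - \<lambda>\<^sub>i)\<^sup>2\<close>, and all error terms are controlled by \<open>U\<close>
  itself because \<open>Im U \<ge> \<beta> Im z \<Sum>\<^sub>i 1/\<bar>z - \<lambda>\<^sub>i\<bar>\<^sup>2\<close>.  At \<open>z = 2 sqrt (n \<beta>) (1 - \<zeta> r\<^sub>n)\<close> the relative error
  is of order \<open>\<kappa> = 1/(n r\<^sub>n\<^bsup>3/2\<^esup>)\<close>, in every moment.  As \<open>\<kappa>\<close> decays like a power of \<open>n\<close>, summing high moments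
  yields \<open>U\<^sup>2/(n \<beta> r\<^sub>n) \<longlonglongrightarrow> - 2 \<zeta>\<close> almost surely, whatever the coupling of the ensembles.  Taking the
  root with positive imaginary part identifies the limit of the Poisson integrals of \<open>\<mu>\<^sub>n\<close>, whose
  boundary values are \<open>\<pi> d\<mu>/dx\<close>, and hence the limit of \<open>\<mu>\<^sub>n\<close> on intervals.  Convergence in probability
  follows by realising the ensembles on a product space.
\<close>

section \<open>Integration by parts for the ensemble density\<close>

text \<open>The obstacle is that neither U nor the tails of the spectrum are bounded in advance. The
  moment recursion closes because the derivative of L in lambda_i is -U/(z - lambda_i)^2 + (2 -
  \<beta>)/(z - lambda_i)^3: the remainder in the loop equation is at most quadratic in |U|, while
  |U|^2 is in turn at most linear in |L|. In scaled form the moment of order 2q+2 is then bounded by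
  \<kappa>^2 times the moment of order 2q, large values being absorbed on the left. The condition
  \<beta> \<ge> 1 keeps |lambda_i - lambda_j| to the power \<beta> - 1, which appears on
  differentiating the weight, bounded near collisions. The partition function is never evaluated, as
  the loop equation is homogeneous in the weight. Since the total mass of mu_n diverges, ordinary
  tightness cannot lead from Poisson integrals to intervals; the integral of 1/(1 + t^2), itself one
  of the convergent Poisson integrals, controls the tails instead. Only countably many spectral
  parameters are tested, so that a single null set suffices, and a Harnack bound recovers all real
  points.\<close>

lemma integral_deriv_eq_0:
  fixes f f' :: "real \<Rightarrow> 'a::euclidean_space"
  assumes S: "finite S" and cont: "continuous_on UNIV f"
    and deriv: "\<And>u. u \<notin> S \<Longrightarrow> (f has_vector_derivative f' u) (at u)"
    and top: "(f \<longlongrightarrow> 0) at_top" and bot: "(f \<longlongrightarrow> 0) at_bot"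
  shows "(\<integral>u. f' u \<partial>lborel) = 0"
proof (cases "integrable lborel f'")
  case True
  have *: "(\<integral>u. indicator {-real N..real N} u *\<^sub>R f' u \<partial>lborel) = f (real N) - f (- real N)" for N
  proof -
    have i: "set_integrable lborel {-real N..real N} f'"
      unfolding set_integrable_def by (rule integrable_mult_indicator) (use True in auto)
    have "(f' has_integral (f (real N) - f (- real N))) {-real N..real N}"
      by (rule fundamental_theorem_of_calculus_interior_strong[OF S])
         (auto intro: deriv continuous_on_subset[OF cont])
    then show ?thesis
      using set_borel_integral_eq_integral(2)[OF i]
      by (simp add: set_lebesgue_integral_def integral_unique)
  qed
  have "(\<lambda>N. \<integral>u. indicator {-real N..real N} u *\<^sub>R f' u \<partial>lborel) \<longlonglongrightarrow> (\<integral>u. f' u \<partial>lborel)"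
  proof (rule integral_dominated_convergence[where w="\<lambda>u. norm (f' u)"])
    show "AE u in lborel. (\<lambda>N. indicator {-real N..real N} u *\<^sub>R f' u) \<longlonglongrightarrow> f' u"
    proof (rule AE_I2)
      fix u :: real
      have "\<forall>\<^sub>F N in sequentially. f' u = indicator {-real N..real N} u *\<^sub>R f' u"
        using eventually_ge_at_top[of "nat \<lceil>\<bar>u\<bar>\<rceil>"]
        by eventually_elim (auto simp: indicator_def; linarith)
      then show "(\<lambda>N. indicator {-real N..real N} u *\<^sub>R f' u) \<longlonglongrightarrow> f' u"
        by (rule Lim_transform_eventually[rotated]) simp
    qed
  qed (use True in \<open>auto simp: indicator_def\<close>)
  moreover have "(\<lambda>N. f (real N) - f (- real N)) \<longlonglongrightarrow> 0 - 0"
    by (intro tendsto_diff filterlim_compose[OF top] filterlim_compose[OF bot]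
        filterlim_real_sequentially filterlim_compose[OF filterlim_uminus_at_bot_at_top])
  ultimately show ?thesis
    unfolding * by (metis LIMSEQ_unique diff_zero)
\<comment> \<open>A function that is not integrable has Bochner integral 0 by convention. The lemma
  thus applies on every line of configuration space, without discarding exceptional lines
  first.\<close>
qed (simp add: not_integrable_integral_eq)

section \<open>Gaussian majorants in one variable\<close>

definition gauss_poly :: "nat \<Rightarrow> real \<Rightarrow> real" where
  "gauss_poly K t = (1 + \<bar>t\<bar>) ^ K * exp (- (1/4) * t\<^sup>2)"

lemma power_le_fact_exp:
  fixes x :: real assumes "x \<ge> 0" shows "x ^ K \<le> fact K * exp x"
proof -
  have "(\<lambda>n. x ^ n / fact n) sums exp x"
    using exp_converges[of x] by (simp add: field_simps)
  then have "(\<Sum>n\<in>{K}. x ^ n / fact n) \<le> exp x"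
    by (intro sum_le_suminf[of "\<lambda>n. x ^ n / fact n" "{K}", THEN order_trans])
       (use assms in \<open>auto simp: sums_iff\<close>)
  then show ?thesis by (simp add: field_simps)
qed

lemma gauss_poly_nonneg: "gauss_poly K t \<ge> 0"
  by (simp add: gauss_poly_def)

lemma gauss_poly_le: "gauss_poly K t \<le> fact K * exp 3 * exp (- t\<^sup>2 / 8)"
proof -
  \<comment> \<open>Half of the Gaussian exponent pays for the exponential growth: 1 + |t| - t^2/4
    \<le> 3 - t^2/8, whence the factor \<open>exp 3\<close>.\<close>
  have "\<bar>t\<bar> \<le> t\<^sup>2 / 8 + 2"
    using zero_le_power2[of "\<bar>t\<bar> - 4"] by (simp add: power2_diff)
  then have "exp (1 + \<bar>t\<bar>) * exp (- (1/4) * t\<^sup>2) \<le> exp 3 * exp (- t\<^sup>2 / 8)"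
    by (simp flip: exp_add)
  moreover have "gauss_poly K t \<le> fact K * exp (1 + \<bar>t\<bar>) * exp (- (1/4) * t\<^sup>2)"
    unfolding gauss_poly_def by (intro mult_right_mono power_le_fact_exp) auto
  ultimately show ?thesis
    by (smt (verit, best) fact_ge_zero mult.assoc mult_left_mono)
qed

lemma gauss_poly_integrable: "integrable lborel (gauss_poly K)"
proof (rule Bochner_Integration.integrable_bound)
  \<comment> \<open>Up to normalization, exp (- t^2/8) is the density of a centred normal law with
    standard deviation 2.\<close>
  show "integrable lborel (\<lambda>t. fact K * exp 3 * sqrt (2 * pi * 2\<^sup>2) * normal_density 0 2 t)"
    by (intro integrable_mult_right) simp
  show "AE t in lborel. norm (gauss_poly K t) \<le> norm (fact K * exp 3 * sqrt (2 * pi * 2\<^sup>2) * normal_density 0 2 t)"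
    using gauss_poly_le[of K] by (intro AE_I2) (simp add: normal_density_def gauss_poly_nonneg abs_mult mult.assoc)
qed (auto simp: gauss_poly_def[abs_def])

lemma gauss_poly_at_top: "(gauss_poly K \<longlongrightarrow> 0) at_top" and gauss_poly_at_bot: "(gauss_poly K \<longlongrightarrow> 0) at_bot"
proof -
  have f: "((\<lambda>t::real. fact K * exp 3 * exp (- (t\<^sup>2 / 8))) \<longlongrightarrow> 0) F"
    if "LIM t F. t\<^sup>2 :> at_top" for F
  proof (rule tendsto_mult_right_zero)
    have "LIM t F. t\<^sup>2 / 8 :> at_top"
      using filterlim_tendsto_pos_mult_at_top[OF tendsto_const _ that, of "1/8"] by simp
    then show "((\<lambda>t::real. exp (- (t\<^sup>2 / 8))) \<longlongrightarrow> 0) F"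
      by (intro filterlim_compose[OF exp_at_bot] filterlim_compose[OF filterlim_uminus_at_bot_at_top])
  qed
  show "(gauss_poly K \<longlongrightarrow> 0) at_top"
    by (rule tendsto_sandwich[OF _ _ tendsto_const f])
       (use gauss_poly_le[of K] in \<open>auto intro!: always_eventually filterlim_pow_at_top filterlim_ident simp: gauss_poly_nonneg\<close>)
  show "(gauss_poly K \<longlongrightarrow> 0) at_bot"
    by (rule tendsto_sandwich[OF _ _ tendsto_const f])
       (use gauss_poly_le[of K] in \<open>auto intro!: always_eventually filterlim_pow_at_bot_even filterlim_ident simp: gauss_poly_nonneg\<close>)
qed

section \<open>The weight and its logarithmic derivative\<close>

definition index_pairs :: "nat \<Rightarrow> (nat \<times> nat) set" where
  "index_pairs n = (SIGMA i:{1..n}. {i<..n})"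

lemma finite_index_pairs [simp]: "finite (index_pairs n)"
  by (simp add: index_pairs_def)

lemma index_pairsD: "(a, b) \<in> index_pairs n \<Longrightarrow> a \<in> {1..n} \<and> b \<in> {1..n} \<and> a < b"
  by (auto simp: index_pairs_def)

lemma gbe_weight_pairs:
  "gbe_weight n \<beta> x = (\<Prod>(a,b)\<in>index_pairs n. \<bar>x a - x b\<bar> powr \<beta>) * exp (- (1/4) * (\<Sum>i\<in>{1..n}. (x i)\<^sup>2))"
  by (simp add: gbe_weight_def index_pairs_def prod.Sigma)

lemma gbe_weight_nonneg: "gbe_weight n \<beta> x \<ge> 0"
  by (auto simp: gbe_weight_def intro!: mult_nonneg_nonneg prod_nonneg)

lemma coord_measurable:
  "i \<in> I \<Longrightarrow> (\<lambda>x. x i) \<in> borel_measurable (Pi\<^sub>M I (\<lambda>_. lborel))"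
  using measurable_component_singleton[of i I "\<lambda>_. lborel"] by simp

lemma gbe_weight_measurable [measurable]:
  "gbe_weight n \<beta> \<in> borel_measurable (Pi\<^sub>M {1..n} (\<lambda>_. lborel))"
proof -
  have "(\<lambda>x. case p of (a, b) \<Rightarrow> \<bar>x a - x b\<bar> powr \<beta>) \<in> borel_measurable (Pi\<^sub>M {1..n} (\<lambda>_. lborel))"
    if p: "p \<in> index_pairs n" for p
  proof -
    obtain a b where ab: "p = (a, b)" by (cases p)
    then have "a \<in> {1..n}" "b \<in> {1..n}" using p by (auto dest: index_pairsD)
    note this[THEN coord_measurable, measurable]
    show ?thesis unfolding ab prod.case by measurable
  qed
  then have 1: "(\<lambda>x. \<Prod>p\<in>index_pairs n. case p of (a, b) \<Rightarrow> \<bar>x a - x b\<bar> powr \<beta>) \<in> borel_measurable (Pi\<^sub>M {1..n} (\<lambda>_. lborel))"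
    by (rule borel_measurable_prod)
  have 2: "(\<lambda>x. \<Sum>i\<in>{1..n}. (x i)\<^sup>2) \<in> borel_measurable (Pi\<^sub>M {1..n} (\<lambda>_. lborel :: real measure))"
    unfolding power2_eq_square by (intro borel_measurable_sum borel_measurable_times coord_measurable)
  show ?thesis
    unfolding gbe_weight_pairs[abs_def] using 1 2 by measurable
qed

text \<open>The logarithmic derivative of the weight in the direction \<open>i\<close>; on the null set where two
  coordinates agree, the singular summands are read as \<open>0\<close>.\<close>

definition gbe_dlog :: "nat \<Rightarrow> real \<Rightarrow> nat \<Rightarrow> (nat \<Rightarrow> real) \<Rightarrow> real" where
  "gbe_dlog n \<beta> i x = (\<Sum>(a,b)\<in>index_pairs n. \<beta> / (x a - x b) * (of_bool (a = i) - of_bool (b = i))) - x i / 2"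

lemma gbe_dlog_measurable:
  assumes "i \<in> {1..n}"
  shows "gbe_dlog n \<beta> i \<in> borel_measurable (Pi\<^sub>M {1..n} (\<lambda>_. lborel))"
proof -
  have "(\<lambda>x. case p of (a, b) \<Rightarrow> \<beta> / (x a - x b) * (of_bool (a = i) - of_bool (b = i)))
      \<in> borel_measurable (Pi\<^sub>M {1..n} (\<lambda>_. lborel))" if p: "p \<in> index_pairs n" for p
  proof -
    obtain a b where ab: "p = (a, b)" by (cases p)
    then have "a \<in> {1..n}" "b \<in> {1..n}" using p by (auto dest: index_pairsD)
    note this[THEN coord_measurable, measurable]
    show ?thesis unfolding ab prod.case by measurable
  qed
  then have 1: "(\<lambda>x. \<Sum>p\<in>index_pairs n. case p of (a, b) \<Rightarrow> \<beta> / (x a - x b) * (of_bool (a = i) - of_bool (b = i)))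
      \<in> borel_measurable (Pi\<^sub>M {1..n} (\<lambda>_. lborel))"
    by (rule borel_measurable_sum)
  note coord_measurable[OF assms, measurable]
  show ?thesis
    unfolding gbe_dlog_def[abs_def] using 1 by measurable
qed

text \<open>Writing each derivative as \<open>f p u * l p\<close> gives the logarithmic product rule
  without dividing by a factor, so factors that vanish at \<open>u\<close> are allowed.\<close>

lemma DERIV_prod_log:
  fixes f :: "'i \<Rightarrow> real \<Rightarrow> real"
  assumes "finite A" "\<And>p. p \<in> A \<Longrightarrow> (f p has_real_derivative (f p u * l p)) (at u)"
  shows "((\<lambda>v. \<Prod>p\<in>A. f p v) has_real_derivative ((\<Prod>p\<in>A. f p u) * (\<Sum>p\<in>A. l p))) (at u)"
  using assms
proof (induction A rule: finite_induct)
  case (insert p A)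
  have "((\<lambda>v. f p v * (\<Prod>p\<in>A. f p v)) has_real_derivative
     (f p u * l p * (\<Prod>p\<in>A. f p u) + (\<Prod>p\<in>A. f p u) * (\<Sum>p\<in>A. l p) * f p u)) (at u)"
    by (rule DERIV_mult) (use insert in auto)
  then show ?case using insert by (simp add: algebra_simps)
qed auto

lemma DERIV_abs_diff_powr:
  fixes u c \<beta> :: real
  assumes "u \<noteq> c"
  shows "((\<lambda>v. \<bar>v - c\<bar> powr \<beta>) has_real_derivative (\<bar>u - c\<bar> powr \<beta> * (\<beta> / (u - c)))) (at u)"
proof (cases "u > c")
  case True
  have "((\<lambda>v. (v - c) powr \<beta>) has_real_derivative (\<bar>u - c\<bar> powr \<beta> * (\<beta> / (u - c)))) (at u)"
    using True by (auto intro!: derivative_eq_intros simp: field_simps powr_diff powr_add)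
  then show ?thesis
    by (rule has_field_derivative_transform_within[where d="u - c"])
       (use True in \<open>auto simp: dist_real_def\<close>)
next
  case False
  have "((\<lambda>v. (c - v) powr \<beta>) has_real_derivative (\<bar>u - c\<bar> powr \<beta> * (\<beta> / (u - c)))) (at u)"
    using False assms by (auto intro!: derivative_eq_intros simp: field_simps powr_diff powr_add)
  then show ?thesis
    by (rule has_field_derivative_transform_within[where d="c - u"])
       (use False assms in \<open>auto simp: dist_real_def\<close>)
qed

text \<open>Only collisions with the moving coordinate have to be excluded. A pair of frozen
  coordinates contributes a constant factor, possibly 0, and both Boolean terms of
  \<open>gbe_dlog\<close> vanish for it.\<close>

lemma gbe_weight_deriv:
  assumes i: "i \<in> {1..n}" and u: "u \<notin> x ` ({1..n} - {i})"
  shows "((\<lambda>v. gbe_weight n \<beta> (x(i := v))) has_real_derivative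
     (gbe_weight n \<beta> (x(i := u)) * gbe_dlog n \<beta> i (x(i := u)))) (at u)"
proof -
  let ?f = "\<lambda>p v. case p of (a, b) \<Rightarrow> \<bar>(x(i:=v)) a - (x(i:=v)) b\<bar> powr \<beta>"
  let ?l = "\<lambda>(a,b). \<beta> / ((x(i:=u)) a - (x(i:=u)) b) * (of_bool (a = i) - of_bool (b = i))"
  have 1: "((\<lambda>v. \<Prod>p\<in>index_pairs n. ?f p v) has_real_derivative
      ((\<Prod>p\<in>index_pairs n. ?f p u) * (\<Sum>p\<in>index_pairs n. ?l p))) (at u)"
  proof (rule DERIV_prod_log)
    fix p assume "p \<in> index_pairs n"
    then obtain a b where p: "p = (a, b)" and ab: "a \<in> {1..n}" "b \<in> {1..n}" "a < b"
      by (cases p) (auto dest: index_pairsD)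
    consider "a = i" | "b = i" | "a \<noteq> i" "b \<noteq> i" by blast
    then show "(?f p has_real_derivative (?f p u * ?l p)) (at u)"
    proof cases
      case 1
      then have "u \<noteq> x b" using u ab by auto
      with DERIV_abs_diff_powr[OF this, of \<beta>] show ?thesis using 1 ab by (simp add: p)
    next
      case 2
      then have "u \<noteq> x a" using u ab by auto
      moreover have "\<beta> / (u - x a) = \<beta> / (x a - u) * (0 - 1)"
        using divide_minus_right[of \<beta> "x a - u"] by simp
      ultimately show ?thesis
        using DERIV_abs_diff_powr[of u "x a" \<beta>] 2 ab by (simp add: p abs_minus_commute)
    next
      case 3
      then show ?thesis by (simp add: p)
    qed
  qed simp
  have 2: "((\<lambda>v. exp (- (1/4) * (\<Sum>k\<in>{1..n}. ((x(i:=v)) k)\<^sup>2))) has_real_derivative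
     exp (- (1/4) * (\<Sum>k\<in>{1..n}. ((x(i:=u)) k)\<^sup>2)) * (- u / 2)) (at u)"
  proof -
    have *: "(\<Sum>k\<in>{1..n}. ((x(i:=v)) k)\<^sup>2) = v\<^sup>2 + (\<Sum>k\<in>{1..n}-{i}. (x k)\<^sup>2)" for v
      using i by (subst sum.remove[of _ i]) auto
    show ?thesis unfolding * by (auto intro!: derivative_eq_intros)
  qed
  show ?thesis
    unfolding gbe_weight_pairs gbe_dlog_def
    by (rule DERIV_cong[OF DERIV_mult[OF 1 2]]) (simp only: fun_upd_same, simp add: algebra_simps)
qed

lemma gbe_weight_continuous:
  assumes "\<beta> > 0"
  shows "continuous_on UNIV (\<lambda>v. gbe_weight n \<beta> (x(i := v)))"
proof -
  have *: "continuous_on UNIV (\<lambda>v. (x(i := v)) k)" for k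
    by (cases "k = i") auto
  show ?thesis unfolding gbe_weight_def
    by (intro continuous_intros continuous_on_powr' *) (use assms in auto)
qed

section \<open>Integrable majorants of the weight and of its derivative\<close>

text \<open>The product (1 + |s|)(1 + |t|) dominates |s - t| and is at least 1, so the real exponent
  may be rounded up to a natural number. It also separates the variables, which is what makes a
  product majorant possible.\<close>

lemma abs_diff_powr_le:
  fixes s t \<beta> :: real
  assumes "0 \<le> \<beta>" "\<beta> \<le> real m"
  shows "\<bar>s - t\<bar> powr \<beta> \<le> ((1 + \<bar>s\<bar>) * (1 + \<bar>t\<bar>)) ^ m"
proof -
  have 1: "1 \<le> (1 + \<bar>s\<bar>) * (1 + \<bar>t\<bar>)" "\<bar>s - t\<bar> \<le> (1 + \<bar>s\<bar>) * (1 + \<bar>t\<bar>)"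
    using abs_triangle_ineq4[of s t] mult_nonneg_nonneg[OF abs_ge_zero[of s] abs_ge_zero[of t]]
    unfolding ring_distribs by linarith+
  have "\<bar>s - t\<bar> powr \<beta> \<le> ((1 + \<bar>s\<bar>) * (1 + \<bar>t\<bar>)) powr \<beta>"
    using 1 assms by (intro powr_mono2) auto
  also have "\<dots> \<le> ((1 + \<bar>s\<bar>) * (1 + \<bar>t\<bar>)) powr real m"
    using 1 assms by (intro powr_mono) auto
  also have "\<dots> = ((1 + \<bar>s\<bar>) * (1 + \<bar>t\<bar>)) ^ m"
    using 1 by (subst powr_realpow) auto
  finally show ?thesis .
qed

lemma prod_pairs_le:
  fixes y :: "nat \<Rightarrow> real"
  assumes y: "\<And>k. y k \<ge> 1" and F: "\<And>p. p \<in> index_pairs n \<Longrightarrow> 0 \<le> F p"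
    "\<And>a b. (a, b) \<in> index_pairs n \<Longrightarrow> F (a, b) \<le> (y a * y b) ^ m"
  shows "(\<Prod>p\<in>index_pairs n. F p) \<le> (\<Prod>k\<in>{1..n}. y k) ^ (m * card (index_pairs n))"
proof -
  have "(\<Prod>p\<in>index_pairs n. F p) \<le> (\<Prod>p\<in>index_pairs n. (\<Prod>k\<in>{1..n}. y k) ^ m)"
  proof (intro prod_mono conjI F)
    fix p assume p: "p \<in> index_pairs n"
    obtain a b where [simp]: "p = (a,b)" by (cases p)
    have ab: "a \<in> {1..n}" "b \<in> {1..n}" "a \<noteq> b" using p by (auto dest: index_pairsD)
    have "y a * y b = (\<Prod>k\<in>{a,b}. y k)" using ab by simp
    also have "\<dots> \<le> (\<Prod>k\<in>{1..n}. y k)"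
      by (rule prod_mono2) (use ab y in \<open>auto intro: order_trans[OF zero_le_one]\<close>)
    finally have "(y a * y b) ^ m \<le> (\<Prod>k\<in>{1..n}. y k) ^ m"
      using y[of a] y[of b] by (intro power_mono) auto
    then show "F p \<le> (\<Prod>k\<in>{1..n}. y k) ^ m" using F(2)[of a b] p by simp
  qed
  then show ?thesis by (simp add: power_mult)
qed

text \<open>A product of one-variable functions, so that integrability and decay along a coordinate
  axis reduce to \<open>gauss_poly\<close>. The rounded exponent times the number of pairs covers
  the Vandermonde factor; the additional 1 pays for the factor \<open>x i\<close> from
  differentiating the Gaussian.\<close>

definition gbe_bound :: "nat \<Rightarrow> real \<Rightarrow> (nat \<Rightarrow> real) \<Rightarrow> real" where
  "gbe_bound n \<beta> x = (\<Prod>k\<in>{1..n}. gauss_poly (nat \<lceil>\<beta>\<rceil> * card (index_pairs n) + 1) (x k))"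

lemma gbe_bound_eq:
  "gbe_bound n \<beta> x = (\<Prod>k\<in>{1..n}. 1 + \<bar>x k\<bar>) ^ (nat \<lceil>\<beta>\<rceil> * card (index_pairs n)) * (\<Prod>k\<in>{1..n}. 1 + \<bar>x k\<bar>)
     * exp (- (1/4) * (\<Sum>i\<in>{1..n}. (x i)\<^sup>2))"
proof -
  have "exp (- (1/4) * (\<Sum>i\<in>{1..n}. (x i)\<^sup>2)) = (\<Prod>i\<in>{1..n}. exp (- (1/4) * (x i)\<^sup>2))"
    unfolding sum_distrib_left by (rule exp_sum) simp
  then show ?thesis
    unfolding gbe_bound_def gauss_poly_def prod.distrib by (simp only: prod.distrib prod_power_distrib[symmetric] power_add power_one_right)
qed

lemma prod_one_plus_ge_1: "(\<Prod>k\<in>A. 1 + \<bar>x k :: real\<bar>) \<ge> 1"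
  by (intro prod_ge_1) auto

lemma gbe_vandermonde_le:
  fixes x :: "nat \<Rightarrow> real"
  assumes "\<beta> \<ge> 1"
  shows "(\<Prod>p\<in>index_pairs n. case p of (a,b) \<Rightarrow> \<bar>x a - x b\<bar> powr \<beta>)
    \<le> (\<Prod>k\<in>{1..n}. 1 + \<bar>x k\<bar>) ^ (nat \<lceil>\<beta>\<rceil> * card (index_pairs n))"
proof (rule prod_pairs_le[where F="\<lambda>p. case p of (a,b) \<Rightarrow> \<bar>x a - x b\<bar> powr \<beta>" and y="\<lambda>k. 1 + \<bar>x k\<bar>"], goal_cases)
  case (3 a b)
  have "real (nat \<lceil>\<beta>\<rceil>) \<ge> \<beta>" by linarith
  then show "(case (a, b) of (a, b) \<Rightarrow> \<bar>x a - x b\<bar> powr \<beta>) \<le> ((1 + \<bar>x a\<bar>) * (1 + \<bar>x b\<bar>)) ^ nat \<lceil>\<beta>\<rceil>"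
    unfolding prod.case using assms by (intro abs_diff_powr_le) auto
qed (auto split: prod.splits)

lemma gbe_weight_le:
  assumes "\<beta> \<ge> 1"
  shows "gbe_weight n \<beta> x \<le> gbe_bound n \<beta> x"
proof -
  let ?Y = "\<Prod>k\<in>{1..n}. 1 + \<bar>x k\<bar>"
  have "(\<Prod>p\<in>index_pairs n. case p of (a,b) \<Rightarrow> \<bar>x a - x b\<bar> powr \<beta>) \<le> ?Y ^ (nat \<lceil>\<beta>\<rceil> * card (index_pairs n))"
    by (rule gbe_vandermonde_le[OF assms])
  also have "\<dots> \<le> ?Y ^ (nat \<lceil>\<beta>\<rceil> * card (index_pairs n)) * ?Y"
    using prod_one_plus_ge_1[of x "{1..n}"] by (simp add: mult_le_cancel_left1)
  finally show ?thesis
    unfolding gbe_weight_pairs gbe_bound_eq by (intro mult_right_mono) auto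
qed

text \<open>Here \<beta> \<ge> 1 enters: division lowers the exponent of a single pair to \<beta> -
  1, which is still nonnegative, so the singularity of the logarithmic derivative is harmless. On
  the collision set itself the quotient is 0 by convention.\<close>

lemma gbe_weight_divide_le:
  assumes "\<beta> \<ge> 1" and ab: "(a, b) \<in> index_pairs n"
  shows "gbe_weight n \<beta> x / \<bar>x a - x b\<bar> \<le> gbe_bound n \<beta> x"
proof -
  let ?Y = "\<Prod>k\<in>{1..n}. 1 + \<bar>x k\<bar>"
  \<comment> \<open>The exponent is lowered by 1 for the pair \<open>(a, b)\<close> only.\<close>
  let ?F = "\<lambda>p. \<bar>x (fst p) - x (snd p)\<bar> powr (\<beta> - of_bool (p = (a, b)))"
  have *: "(\<Prod>p\<in>index_pairs n. case p of (a,b) \<Rightarrow> \<bar>x a - x b\<bar> powr \<beta>) / \<bar>x a - x b\<bar> \<le> (\<Prod>p\<in>index_pairs n. ?F p)"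
  proof -
    let ?rest = "\<Prod>p\<in>index_pairs n - {(a,b)}. case p of (a,b) \<Rightarrow> \<bar>x a - x b\<bar> powr \<beta>"
    have "(\<Prod>p\<in>index_pairs n. ?F p) = \<bar>x a - x b\<bar> powr (\<beta> - 1) * (\<Prod>p\<in>index_pairs n - {(a,b)}. ?F p)"
      using ab by (subst prod.remove[of _ "(a,b)"]) auto
    also have "(\<Prod>p\<in>index_pairs n - {(a,b)}. ?F p) = ?rest"
      by (rule prod.cong) auto
    finally show ?thesis
      using ab by (subst prod.remove[of _ "(a,b)"]) (auto simp: powr_diff)
  qed
  have "(\<Prod>p\<in>index_pairs n. ?F p) \<le> ?Y ^ (nat \<lceil>\<beta>\<rceil> * card (index_pairs n))"
  proof (rule prod_pairs_le)
    fix c d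
    have "real (nat \<lceil>\<beta>\<rceil>) \<ge> \<beta>" by linarith
    then show "?F (c, d) \<le> ((1 + \<bar>x c\<bar>) * (1 + \<bar>x d\<bar>)) ^ nat \<lceil>\<beta>\<rceil>"
      unfolding fst_conv snd_conv using assms(1) by (intro abs_diff_powr_le) (auto simp: of_bool_def, linarith)
  qed auto
  also have "\<dots> \<le> ?Y ^ (nat \<lceil>\<beta>\<rceil> * card (index_pairs n)) * ?Y"
    using prod_one_plus_ge_1[of x "{1..n}"] by (simp add: mult_le_cancel_left1)
  finally have "(\<Prod>p\<in>index_pairs n. case p of (a,b) \<Rightarrow> \<bar>x a - x b\<bar> powr \<beta>) / \<bar>x a - x b\<bar> \<le> \<dots>"
    using * by linarith
  then have "(\<Prod>p\<in>index_pairs n. case p of (a,b) \<Rightarrow> \<bar>x a - x b\<bar> powr \<beta>) / \<bar>x a - x b\<bar> *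
      exp (- (1/4) * (\<Sum>i\<in>{1..n}. (x i)\<^sup>2)) \<le> gbe_bound n \<beta> x"
    unfolding gbe_bound_eq by (intro mult_right_mono) auto
  then show ?thesis
    unfolding gbe_weight_pairs by (simp add: field_simps)
qed

lemma gbe_weight_times_le:
  assumes "\<beta> \<ge> 1" and i: "i \<in> {1..n}"
  shows "gbe_weight n \<beta> x * \<bar>x i\<bar> \<le> gbe_bound n \<beta> x"
proof -
  let ?Y = "\<Prod>k\<in>{1..n}. 1 + \<bar>x k\<bar>"
  have 1: "(\<Prod>p\<in>index_pairs n. case p of (a,b) \<Rightarrow> \<bar>x a - x b\<bar> powr \<beta>) \<le> ?Y ^ (nat \<lceil>\<beta>\<rceil> * card (index_pairs n))"
    by (rule gbe_vandermonde_le[OF assms(1)])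
  have "(\<Prod>k\<in>{i}. 1 + \<bar>x k\<bar>) \<le> ?Y" using i by (intro prod_mono2) auto
  then have 2: "\<bar>x i\<bar> \<le> ?Y" by simp
  have "(\<Prod>p\<in>index_pairs n. case p of (a,b) \<Rightarrow> \<bar>x a - x b\<bar> powr \<beta>) * \<bar>x i\<bar> \<le>
     ?Y ^ (nat \<lceil>\<beta>\<rceil> * card (index_pairs n)) * ?Y"
    by (intro mult_mono 1 2 zero_le_power prod_nonneg) auto
  then have "((\<Prod>p\<in>index_pairs n. case p of (a,b) \<Rightarrow> \<bar>x a - x b\<bar> powr \<beta>) * \<bar>x i\<bar>) *
      exp (- (1/4) * (\<Sum>i\<in>{1..n}. (x i)\<^sup>2)) \<le> gbe_bound n \<beta> x"
    unfolding gbe_bound_eq by (intro mult_right_mono) auto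
  then show ?thesis
    unfolding gbe_weight_pairs by (simp add: mult_ac)
qed

lemma gbe_weight_dlog_le:
  assumes "\<beta> \<ge> 1" and i: "i \<in> {1..n}"
  shows "\<bar>gbe_weight n \<beta> x * gbe_dlog n \<beta> i x\<bar> \<le> (\<beta> * real (card (index_pairs n)) + 1) * gbe_bound n \<beta> x"
proof -
  have "\<bar>gbe_weight n \<beta> x * (\<Sum>(a,b)\<in>index_pairs n. \<beta> / (x a - x b) * (of_bool (a = i) - of_bool (b = i)))\<bar>
     \<le> (\<Sum>p\<in>index_pairs n. \<beta> * gbe_bound n \<beta> x)"
    unfolding sum_distrib_left
  proof (intro order_trans[OF sum_abs] sum_mono)
    fix p assume p: "p \<in> index_pairs n"
    obtain a b where [simp]: "p = (a,b)" by (cases p)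
    have "\<bar>gbe_weight n \<beta> x * (\<beta> / (x a - x b) * (of_bool (a = i) - of_bool (b = i)))\<bar>
       \<le> \<beta> * (gbe_weight n \<beta> x / \<bar>x a - x b\<bar>)"
      using assms gbe_weight_nonneg[of n \<beta> x] by (auto simp: abs_mult mult.commute)
    also have "\<dots> \<le> \<beta> * gbe_bound n \<beta> x"
      using gbe_weight_divide_le[OF assms(1), of a b n x] p assms by (intro mult_left_mono) auto
    finally show "\<bar>gbe_weight n \<beta> x * (case p of (a,b) \<Rightarrow> \<beta> / (x a - x b) * (of_bool (a = i) - of_bool (b = i)))\<bar>
       \<le> \<beta> * gbe_bound n \<beta> x" by simp
  qed
  moreover have "\<bar>gbe_weight n \<beta> x * (x i / 2)\<bar> \<le> gbe_bound n \<beta> x"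
    using gbe_weight_times_le[OF assms, of x] mult_nonneg_nonneg[OF gbe_weight_nonneg[of n \<beta> x] abs_ge_zero[of "x i"]]
      abs_of_nonneg[OF gbe_weight_nonneg[of n \<beta> x]]
    unfolding abs_mult abs_divide by linarith
  ultimately show ?thesis
    unfolding gbe_dlog_def right_diff_distrib by (simp add: algebra_simps)
qed

interpretation lborel_prod: product_sigma_finite "\<lambda>_::nat. lborel :: real measure"
  by standard

lemma gbe_bound_integrable: "integrable (Pi\<^sub>M {1..n} (\<lambda>_. lborel)) (gbe_bound n \<beta>)"
  unfolding gbe_bound_def[abs_def]
  by (intro lborel_prod.product_integrable_prod gauss_poly_integrable) simp

lemma gbe_bound_tendsto_0:
  assumes i: "i \<in> {1..n}"
  shows "((\<lambda>v. gbe_bound n \<beta> (x(i := v))) \<longlongrightarrow> 0) at_top" "((\<lambda>v. gbe_bound n \<beta> (x(i := v))) \<longlongrightarrow> 0) at_bot"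
proof -
  define K where "K = nat \<lceil>\<beta>\<rceil> * card (index_pairs n) + 1"
  have "gbe_bound n \<beta> (x(i := v)) = gauss_poly K v * (\<Prod>k\<in>{1..n}-{i}. gauss_poly K (x k))" for v
    unfolding gbe_bound_def K_def using i by (subst prod.remove[of _ i]) auto
  then show "((\<lambda>v. gbe_bound n \<beta> (x(i := v))) \<longlongrightarrow> 0) at_top" "((\<lambda>v. gbe_bound n \<beta> (x(i := v))) \<longlongrightarrow> 0) at_bot"
    by (auto intro!: tendsto_mult_left_zero gauss_poly_at_top gauss_poly_at_bot)
qed

text \<open>By Fubini with coordinate \<open>i\<close> innermost, each inner integrand is, off
  finitely many collision points, the derivative of weight times \<open>\<phi>\<close>, a continuous
  function that vanishes at both ends. Domination by \<open>gbe_bound\<close> provides the joint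
  integrability that Fubini requires.\<close>

lemma gbe_integration_by_parts:
  fixes \<phi> \<phi>' :: "(nat \<Rightarrow> real) \<Rightarrow> complex"
  assumes \<beta>: "\<beta> \<ge> 1" and i: "i \<in> {1..n}"
    and meas [measurable]: "\<phi> \<in> borel_measurable (Pi\<^sub>M {1..n} (\<lambda>_. lborel))"
      "\<phi>' \<in> borel_measurable (Pi\<^sub>M {1..n} (\<lambda>_. lborel))"
    and bnd: "\<And>x. norm (\<phi> x) \<le> C" "\<And>x. norm (\<phi>' x) \<le> C"
    and deriv: "\<And>x u. ((\<lambda>v. \<phi> (x(i := v))) has_vector_derivative \<phi>' (x(i := u))) (at u)"
  shows "integrable (Pi\<^sub>M {1..n} (\<lambda>_. lborel)) (\<lambda>x. (gbe_weight n \<beta> x * gbe_dlog n \<beta> i x) *\<^sub>R \<phi> x + gbe_weight n \<beta> x *\<^sub>R \<phi>' x)"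
    and "(\<integral>x. (gbe_weight n \<beta> x * gbe_dlog n \<beta> i x) *\<^sub>R \<phi> x + gbe_weight n \<beta> x *\<^sub>R \<phi>' x \<partial>Pi\<^sub>M {1..n} (\<lambda>_. lborel)) = 0"
proof -
  let ?w = "gbe_weight n \<beta>" and ?d = "gbe_dlog n \<beta> i" and ?P = "Pi\<^sub>M {1..n} (\<lambda>_. lborel) :: (nat \<Rightarrow> real) measure"
  have [measurable]: "?d \<in> borel_measurable ?P" by (rule gbe_dlog_measurable[OF i])
  have C: "C \<ge> 0" using norm_ge_zero order_trans bnd(1) by blast
  let ?F = "\<lambda>x. (?w x * ?d x) *\<^sub>R \<phi> x + ?w x *\<^sub>R \<phi>' x"
  show int: "integrable ?P ?F"
  proof (rule Bochner_Integration.integrable_bound)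
    show "integrable ?P (\<lambda>x. ((\<beta> * real (card (index_pairs n)) + 1) * C + C) * gbe_bound n \<beta> x)"
      by (intro integrable_mult_right gbe_bound_integrable)
    show "AE x in ?P. norm (?F x) \<le> norm (((\<beta> * real (card (index_pairs n)) + 1) * C + C) * gbe_bound n \<beta> x)"
    proof (rule AE_I2)
      fix x
      have "norm (?F x) \<le> \<bar>?w x * ?d x\<bar> * norm (\<phi> x) + ?w x * norm (\<phi>' x)"
        using gbe_weight_nonneg[of n \<beta> x] by (intro norm_triangle_le) simp
      also have "\<dots> \<le> ((\<beta> * real (card (index_pairs n)) + 1) * gbe_bound n \<beta> x) * C + gbe_bound n \<beta> x * C"
        using gbe_weight_nonneg[of n \<beta> x] gbe_weight_le[OF \<beta>, of n x] \<beta> C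
        by (intro add_mono mult_mono bnd gbe_weight_dlog_le[OF \<beta> i] gbe_weight_le \<beta>) auto
      also have "\<dots> = ((\<beta> * real (card (index_pairs n)) + 1) * C + C) * gbe_bound n \<beta> x"
        by (simp add: algebra_simps)
      finally show "norm (?F x) \<le> norm (((\<beta> * real (card (index_pairs n)) + 1) * C + C) * gbe_bound n \<beta> x)"
        by simp
    qed
  qed measurable
  have 0: "(\<integral>u. ?F (x(i := u)) \<partial>lborel) = 0" for x
  \<comment> \<open>The exceptional points are the values of the other coordinates; there the weight
    is continuous but may fail to be differentiable.\<close>
  proof (rule integral_deriv_eq_0[where f="\<lambda>v. ?w (x(i := v)) *\<^sub>R \<phi> (x(i := v))" and S="x ` ({1..n} - {i})"])
    have "continuous_on UNIV (\<lambda>v. \<phi> (x(i := v)))"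
      using deriv by (intro continuous_at_imp_continuous_on) (auto intro: has_vector_derivative_continuous)
    then show "continuous_on UNIV (\<lambda>v. ?w (x(i := v)) *\<^sub>R \<phi> (x(i := v)))"
      using \<beta> by (intro continuous_intros gbe_weight_continuous) auto
    fix u assume u: "u \<notin> x ` ({1..n} - {i})"
    show "((\<lambda>v. ?w (x(i := v)) *\<^sub>R \<phi> (x(i := v))) has_vector_derivative ?F (x(i := u))) (at u)"
      using has_vector_derivative_scaleR[OF gbe_weight_deriv[OF i u, of \<beta>] deriv, of x]
      by (simp add: add.commute)
  next
    have le: "norm (?w (x(i := v)) *\<^sub>R \<phi> (x(i := v))) \<le> norm (gbe_bound n \<beta> (x(i := v))) * C" for v
      using gbe_weight_nonneg[of n \<beta> "x(i := v)"] gbe_weight_le[OF \<beta>, of n "x(i := v)"] bnd(1)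
      by (auto intro!: mult_mono)
    show "((\<lambda>v. ?w (x(i := v)) *\<^sub>R \<phi> (x(i := v))) \<longlongrightarrow> 0) at_top"
      by (rule tendsto_0_le[OF gbe_bound_tendsto_0(1)[OF i] always_eventually]) (use le in blast)
    show "((\<lambda>v. ?w (x(i := v)) *\<^sub>R \<phi> (x(i := v))) \<longlongrightarrow> 0) at_bot"
      by (rule tendsto_0_le[OF gbe_bound_tendsto_0(2)[OF i] always_eventually]) (use le in blast)
  qed simp
  have ins: "insert i ({1..n} - {i}) = {1..n}" using i by auto
  have "integral\<^sup>L ?P ?F = (\<integral>x. (\<integral>u. ?F (x(i := u)) \<partial>lborel) \<partial>Pi\<^sub>M ({1..n} - {i}) (\<lambda>_. lborel))"
    using lborel_prod.product_integral_insert[of "{1..n} - {i}" i ?F] int unfolding ins by simp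
  then show "integral\<^sup>L ?P ?F = 0" unfolding 0 by simp
qed

section \<open>Loop equation\<close>

declare One_nat_def [simp del]

abbreviation config_lborel :: "nat \<Rightarrow> (nat \<Rightarrow> real) measure" where
  "config_lborel n \<equiv> Pi\<^sub>M {1..n} (\<lambda>_. lborel)"

definition resolvent :: "complex \<Rightarrow> (nat \<Rightarrow> real) \<Rightarrow> nat \<Rightarrow> complex" where
  "resolvent z x i = 1 / (z - of_real (x i))"

definition res_sum :: "nat \<Rightarrow> complex \<Rightarrow> (nat \<Rightarrow> real) \<Rightarrow> complex" where
  "res_sum n z x = (\<Sum>i\<in>{1..n}. resolvent z x i)"

definition res_sum2 :: "nat \<Rightarrow> complex \<Rightarrow> (nat \<Rightarrow> real) \<Rightarrow> complex" where
  "res_sum2 n z x = (\<Sum>i\<in>{1..n}. (resolvent z x i)\<^sup>2)"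

definition loop_expr :: "nat \<Rightarrow> real \<Rightarrow> complex \<Rightarrow> (nat \<Rightarrow> real) \<Rightarrow> complex" where
  "loop_expr n \<beta> z x = (of_real \<beta> / 2) * (res_sum n z x)\<^sup>2 + (1 - of_real \<beta> / 2) * res_sum2 n z x
     - z / 2 * res_sum n z x + of_nat n / 2"

lemma resolvent_nz: "Im z > 0 \<Longrightarrow> z - of_real t \<noteq> 0"
  by (auto simp: complex_eq_iff)

lemma norm_resolvent_le:
  assumes "Im z > 0" shows "norm (resolvent z x i) \<le> 1 / Im z"
proof -
  have "Im z \<le> norm (z - of_real (x i))"
    using abs_Im_le_cmod[of "z - of_real (x i)"] assms by simp
  then show ?thesis
    using assms by (simp add: resolvent_def norm_divide frac_le)
qed

lemma res_sum_bounded: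
  assumes "Im z > 0" shows "norm (res_sum n z x) \<le> real n / Im z"
  unfolding res_sum_def using norm_resolvent_le[OF assms, of x]
  by (intro order_trans[OF sum_norm_bound[where K="1 / Im z"]]) auto

lemma res_sum2_bounded:
  assumes "Im z > 0" shows "norm (res_sum2 n z x) \<le> real n * (1 / Im z)\<^sup>2"
  unfolding res_sum2_def using norm_resolvent_le[OF assms, of x]
  by (intro order_trans[OF sum_norm_bound[where K="(1 / Im z)\<^sup>2"]]) (auto simp: norm_power intro!: power_mono simp del: power_divide)

lemma resolvent_measurable:
  assumes "i \<in> {1..n}" shows "(\<lambda>x. resolvent z x i) \<in> borel_measurable (config_lborel n)"
proof -
  note coord_measurable[OF assms, measurable]
  show ?thesis unfolding resolvent_def by measurable
qed

lemma res_sum_measurable [measurable]: "res_sum n z \<in> borel_measurable (config_lborel n)"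
  unfolding res_sum_def[abs_def] by (intro borel_measurable_sum resolvent_measurable)

lemma res_sum2_measurable [measurable]: "res_sum2 n z \<in> borel_measurable (config_lborel n)"
  unfolding res_sum2_def[abs_def] power2_eq_square
  by (intro borel_measurable_sum borel_measurable_times resolvent_measurable)

lemma loop_expr_measurable [measurable]: "loop_expr n \<beta> z \<in> borel_measurable (config_lborel n)"
  unfolding loop_expr_def[abs_def] by measurable

lemma loop_expr_bounded:
  assumes "Im z > 0" obtains C where "\<And>x. norm (loop_expr n \<beta> z x) \<le> C"
proof
  fix x
  have "norm (loop_expr n \<beta> z x) \<le> norm ((of_real \<beta> / 2) * (res_sum n z x)\<^sup>2) + norm ((1 - of_real \<beta> / 2) * res_sum2 n z x)
     + norm (z / 2 * res_sum n z x) + norm (of_nat n / 2 :: complex)"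
    unfolding loop_expr_def by (intro norm_triangle_mono norm_triangle_le_diff add_mono order_refl)
  also have "\<dots> \<le> (\<bar>\<beta>\<bar> / 2) * (real n / Im z)\<^sup>2 + norm (1 - of_real \<beta> / 2 :: complex) * (real n * (1 / Im z)\<^sup>2)
     + norm (z / 2) * (real n / Im z) + real n / 2"
    unfolding norm_mult norm_power using res_sum_bounded[OF assms, of n x] res_sum2_bounded[OF assms, of n x]
    by (intro add_mono mult_mono power_mono) auto
  finally show "norm (loop_expr n \<beta> z x) \<le> (\<bar>\<beta>\<bar> / 2) * (real n / Im z)\<^sup>2 + norm (1 - of_real \<beta> / 2 :: complex) * (real n * (1 / Im z)\<^sup>2)
     + norm (z / 2) * (real n / Im z) + real n / 2" .
qed

lemma sum_index_pairs:
  fixes g :: "nat \<Rightarrow> 'a::field_char_0"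
  shows "(\<Sum>(a,b)\<in>index_pairs n. g a * g b) = ((\<Sum>i\<in>{1..n}. g i)\<^sup>2 - (\<Sum>i\<in>{1..n}. (g i)\<^sup>2)) / 2"
proof -
  let ?D = "(\<lambda>i. (i, i)) ` {1..n}"
  have "{1..n} \<times> {1..n} = (index_pairs n \<union> prod.swap ` index_pairs n) \<union> ?D"
    by (auto simp: index_pairs_def image_iff)
  then have "(\<Sum>i\<in>{1..n}. g i)\<^sup>2 = (\<Sum>(a,b)\<in>(index_pairs n \<union> prod.swap ` index_pairs n) \<union> ?D. g a * g b)"
    by (simp add: power2_eq_square sum_product sum.cartesian_product)
  also have "\<dots> = (\<Sum>(a,b)\<in>index_pairs n \<union> prod.swap ` index_pairs n. g a * g b) + (\<Sum>(a,b)\<in>?D. g a * g b)"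
    by (intro sum.union_disjoint) (auto simp: index_pairs_def)
  also have "(\<Sum>(a,b)\<in>?D. g a * g b) = (\<Sum>i\<in>{1..n}. (g i)\<^sup>2)"
    by (subst sum.reindex) (auto simp: inj_on_def power2_eq_square)
  also have "(\<Sum>(a,b)\<in>index_pairs n \<union> prod.swap ` index_pairs n. g a * g b) =
      (\<Sum>(a,b)\<in>index_pairs n. g a * g b) + (\<Sum>(a,b)\<in>prod.swap ` index_pairs n. g a * g b)"
    by (intro sum.union_disjoint) (auto simp: index_pairs_def)
  also have "(\<Sum>(a,b)\<in>prod.swap ` index_pairs n. g a * g b) = (\<Sum>(a,b)\<in>index_pairs n. g a * g b)"
    by (subst sum.reindex) (auto simp: inj_on_def case_prod_beta mult.commute intro!: sum.cong)
  finally show ?thesis by simp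
qed

lemma of_real_of_bool: "of_real (of_bool P) = of_bool P"
  by simp

text \<open>Partial fractions remove the interaction: (R_a - R_b)/(x_a - x_b) = R_a R_b, so the sum
  over pairs becomes half of S^2 minus the sum of squares. The Gaussian part uses x_i R_i = z R_i -
  1. A nonzero weight guarantees that no denominator vanishes.\<close>

lemma sum_dlog_resolvent:
  assumes z: "Im z > 0" and w: "gbe_weight n \<beta> x \<noteq> 0"
  shows "(\<Sum>i\<in>{1..n}. of_real (gbe_dlog n \<beta> i x) * resolvent z x i) = loop_expr n \<beta> z x - res_sum2 n z x"
proof -
  let ?R = "resolvent z x"
  have ne: "x a \<noteq> x b" if "(a, b) \<in> index_pairs n" for a b
  proof
    assume "x a = x b"
    then have "(\<Prod>(a,b)\<in>index_pairs n. \<bar>x a - x b\<bar> powr \<beta>) = 0"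
      using that by (intro prod_zero) (auto intro!: bexI[of _ "(a,b)"])
    then show False using w by (simp add: gbe_weight_pairs)
  qed
  have "(\<Sum>i\<in>{1..n}. of_real (gbe_dlog n \<beta> i x) * ?R i) =
     (\<Sum>i\<in>{1..n}. \<Sum>(a,b)\<in>index_pairs n. of_real (\<beta> / (x a - x b)) * (of_bool (a = i) - of_bool (b = i)) * ?R i)
      - (\<Sum>i\<in>{1..n}. of_real (x i) * ?R i) / 2"
    by (simp add: of_real_of_bool gbe_dlog_def left_diff_distrib sum_subtractf sum_distrib_right sum_divide_distrib case_prod_beta)
  also have "(\<Sum>i\<in>{1..n}. \<Sum>(a,b)\<in>index_pairs n. of_real (\<beta> / (x a - x b)) * (of_bool (a = i) - of_bool (b = i)) * ?R i)
     = (\<Sum>(a,b)\<in>index_pairs n. \<Sum>i\<in>{1..n}. of_real (\<beta> / (x a - x b)) * (of_bool (a = i) - of_bool (b = i)) * ?R i)"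
    by (subst sum.swap) (simp add: case_prod_beta)
  also have "\<dots> = (\<Sum>(a,b)\<in>index_pairs n. of_real \<beta> * (?R a * ?R b))"
  proof (rule sum.cong[OF refl], clarify)
    fix a b assume ab: "(a, b) \<in> index_pairs n"
    then have ab': "a \<in> {1..n}" "b \<in> {1..n}" by (auto dest: index_pairsD)
    have "(\<Sum>i\<in>{1..n}. of_real (\<beta> / (x a - x b)) * (of_bool (a = i) - of_bool (b = i)) * ?R i)
       = of_real (\<beta> / (x a - x b)) * ((\<Sum>i\<in>{1..n}. if a = i then ?R i else 0) - (\<Sum>i\<in>{1..n}. if b = i then ?R i else 0))"
      unfolding sum_subtractf[symmetric] sum_distrib_left by (intro sum.cong) auto
    also have "\<dots> = of_real (\<beta> / (x a - x b)) * (?R a - ?R b)"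
      using ab' by simp
    also have "?R a - ?R b = of_real (x a - x b) * (?R a * ?R b)"
      using resolvent_nz[OF z] by (simp add: resolvent_def field_simps)
    finally show "(\<Sum>i\<in>{1..n}. of_real (\<beta> / (x a - x b)) * (of_bool (a = i) - of_bool (b = i)) * ?R i) = of_real \<beta> * (?R a * ?R b)"
      using ne[OF ab] by simp
  qed
  also have "\<dots> = of_real \<beta> * (((\<Sum>i\<in>{1..n}. ?R i)\<^sup>2 - (\<Sum>i\<in>{1..n}. (?R i)\<^sup>2)) / 2)"
    unfolding sum_index_pairs[symmetric] sum_distrib_left by (simp add: case_prod_beta)
  also have "(\<Sum>i\<in>{1..n}. of_real (x i) * ?R i) = (\<Sum>i\<in>{1..n}. z * ?R i - 1)"
    using resolvent_nz[OF z] by (intro sum.cong) (auto simp: resolvent_def field_simps)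
  finally show ?thesis
    by (simp add: loop_expr_def res_sum_def res_sum2_def sum_subtractf sum_distrib_left[symmetric] field_simps)
qed

lemma has_vector_derivative_resolvent:
  assumes z: "Im z > 0"
  shows "((\<lambda>v. resolvent z (x(i := v)) k) has_vector_derivative (if k = i then (resolvent z (x(i := u)) i)\<^sup>2 else 0)) (at u)"
proof (cases "k = i")
  case True
  have "((\<lambda>w. 1 / (z - w)) has_field_derivative (1 / (z - of_real u))\<^sup>2) (at (of_real u))"
    using resolvent_nz[OF z] by (auto intro!: derivative_eq_intros simp: power2_eq_square)
  from has_vector_derivative_real_field[OF this] show ?thesis
    using True by (simp add: resolvent_def)
qed (simp add: resolvent_def)

text \<open>Integration by parts in direction \<open>i\<close> is applied to R_i G and summed over
  \<open>i\<close>. Differentiating R_i contributes \<open>res_sum2\<close> times G, which cancels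
  the term left over in \<open>sum_dlog_resolvent\<close>.\<close>

lemma loop_equation:
  fixes G :: "(nat \<Rightarrow> real) \<Rightarrow> complex"
  assumes \<beta>: "\<beta> \<ge> 1" and z: "Im z > 0"
    and meas [measurable]: "G \<in> borel_measurable (config_lborel n)"
      "\<And>i. i \<in> {1..n} \<Longrightarrow> G' i \<in> borel_measurable (config_lborel n)"
    and bnd: "\<And>x. norm (G x) \<le> C" "\<And>i x. i \<in> {1..n} \<Longrightarrow> norm (G' i x) \<le> C"
    and deriv: "\<And>i x u. i \<in> {1..n} \<Longrightarrow> ((\<lambda>v. G (x(i := v))) has_vector_derivative G' i (x(i := u))) (at u)"
  shows "(\<integral>x. gbe_weight n \<beta> x *\<^sub>R (G x * loop_expr n \<beta> z x + (\<Sum>i\<in>{1..n}. resolvent z x i * G' i x)) \<partial>config_lborel n) = 0"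
proof -
  let ?w = "gbe_weight n \<beta>"
  let ?F = "\<lambda>i x. (?w x * gbe_dlog n \<beta> i x) *\<^sub>R (resolvent z x i * G x)
     + ?w x *\<^sub>R ((resolvent z x i)\<^sup>2 * G x + resolvent z x i * G' i x)"
  have C: "C \<ge> 0" using norm_ge_zero order_trans bnd(1) by blast
  have "integrable (config_lborel n) (?F i) \<and> (\<integral>x. ?F i x \<partial>config_lborel n) = 0" if i: "i \<in> {1..n}" for i
  proof -
    note resolvent_measurable[OF i, measurable] meas(2)[OF i, measurable]
    let ?\<eta> = "1 / Im z" and ?C' = "1 / Im z * C + ((1 / Im z)\<^sup>2 * C + 1 / Im z * C)"
    have R: "norm (resolvent z x i) \<le> ?\<eta>" for x by (rule norm_resolvent_le[OF z])
    have "(\<lambda>x. resolvent z x i * G x) \<in> borel_measurable (config_lborel n)"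
      "(\<lambda>x. (resolvent z x i)\<^sup>2 * G x + resolvent z x i * G' i x) \<in> borel_measurable (config_lborel n)"
      by measurable
    moreover have "norm (resolvent z x i * G x) \<le> ?C'" for x
    proof -
      have "norm (resolvent z x i * G x) \<le> ?\<eta> * C"
        unfolding norm_mult using R bnd z C by (intro mult_mono) auto
      moreover have "0 \<le> ?\<eta>\<^sup>2 * C" "0 \<le> ?\<eta> * C" using z C by auto
      ultimately show ?thesis by linarith
    qed
    moreover have "norm ((resolvent z x i)\<^sup>2 * G x + resolvent z x i * G' i x) \<le> ?C'" for x
    proof -
      have "norm ((resolvent z x i)\<^sup>2 * G x + resolvent z x i * G' i x) \<le> ?\<eta>\<^sup>2 * C + ?\<eta> * C"
        using R bnd(1) bnd(2)[OF i] z C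
        by (intro order_trans[OF norm_triangle_ineq] add_mono) (auto simp only: norm_mult norm_power intro!: mult_mono power_mono, auto)
      moreover have "0 \<le> ?\<eta> * C" using z C by auto
      ultimately show ?thesis by linarith
    qed
    moreover have "((\<lambda>v. resolvent z (x(i := v)) i * G (x(i := v))) has_vector_derivative
        (resolvent z (x(i := u)) i)\<^sup>2 * G (x(i := u)) + resolvent z (x(i := u)) i * G' i (x(i := u))) (at u)" for x u
      using has_vector_derivative_mult[OF has_vector_derivative_resolvent[OF z, of x i i u] deriv[OF i, of x u]]
      by (simp add: add.commute)
    ultimately show ?thesis
      using gbe_integration_by_parts[OF \<beta> i, of "\<lambda>x. resolvent z x i * G x"
        "\<lambda>x. (resolvent z x i)\<^sup>2 * G x + resolvent z x i * G' i x" ?C'] by blast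
  qed
  then have "(\<integral>x. (\<Sum>i\<in>{1..n}. ?F i x) \<partial>config_lborel n) = 0"
    by (subst Bochner_Integration.integral_sum) auto
  moreover have "(\<Sum>i\<in>{1..n}. ?F i x) = ?w x *\<^sub>R (G x * loop_expr n \<beta> z x + (\<Sum>i\<in>{1..n}. resolvent z x i * G' i x))" for x
  \<comment> \<open>At configurations of weight 0, in particular at collisions, both sides vanish;
    elsewhere \<open>sum_dlog_resolvent\<close> applies.\<close>
  proof (cases "?w x = 0")
    case False
    have "(\<Sum>i\<in>{1..n}. ?F i x) = ?w x *\<^sub>R ((\<Sum>i\<in>{1..n}. of_real (gbe_dlog n \<beta> i x) * resolvent z x i) * G x
        + res_sum2 n z x * G x + (\<Sum>i\<in>{1..n}. resolvent z x i * G' i x))"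
      by (simp add: res_sum2_def sum_distrib_right scaleR_sum_right sum.distrib scaleR_conv_of_real algebra_simps sum_distrib_left)
    also have "(\<Sum>i\<in>{1..n}. of_real (gbe_dlog n \<beta> i x) * resolvent z x i) * G x + res_sum2 n z x * G x = G x * loop_expr n \<beta> z x"
      unfolding sum_dlog_resolvent[OF z False] by (simp add: algebra_simps)
    finally show ?thesis .
  qed simp
  ultimately show ?thesis by simp
qed

section \<open>Moments of the loop expression\<close>

text \<open>This is the partial derivative of \<open>loop_expr\<close> in coordinate
  \<open>i\<close>, as \<open>has_vector_derivative_loop_expr\<close> confirms. The bracket is the
  negative of U, so its main term is again controlled by U.\<close>

definition loop_deriv :: "nat \<Rightarrow> real \<Rightarrow> complex \<Rightarrow> nat \<Rightarrow> (nat \<Rightarrow> real) \<Rightarrow> complex" where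
  "loop_deriv n \<beta> z i x = (resolvent z x i)\<^sup>2 * (of_real \<beta> * res_sum n z x - z / 2)
     + (2 - of_real \<beta>) * (resolvent z x i) ^ 3"

text \<open>Absolute values inside the sum give a bound for the derivative term of the loop equation
  that does not depend on phases, for G any product of powers of \<open>loop_expr\<close> and its
  conjugate.\<close>

definition loop_noise :: "nat \<Rightarrow> real \<Rightarrow> complex \<Rightarrow> (nat \<Rightarrow> real) \<Rightarrow> real" where
  "loop_noise n \<beta> z x = (\<Sum>i\<in>{1..n}. norm (resolvent z x i) * norm (loop_deriv n \<beta> z i x))"

lemma loop_deriv_measurable:
  assumes "i \<in> {1..n}" shows "loop_deriv n \<beta> z i \<in> borel_measurable (config_lborel n)"
proof -
  note resolvent_measurable[OF assms, measurable]
  show ?thesis unfolding loop_deriv_def[abs_def] by measurable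
qed

lemma loop_noise_measurable [measurable]: "loop_noise n \<beta> z \<in> borel_measurable (config_lborel n)"
  unfolding loop_noise_def[abs_def]
proof (rule borel_measurable_sum)
  fix i assume i: "i \<in> {1..n}"
  note resolvent_measurable[OF i, measurable] loop_deriv_measurable[OF i, measurable]
  show "(\<lambda>x. norm (resolvent z x i) * norm (loop_deriv n \<beta> z i x)) \<in> borel_measurable (config_lborel n)"
    by measurable
qed

lemma loop_deriv_bounded:
  assumes "Im z > 0" obtains C where "\<And>x i. norm (loop_deriv n \<beta> z i x) \<le> C"
proof
  fix x i
  have "norm (loop_deriv n \<beta> z i x) \<le> (norm (resolvent z x i))\<^sup>2 * (\<bar>\<beta>\<bar> * norm (res_sum n z x) + norm (z / 2))
     + norm (2 - of_real \<beta> :: complex) * norm (resolvent z x i) ^ 3"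
    unfolding loop_deriv_def
    by (rule order_trans[OF norm_triangle_ineq], unfold norm_mult norm_power,
        intro add_mono mult_left_mono order_trans[OF norm_triangle_ineq4]) (auto simp: norm_mult)
  also have "\<dots> \<le> (1 / Im z)\<^sup>2 * (\<bar>\<beta>\<bar> * (real n / Im z) + norm (z / 2)) + norm (2 - of_real \<beta> :: complex) * (1 / Im z) ^ 3"
    using norm_resolvent_le[OF assms, of x i] res_sum_bounded[OF assms, of n x] assms
    by (intro add_mono mult_mono power_mono) auto
  finally show "norm (loop_deriv n \<beta> z i x) \<le> (1 / Im z)\<^sup>2 * (\<bar>\<beta>\<bar> * (real n / Im z) + norm (z / 2)) + norm (2 - of_real \<beta> :: complex) * (1 / Im z) ^ 3" .
qed

lemma loop_noise_bounded:
  assumes "Im z > 0" obtains C where "\<And>x. norm (loop_noise n \<beta> z x) \<le> C"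
proof -
  obtain C where C: "\<And>x i. norm (loop_deriv n \<beta> z i x) \<le> C"
    using loop_deriv_bounded[OF assms] by blast
  have C0: "0 \<le> C" using norm_ge_zero order_trans C by blast
  have "norm (loop_noise n \<beta> z x) \<le> real n * (1 / Im z * C)" for x
    unfolding loop_noise_def
    using norm_resolvent_le[OF assms, of x] C[of _ x] C0 assms
    by (intro order_trans[OF sum_norm_bound[where K="1 / Im z * C"]]) (auto simp only: real_norm_def abs_mult abs_norm_cancel
        card_atLeastAtMost intro!: mult_mono, auto)
  then show ?thesis using that by blast
qed

lemma has_vector_derivative_power_complex:
  fixes f :: "real \<Rightarrow> complex"
  assumes "(f has_vector_derivative f') (at u)"
  shows "((\<lambda>v. f v ^ q) has_vector_derivative (of_nat q * f u ^ (q - 1) * f')) (at u)"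
proof -
  have "((\<lambda>w. w ^ q) has_field_derivative (of_nat q * f u ^ (q - 1))) (at (f u))"
    using DERIV_power[OF DERIV_ident, of q "f u" UNIV] by (simp add: One_nat_def)
  from field_vector_diff_chain_at[OF assms this] show ?thesis
    by (simp add: o_def mult_ac)
qed

lemma has_vector_derivative_loop_expr:
  assumes z: "Im z > 0" and i: "i \<in> {1..n}"
  shows "((\<lambda>v. loop_expr n \<beta> z (x(i := v))) has_vector_derivative loop_deriv n \<beta> z i (x(i := u))) (at u)"
proof -
  let ?R = "resolvent z (x(i := u)) i" and ?S = "res_sum n z (x(i := u))"
  note R = has_vector_derivative_resolvent[OF z, of x i _ u]
  have "((\<lambda>v. res_sum n z (x(i := v))) has_vector_derivative (\<Sum>k\<in>{1..n}. if k = i then ?R\<^sup>2 else 0)) (at u)"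
    unfolding res_sum_def by (intro has_vector_derivative_sum R)
  then have S: "((\<lambda>v. res_sum n z (x(i := v))) has_vector_derivative ?R\<^sup>2) (at u)"
    using i by simp
  have "((\<lambda>v. res_sum2 n z (x(i := v))) has_vector_derivative (\<Sum>k\<in>{1..n}. of_nat 2 * resolvent z (x(i := u)) k ^ (2 - 1) * (if k = i then ?R\<^sup>2 else 0))) (at u)"
    unfolding res_sum2_def by (intro has_vector_derivative_sum has_vector_derivative_power_complex R)
  also have "(\<Sum>k\<in>{1..n}. of_nat 2 * resolvent z (x(i := u)) k ^ (2 - 1) * (if k = i then ?R\<^sup>2 else 0)) = 2 * ?R ^ 3"
    using i by (simp add: if_distrib[of "\<lambda>t. _ * t"] cong: if_cong)  (simp add: power2_eq_square power3_eq_cube)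
  finally have Q: "((\<lambda>v. res_sum2 n z (x(i := v))) has_vector_derivative 2 * ?R ^ 3) (at u)" .
  have "((\<lambda>v. loop_expr n \<beta> z (x(i := v))) has_vector_derivative
      ((of_real \<beta> / 2) * (of_nat 2 * ?S ^ (2 - 1) * ?R\<^sup>2) + (1 - of_real \<beta> / 2) * (2 * ?R ^ 3)
     - z / 2 * ?R\<^sup>2 + 0)) (at u)"
    unfolding loop_expr_def
    by (intro has_vector_derivative_add has_vector_derivative_diff has_vector_derivative_mult_right
      has_vector_derivative_power_complex S Q has_vector_derivative_const)
  then show ?thesis
    by (simp add: loop_deriv_def algebra_simps)
qed

lemma gbe_measurable:
  assumes "gaussian_beta_ensemble M n \<beta> X" shows "X \<in> measurable M (config_lborel n)"
  using assms unfolding gaussian_beta_ensemble_def by (rule distributed_measurable)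

lemma gbe_const_nonneg: "gbe_const n \<beta> \<ge> 0"
  unfolding gbe_const_def by (intro divide_nonneg_nonneg integral_nonneg) (auto simp: gbe_weight_nonneg)

lemma gbe_density_nonneg: "gbe_density n \<beta> x \<ge> 0"
  by (simp add: gbe_density_def gbe_weight_nonneg gbe_const_nonneg)

text \<open>The normalization factors out, so the homogeneous loop equation for the weight passes to
  expectations without evaluating \<open>gbe_const\<close>.\<close>

lemma gbe_expectation:
  fixes F :: "(nat \<Rightarrow> real) \<Rightarrow> 'b::{banach,second_countable_topology}"
  assumes X: "gaussian_beta_ensemble M n \<beta> X"
    and [measurable]: "F \<in> borel_measurable (config_lborel n)"
  shows "(\<integral>\<omega>. F (X \<omega>) \<partial>M) = gbe_const n \<beta> *\<^sub>R (\<integral>x. gbe_weight n \<beta> x *\<^sub>R F x \<partial>config_lborel n)"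
proof -
  note gbe_measurable[OF X, measurable]
  have [measurable]: "gbe_density n \<beta> \<in> borel_measurable (config_lborel n)"
    unfolding gbe_density_def[abs_def] by measurable
  have "(\<integral>\<omega>. F (X \<omega>) \<partial>M) = (\<integral>x. F x \<partial>distr M (config_lborel n) X)"
    by (rule integral_distr[symmetric]) measurable
  also have "distr M (config_lborel n) X = density (config_lborel n) (\<lambda>x. ennreal (gbe_density n \<beta> x))"
    using X unfolding gaussian_beta_ensemble_def by (rule distributed_distr_eq_density)
  also have "(\<integral>x. F x \<partial>density (config_lborel n) (\<lambda>x. ennreal (gbe_density n \<beta> x))) =
      (\<integral>x. gbe_density n \<beta> x *\<^sub>R F x \<partial>config_lborel n)"
    by (rule integral_density) (auto simp: gbe_density_nonneg)
  also have "\<dots> = gbe_const n \<beta> *\<^sub>R (\<integral>x. gbe_weight n \<beta> x *\<^sub>R F x \<partial>config_lborel n)"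
    by (simp add: gbe_density_def scaleR_scaleR[symmetric] del: scaleR_scaleR)
  finally show ?thesis .
qed

lemma cnj_borel_measurable [measurable]: "cnj \<in> borel_measurable borel"
  by (intro borel_measurable_continuous_onI continuous_intros)

text \<open>For this G the product with \<open>loop_expr\<close> is the real number |L|^(2q+2). The
  coordinates are real, so conjugation commutes with differentiation; the q factors L and the q+1
  conjugate factors each contribute |L|^(2q) times the derivative, whence 2q+1.\<close>

lemma loop_moment_le:
  assumes "prob_space M" and X: "gaussian_beta_ensemble M n \<beta> X"
    and \<beta>: "\<beta> \<ge> 1" and z: "Im z > 0"
  shows "(\<integral>\<omega>. norm (loop_expr n \<beta> z (X \<omega>)) ^ (2 * q + 2) \<partial>M) \<le>
    (2 * real q + 1) * (\<integral>\<omega>. norm (loop_expr n \<beta> z (X \<omega>)) ^ (2 * q) * loop_noise n \<beta> z (X \<omega>) \<partial>M)"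
proof -
  interpret prob_space M by fact
  note gbe_measurable[OF X, measurable]
  let ?L = "loop_expr n \<beta> z" and ?L' = "loop_deriv n \<beta> z"
  obtain C1 where C1: "\<And>x. norm (?L x) \<le> C1" using loop_expr_bounded[OF z] by blast
  obtain C2 where C2: "\<And>x i. norm (?L' i x) \<le> C2" using loop_deriv_bounded[OF z] by blast
  obtain C3 where C3: "\<And>x. norm (loop_noise n \<beta> z x) \<le> C3" using loop_noise_bounded[OF z] by blast
  have C1': "0 \<le> C1" using norm_ge_zero order_trans C1 by blast
  have C2': "0 \<le> C2" using norm_ge_zero order_trans C2 by blast
  have C3': "0 \<le> C3" using norm_ge_zero order_trans C3 by blast
  define G where "G x = cnj (?L x) ^ Suc q * ?L x ^ q" for x
  define G' where "G' i x = cnj (?L x) ^ Suc q * (of_nat q * ?L x ^ (q - 1) * ?L' i x)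
      + of_nat (Suc q) * cnj (?L x) ^ (Suc q - 1) * cnj (?L' i x) * ?L x ^ q" for i x
  have [measurable]: "G \<in> borel_measurable (config_lborel n)" unfolding G_def[abs_def] by measurable
  have mG': "G' i \<in> borel_measurable (config_lborel n)" if "i \<in> {1..n}" for i
  proof -
    note loop_deriv_measurable[OF that, measurable]
    show ?thesis unfolding G'_def[abs_def] by measurable
  qed
  have nG': "norm (G' i x) \<le> (2 * real q + 1) * norm (?L x) ^ (2 * q) * norm (?L' i x)" for i x
  proof -
    \<comment> \<open>For \<open>q = 0\<close> the truncated exponent \<open>q - 1\<close> does no
      harm, since the factor \<open>of_nat q\<close> is 0.\<close>
    have a: "norm (cnj (?L x) ^ Suc q * (of_nat q * ?L x ^ (q - 1) * ?L' i x)) = real q * norm (?L x) ^ (2 * q) * norm (?L' i x)"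
    proof (cases q)
      case (Suc q')
      then have "2 * q = Suc q + (q - 1)" by simp
      show ?thesis unfolding \<open>2 * q = _\<close> power_add by (simp add: norm_mult norm_power)
    qed simp
    have b: "norm (of_nat (Suc q) * cnj (?L x) ^ (Suc q - 1) * cnj (?L' i x) * ?L x ^ q) = real (Suc q) * norm (?L x) ^ (2 * q) * norm (?L' i x)"
      unfolding mult_2 power_add by (simp add: norm_mult norm_power del: of_nat_Suc)
    show ?thesis
      unfolding G'_def by (rule order_trans[OF norm_triangle_ineq], unfold a b) (simp add: algebra_simps)
  qed
  have GL: "G x * ?L x = of_real (norm (?L x) ^ (2 * q + 2))" for x
  proof -
    have "G x * ?L x = (?L x * cnj (?L x)) ^ Suc q"
      by (simp add: G_def power_mult_distrib mult_ac)
    also have "?L x * cnj (?L x) = of_real ((norm (?L x))\<^sup>2)"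
      by (simp only: complex_norm_square)
    also have "of_real ((norm (?L x))\<^sup>2) ^ Suc q = complex_of_real (norm (?L x) ^ (2 * q + 2))"
      by (simp add: power_add power_mult power2_eq_square)
    finally show ?thesis .
  qed
  let ?H = "\<lambda>x. \<Sum>i\<in>{1..n}. resolvent z x i * G' i x"
  have [measurable]: "?H \<in> borel_measurable (config_lborel n)"
    by (intro borel_measurable_sum borel_measurable_times resolvent_measurable mG')
  have nH: "norm (?H x) \<le> (2 * real q + 1) * (norm (?L x) ^ (2 * q) * loop_noise n \<beta> z x)" for x
  proof -
    have "norm (?H x) \<le> (\<Sum>i\<in>{1..n}. norm (resolvent z x i) * ((2 * real q + 1) * norm (?L x) ^ (2 * q) * norm (?L' i x)))"
      by (intro sum_norm_le) (auto simp: norm_mult intro!: mult_left_mono nG')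
    also have "\<dots> = (2 * real q + 1) * (norm (?L x) ^ (2 * q) * loop_noise n \<beta> z x)"
      by (simp add: loop_noise_def sum_distrib_left mult_ac)
    finally show ?thesis .
  qed
  have bN: "norm (norm (?L x) ^ (2 * q) * loop_noise n \<beta> z x) \<le> C1 ^ (2 * q) * C3" for x
    unfolding norm_mult norm_power using C1[of x] C3[of x] C1' C3' by (intro mult_mono power_mono) auto
  have "(\<integral>x. gbe_weight n \<beta> x *\<^sub>R (G x * ?L x + ?H x) \<partial>config_lborel n) = 0"
  proof (rule loop_equation[OF \<beta> z _ mG'])
    let ?C = "C1 ^ (2 * q + 1) + (2 * real q + 1) * C1 ^ (2 * q) * C2"
    show "norm (G x) \<le> ?C" for x
    proof -
      have "norm (G x) = norm (?L x) ^ (2 * q + 1)"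
        by (simp add: G_def norm_mult norm_power mult_2 power_add)
      also have "\<dots> \<le> C1 ^ (2 * q + 1)" by (intro power_mono C1) auto
      also have "\<dots> \<le> ?C" using C1' C2' by simp
      finally show ?thesis .
    qed
    show "norm (G' i x) \<le> ?C" for i x
    proof -
      have "norm (G' i x) \<le> (2 * real q + 1) * C1 ^ (2 * q) * C2"
        by (rule order_trans[OF nG']) (use C1' C2' C1 C2 in \<open>auto intro!: mult_mono power_mono\<close>)
      also have "\<dots> \<le> ?C" using C1' C2' by simp
      finally show ?thesis .
    qed
    fix i x u assume i: "i \<in> {1..n}"
    note d = has_vector_derivative_loop_expr[OF z i, of \<beta> x u]
    show "((\<lambda>v. G (x(i := v))) has_vector_derivative G' i (x(i := u))) (at u)"
      unfolding G_def G'_def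
      by (intro has_vector_derivative_mult has_vector_derivative_power_complex has_vector_derivative_cnj d)
  qed auto
  then have 0: "(\<integral>\<omega>. G (X \<omega>) * ?L (X \<omega>) + ?H (X \<omega>) \<partial>M) = 0"
    by (subst gbe_expectation[OF X]) auto
  have i1: "integrable M (\<lambda>\<omega>. norm (?L (X \<omega>)) ^ (2 * q + 2))"
    by (rule integrable_const_bound[where B="C1 ^ (2 * q + 2)"]) (auto intro!: AE_I2 power_mono C1 simp del: power_Suc)
  have i3: "integrable M (\<lambda>\<omega>. norm (?L (X \<omega>)) ^ (2 * q) * loop_noise n \<beta> z (X \<omega>))"
    by (rule integrable_const_bound[where B="C1 ^ (2 * q) * C3"]) (use bN in \<open>auto intro!: AE_I2\<close>)
  have i2: "integrable M (\<lambda>\<omega>. ?H (X \<omega>))"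
  proof (rule integrable_const_bound[where B="(2 * real q + 1) * (C1 ^ (2 * q) * C3)"])
    have "norm (?H x) \<le> (2 * real q + 1) * (C1 ^ (2 * q) * C3)" for x
      using bN[of x] by (intro order_trans[OF nH] mult_left_mono) auto
    then show "AE \<omega> in M. norm (?H (X \<omega>)) \<le> (2 * real q + 1) * (C1 ^ (2 * q) * C3)" by simp
  qed measurable
  have "complex_of_real (\<integral>\<omega>. norm (?L (X \<omega>)) ^ (2 * q + 2) \<partial>M) = - (\<integral>\<omega>. ?H (X \<omega>) \<partial>M)"
    using 0 unfolding GL Bochner_Integration.integral_add[OF integrable_of_real[OF i1] i2] integral_complex_of_real
    by (simp only: add_eq_0_iff2)
  then have "norm (complex_of_real (\<integral>\<omega>. norm (?L (X \<omega>)) ^ (2 * q + 2) \<partial>M)) = norm (\<integral>\<omega>. ?H (X \<omega>) \<partial>M)"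
    by simp
  then have "(\<integral>\<omega>. norm (?L (X \<omega>)) ^ (2 * q + 2) \<partial>M) \<le> norm (\<integral>\<omega>. ?H (X \<omega>) \<partial>M)"
    unfolding norm_of_real by linarith
  also have "\<dots> \<le> (\<integral>\<omega>. norm (?H (X \<omega>)) \<partial>M)" by simp
  also have "\<dots> \<le> (\<integral>\<omega>. (2 * real q + 1) * (norm (?L (X \<omega>)) ^ (2 * q) * loop_noise n \<beta> z (X \<omega>)) \<partial>M)"
    using i2 i3 nH by (intro integral_mono integrable_norm integrable_mult_right) auto
  finally show ?thesis by simp
qed

section \<open>Scaling at the edge\<close>

text \<open>Viewed as a quadratic equation for \<open>res_sum\<close>, the definition of
  \<open>loop_expr\<close> has roots given by a square root; up to sign, \<open>loop_disc\<close> is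
  this square root of the discriminant, and \<open>loop_disc_square\<close> is the completed
  square.\<close>

definition loop_disc :: "nat \<Rightarrow> real \<Rightarrow> complex \<Rightarrow> (nat \<Rightarrow> real) \<Rightarrow> complex" where
  "loop_disc n \<beta> z x = z / 2 - of_real \<beta> * res_sum n z x"

definition res_norm2 :: "nat \<Rightarrow> complex \<Rightarrow> (nat \<Rightarrow> real) \<Rightarrow> real" where
  "res_norm2 n z x = (\<Sum>i\<in>{1..n}. (norm (resolvent z x i))\<^sup>2)"

lemma Im_resolvent: "Im (resolvent z x i) = - Im z * (norm (resolvent z x i))\<^sup>2"
  by (simp add: resolvent_def norm_divide Im_divide cmod_power2 power_divide)

lemma Im_loop_disc: "Im (loop_disc n \<beta> z x) = Im z / 2 + \<beta> * Im z * res_norm2 n z x"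
  by (simp add: loop_disc_def res_sum_def res_norm2_def Im_resolvent sum_distrib_left[symmetric] sum_negf)

lemma res_norm2_le:
  assumes "Im z > 0" "\<beta> > 0"
  shows "res_norm2 n z x \<le> norm (loop_disc n \<beta> z x) / (\<beta> * Im z)"
proof -
  have "\<beta> * Im z * res_norm2 n z x \<le> Im (loop_disc n \<beta> z x)"
    using assms by (simp add: Im_loop_disc)
  also have "\<dots> \<le> norm (loop_disc n \<beta> z x)"
    using abs_Im_le_cmod[of "loop_disc n \<beta> z x"] by linarith
  finally show ?thesis using assms by (simp add: field_simps)
qed

lemma loop_disc_square:
  "(loop_disc n \<beta> z x)\<^sup>2 = z\<^sup>2 / 4 - of_nat n * of_real \<beta> + 2 * of_real \<beta> * loop_expr n \<beta> z x
     - of_real \<beta> * (2 - of_real \<beta>) * res_sum2 n z x"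
  by (simp add: loop_disc_def loop_expr_def power2_eq_square field_simps)

lemma norm_res_sum2_le: "norm (res_sum2 n z x) \<le> res_norm2 n z x"
  unfolding res_sum2_def res_norm2_def by (intro sum_norm_le) (auto simp: norm_power)

text \<open>Every term has at least three resolvents in the factor of U and four in the other. Two
  are kept to form \<open>res_norm2\<close>, and the rest are bounded by 1/Im z. Then
  \<open>res_norm2_le\<close> trades \<open>res_norm2\<close> for another factor |U|, which makes
  the main term quadratic.\<close>

lemma loop_noise_le:
  fixes x :: "nat \<Rightarrow> real" and n :: nat
  assumes z: "Im z > 0" and \<beta>: "\<beta> > 0"
  defines "u \<equiv> norm (loop_disc n \<beta> z x)"
  shows "loop_noise n \<beta> z x \<le> u\<^sup>2 / (\<beta> * (Im z)\<^sup>2) + \<bar>2 - \<beta>\<bar> * u / (\<beta> * Im z ^ 3)"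
proof -
  let ?\<eta> = "Im z"
  have "norm (resolvent z x i) * norm (loop_deriv n \<beta> z i x) \<le> (norm (resolvent z x i))\<^sup>2 * (u / ?\<eta> + \<bar>2 - \<beta>\<bar> / ?\<eta>\<^sup>2)" for i
  proof -
    let ?R = "norm (resolvent z x i)"
    have R: "?R \<le> 1 / ?\<eta>" by (rule norm_resolvent_le[OF z])
    have "norm (2 - of_real \<beta> :: complex) = \<bar>2 - \<beta>\<bar>"
      by (metis norm_of_real of_real_diff of_real_numeral)
    then have "norm (loop_deriv n \<beta> z i x) \<le> ?R\<^sup>2 * u + \<bar>2 - \<beta>\<bar> * ?R ^ 3"
      unfolding loop_deriv_def u_def loop_disc_def
      by (intro order_trans[OF norm_triangle_ineq]) (simp add: norm_mult norm_power norm_minus_commute)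
    then have "?R * norm (loop_deriv n \<beta> z i x) \<le> ?R * (?R\<^sup>2 * u + \<bar>2 - \<beta>\<bar> * ?R ^ 3)"
      by (rule mult_left_mono) simp
    also have "\<dots> = ?R\<^sup>2 * (u * ?R + \<bar>2 - \<beta>\<bar> * ?R\<^sup>2)"
      by (simp add: power2_eq_square power3_eq_cube algebra_simps)
    also have "\<dots> \<le> ?R\<^sup>2 * (u * (1 / ?\<eta>) + \<bar>2 - \<beta>\<bar> * (1 / ?\<eta>)\<^sup>2)"
      using R by (intro mult_left_mono add_mono power_mono) (auto simp: u_def)
    finally show ?thesis by (simp add: power_divide)
  qed
  then have "loop_noise n \<beta> z x \<le> res_norm2 n z x * (u / ?\<eta> + \<bar>2 - \<beta>\<bar> / ?\<eta>\<^sup>2)"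
    unfolding loop_noise_def res_norm2_def sum_distrib_right by (rule sum_mono)
  also have "\<dots> \<le> u / (\<beta> * ?\<eta>) * (u / ?\<eta> + \<bar>2 - \<beta>\<bar> / ?\<eta>\<^sup>2)"
    using res_norm2_le[OF z \<beta>, of n x] z by (intro mult_right_mono) (auto simp: u_def)
  also have "\<dots> = u\<^sup>2 / (\<beta> * ?\<eta>\<^sup>2) + \<bar>2 - \<beta>\<bar> * u / (\<beta> * ?\<eta> ^ 3)"
    using z \<beta> by (simp add: field_simps power2_eq_square power3_eq_cube)
  finally show ?thesis .
qed

text \<open>The spectral parameter which becomes \<open>\<zeta> = x - \<i> s\<close> in the edge coordinate.\<close>

definition edge_point :: "nat \<Rightarrow> real \<Rightarrow> real \<Rightarrow> real \<Rightarrow> real \<Rightarrow> complex" where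
  "edge_point n \<beta> \<rho> x s = of_real (2 * sqrt (real n * \<beta>)) * (1 - of_real \<rho> * Complex x (- s))"

text \<open>The scale is dictated by z^2/4 - n \<beta> = n \<beta> \<rho> (-2 \<zeta> + \<rho>
  \<zeta>^2) at the edge point, so this normalization of U should stay bounded.\<close>

definition edge_disc :: "nat \<Rightarrow> real \<Rightarrow> real \<Rightarrow> real \<Rightarrow> real \<Rightarrow> (nat \<Rightarrow> real) \<Rightarrow> complex" where
  "edge_disc n \<beta> \<rho> x s X = loop_disc n \<beta> (edge_point n \<beta> \<rho> x s) X / of_real (sqrt (real n * \<beta> * \<rho>))"

text \<open>The size of the term 2 \<beta> L of \<open>loop_disc_square\<close> after division by n
  \<beta> \<rho>, the square of the scale of U.\<close>

definition edge_error :: "nat \<Rightarrow> real \<Rightarrow> real \<Rightarrow> real \<Rightarrow> real \<Rightarrow> (nat \<Rightarrow> real) \<Rightarrow> real" where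
  "edge_error n \<beta> \<rho> x s X = 2 * \<beta> / (real n * \<beta> * \<rho>) * norm (loop_expr n \<beta> (edge_point n \<beta> \<rho> x s) X)"

text \<open>Equals 1/(Im z * sqrt (n \<beta> \<rho>)) at the edge point: the bound 1/Im z for one
  resolvent relative to the scale of U. It is also the mass of one atom of
  \<open>edge_measure\<close> divided by 2 \<beta> s.\<close>

definition edge_kappa :: "nat \<Rightarrow> real \<Rightarrow> real \<Rightarrow> real \<Rightarrow> real" where
  "edge_kappa n \<beta> \<rho> s = 1 / (2 * real n * \<beta> * s * \<rho> powr (3/2))"

text \<open>Tailored to \<open>edge_noise_le\<close>: 2|\<zeta>| + |\<zeta>|^2 bounds the
  deterministic part of \<open>edge_disc\<close> squared when \<rho> \<le> 1, and |2 - \<beta>|^2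
  arises from absorbing the term linear in \<open>edge_disc\<close>.\<close>

definition edge_const :: "real \<Rightarrow> real \<Rightarrow> real \<Rightarrow> real" where
  "edge_const \<beta> x s = 4 * \<beta> * (3 * (2 * norm (Complex x (-s)) + (norm (Complex x (-s)))\<^sup>2) + 3 + 2 * \<bar>2 - \<beta>\<bar>\<^sup>2)"

text \<open>Up to the factor 1/pi, the Poisson integral of \<open>edge_measure\<close> at the point
  x + i s of the upper half-plane.\<close>

definition poisson_avg :: "nat \<Rightarrow> real \<Rightarrow> real \<Rightarrow> real \<Rightarrow> real \<Rightarrow> (nat \<Rightarrow> real) \<Rightarrow> real" where
  "poisson_avg n \<beta> \<rho> x s X = 1 / (real n * \<rho> powr (3/2)) * (\<Sum>k\<in>{1..n}. s / ((edge_coord n \<beta> \<rho> X k - x)\<^sup>2 + s\<^sup>2))"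

lemma powr_three_halves: "\<rho> > 0 \<Longrightarrow> \<rho> powr (3/2) = \<rho> * sqrt (\<rho>::real)"
  using powr_add[of \<rho> 1 "1/2"] by (simp add: powr_half_sqrt)

section \<open>Deterministic estimates at fixed size and scale\<close>

context
  fixes n :: nat and \<beta> \<rho> x s :: real and X :: "nat \<Rightarrow> real"
  assumes n: "n \<ge> 1" and \<beta>: "\<beta> \<ge> 1" and \<rho>: "0 < \<rho>" and s: "s > 0"
begin

private lemma Im_edge_point: "Im (edge_point n \<beta> \<rho> x s) = 2 * sqrt (real n * \<beta>) * \<rho> * s"
  by (simp add: edge_point_def)

lemma Im_edge_point_pos: "Im (edge_point n \<beta> \<rho> x s) > 0"
  unfolding Im_edge_point using n \<beta> \<rho> s by simp

private lemma edge_kappa_eq: "edge_kappa n \<beta> \<rho> s = 1 / (Im (edge_point n \<beta> \<rho> x s) * sqrt (real n * \<beta> * \<rho>))"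
proof -
  have "sqrt (real n * \<beta>) * sqrt (real n * \<beta>) = real n * \<beta>" using \<beta> by simp
  then have "Im (edge_point n \<beta> \<rho> x s) * sqrt (real n * \<beta> * \<rho>) = 2 * (real n * \<beta>) * s * (\<rho> * sqrt \<rho>)"
    unfolding Im_edge_point real_sqrt_mult[of "real n * \<beta>" \<rho>] by (metis (no_types, opaque_lifting) mult.assoc mult.commute)
  then show ?thesis
    using \<rho> by (simp add: edge_kappa_def powr_three_halves mult_ac)
qed

lemma edge_kappa_pos: "edge_kappa n \<beta> \<rho> s > 0"
  using n \<beta> \<rho> s by (simp add: edge_kappa_def)

text \<open>Dividing \<open>loop_disc_square\<close> by n \<beta> \<rho> leaves two errors. The one
  with \<open>res_sum2\<close> is bounded by \<open>res_norm2\<close>, hence by |U|/(\<beta> Im z),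
  which after scaling is \<open>edge_kappa\<close> times \<open>edge_disc\<close>.\<close>

lemma edge_disc_square:
  "norm ((edge_disc n \<beta> \<rho> x s X)\<^sup>2 - (- 2 * Complex x (- s) + of_real \<rho> * (Complex x (- s))\<^sup>2))
   \<le> edge_error n \<beta> \<rho> x s X + \<bar>2 - \<beta>\<bar> * edge_kappa n \<beta> \<rho> s * norm (edge_disc n \<beta> \<rho> x s X)"
proof -
  let ?z = "edge_point n \<beta> \<rho> x s" and ?\<sigma> = "real n * \<beta> * \<rho>" and ?\<zeta> = "Complex x (- s)"
  let ?U = "loop_disc n \<beta> ?z X"
  define \<sigma>' where "\<sigma>' = ?\<sigma>"
  have \<sigma>: "?\<sigma> > 0" using n \<beta> \<rho> by simp
  have z2: "?z\<^sup>2 / 4 - of_nat n * of_real \<beta> = of_real ?\<sigma> * (- 2 * ?\<zeta> + of_real \<rho> * ?\<zeta>\<^sup>2)"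
  proof -
    have "(complex_of_real (2 * sqrt (real n * \<beta>)))\<^sup>2 = 4 * (of_nat n * of_real \<beta>)"
      unfolding of_real_power[symmetric] power_mult_distrib using \<beta> by simp
    then have "?z\<^sup>2 / 4 = of_nat n * of_real \<beta> * (1 - of_real \<rho> * ?\<zeta>)\<^sup>2"
      unfolding edge_point_def power_mult_distrib by simp
    then show ?thesis by (simp add: power2_eq_square algebra_simps)
  qed
  have d2: "(edge_disc n \<beta> \<rho> x s X)\<^sup>2 = ?U\<^sup>2 / of_real ?\<sigma>"
    unfolding edge_disc_def power_divide of_real_power[symmetric] using \<sigma> by simp
  have "(edge_disc n \<beta> \<rho> x s X)\<^sup>2 - (- 2 * ?\<zeta> + of_real \<rho> * ?\<zeta>\<^sup>2) =
     (2 * of_real \<beta> * loop_expr n \<beta> ?z X - of_real \<beta> * (2 - of_real \<beta>) * res_sum2 n ?z X) / of_real ?\<sigma>"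
    unfolding d2 loop_disc_square z2 using \<sigma> unfolding \<sigma>'_def[symmetric] by (simp add: diff_divide_distrib add_divide_distrib)
  also have "norm \<dots> \<le> (2 * \<beta> * norm (loop_expr n \<beta> ?z X) + \<beta> * \<bar>2 - \<beta>\<bar> * res_norm2 n ?z X) / ?\<sigma>"
  proof -
    have b: "norm (2 - of_real \<beta> :: complex) = \<bar>2 - \<beta>\<bar>"
      by (metis norm_of_real of_real_diff of_real_numeral)
    have "norm (2 * of_real \<beta> * loop_expr n \<beta> ?z X - of_real \<beta> * (2 - of_real \<beta>) * res_sum2 n ?z X)
      \<le> norm (2 * of_real \<beta> * loop_expr n \<beta> ?z X) + norm (of_real \<beta> * (2 - of_real \<beta>) * res_sum2 n ?z X)"
      by (rule norm_triangle_ineq4)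
    also have "\<dots> \<le> 2 * \<beta> * norm (loop_expr n \<beta> ?z X) + \<beta> * \<bar>2 - \<beta>\<bar> * res_norm2 n ?z X"
      unfolding norm_mult b using \<beta> norm_res_sum2_le[of n ?z X] by (simp add: mult_left_mono)
    finally show ?thesis
      unfolding norm_divide norm_of_real using \<sigma> by (simp add: divide_right_mono)
  qed
  also have "\<dots> \<le> (2 * \<beta> * norm (loop_expr n \<beta> ?z X) + \<beta> * \<bar>2 - \<beta>\<bar> * (norm ?U / (\<beta> * Im ?z))) / ?\<sigma>"
    using \<sigma> \<beta> res_norm2_le[OF Im_edge_point_pos, of \<beta> n X]
    by (intro divide_right_mono add_left_mono mult_left_mono) auto
  also have "\<dots> = edge_error n \<beta> \<rho> x s X + \<bar>2 - \<beta>\<bar> * (norm ?U / (Im ?z * ?\<sigma>))"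
    using \<beta> by (simp add: edge_error_def add_divide_distrib)
  also have "norm ?U / (Im ?z * ?\<sigma>) = edge_kappa n \<beta> \<rho> s * norm (edge_disc n \<beta> \<rho> x s X)"
    unfolding edge_kappa_eq edge_disc_def norm_divide norm_of_real
    using \<sigma> by (simp add: abs_of_nonneg)
  finally show ?thesis by (simp add: mult.assoc)
qed

private lemma noise_le1:
  "(2 * \<beta> / (real n * \<beta> * \<rho>))\<^sup>2 * loop_noise n \<beta> (edge_point n \<beta> \<rho> x s) X
   \<le> 4 * \<beta> * (edge_kappa n \<beta> \<rho> s)\<^sup>2 * ((norm (edge_disc n \<beta> \<rho> x s X))\<^sup>2
      + \<bar>2 - \<beta>\<bar> * edge_kappa n \<beta> \<rho> s * norm (edge_disc n \<beta> \<rho> x s X))"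
proof -
  let ?\<sigma> = "real n * \<beta> * \<rho>" and ?u = "norm (loop_disc n \<beta> (edge_point n \<beta> \<rho> x s) X)"
  define \<eta> where "\<eta> = Im (edge_point n \<beta> \<rho> x s)"
  define t where "t = sqrt ?\<sigma>"
  have \<sigma>: "?\<sigma> > 0" using n \<beta> \<rho> by simp
  then have t: "t > 0" "?\<sigma> = t\<^sup>2" by (auto simp: t_def)
  have \<eta>: "\<eta> > 0" unfolding \<eta>_def by (rule Im_edge_point_pos)
  have d: "norm (edge_disc n \<beta> \<rho> x s X) = ?u / t"
    unfolding edge_disc_def norm_divide norm_of_real t_def using \<sigma> by simp
  have k: "edge_kappa n \<beta> \<rho> s = 1 / (\<eta> * t)"
    unfolding edge_kappa_eq \<eta>_def t_def ..
  have "(2 * \<beta> / ?\<sigma>)\<^sup>2 * loop_noise n \<beta> (edge_point n \<beta> \<rho> x s) X \<le>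
     (2 * \<beta> / ?\<sigma>)\<^sup>2 * (?u\<^sup>2 / (\<beta> * \<eta>\<^sup>2) + \<bar>2 - \<beta>\<bar> * ?u / (\<beta> * \<eta> ^ 3))"
    unfolding \<eta>_def using loop_noise_le[OF Im_edge_point_pos, of \<beta> n X] \<beta> by (intro mult_left_mono) auto
  also have "\<dots> = 4 * \<beta> * (1 / (\<eta> * t))\<^sup>2 * ((?u / t)\<^sup>2 + \<bar>2 - \<beta>\<bar> * (1 / (\<eta> * t)) * (?u / t))"
    unfolding t(2) using \<beta> \<eta> t(1) by (simp add: field_simps power2_eq_square power3_eq_cube)
  finally show ?thesis unfolding d k .
qed

text \<open>This closes the recursion. The noise is quadratic in \<open>edge_disc\<close> by
  \<open>loop_noise_le\<close>, but \<open>edge_disc_square\<close> bounds that square linearly by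
  the error itself. The noise is therefore linear in \<open>edge_error\<close>, with a prefactor
  \<kappa>^2 that is small.\<close>

lemma edge_noise_le:
  assumes \<rho>1: "\<rho> \<le> 1" and \<kappa>: "edge_kappa n \<beta> \<rho> s \<le> 1"
  shows "(2 * \<beta> / (real n * \<beta> * \<rho>))\<^sup>2 * loop_noise n \<beta> (edge_point n \<beta> \<rho> x s) X
   \<le> edge_const \<beta> x s * (edge_kappa n \<beta> \<rho> s)\<^sup>2 * (1 + edge_error n \<beta> \<rho> x s X)"
proof -
  let ?\<zeta> = "Complex x (- s)"
  define c where "c = 2 * norm ?\<zeta> + (norm ?\<zeta>)\<^sup>2"
  define u where "u = norm (edge_disc n \<beta> \<rho> x s X)"
  define l where "l = edge_error n \<beta> \<rho> x s X"
  define k where "k = \<bar>2 - \<beta>\<bar>"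
  define \<kappa>' where "\<kappa>' = edge_kappa n \<beta> \<rho> s"
  have \<kappa>': "0 < \<kappa>'" "\<kappa>' \<le> 1" unfolding \<kappa>'_def using edge_kappa_pos \<kappa> by auto
  have l: "l \<ge> 0" unfolding l_def edge_error_def using n \<beta> \<rho> by simp
  have u: "u \<ge> 0" and k: "k \<ge> 0" and c: "c \<ge> 0" by (auto simp: u_def k_def c_def)
  have "norm (- 2 * ?\<zeta> + of_real \<rho> * ?\<zeta>\<^sup>2) \<le> c"
  proof -
    have "norm (- 2 * ?\<zeta> + of_real \<rho> * ?\<zeta>\<^sup>2) \<le> norm (- 2 * ?\<zeta>) + norm (of_real \<rho> * ?\<zeta>\<^sup>2)"
      by (rule norm_triangle_ineq)
    also have "\<dots> \<le> c"
      unfolding c_def norm_mult norm_power using \<rho> \<rho>1 by (auto intro!: mult_left_le_one_le)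
    finally show ?thesis .
  qed
  moreover have "norm ((edge_disc n \<beta> \<rho> x s X)\<^sup>2) \<le> norm (- 2 * ?\<zeta> + of_real \<rho> * ?\<zeta>\<^sup>2) + (l + k * \<kappa>' * u)"
    using edge_disc_square norm_triangle_sub[of "(edge_disc n \<beta> \<rho> x s X)\<^sup>2" "- 2 * ?\<zeta> + of_real \<rho> * ?\<zeta>\<^sup>2"]
    unfolding l_def k_def \<kappa>'_def u_def by linarith
  moreover have ku: "k * \<kappa>' * u \<le> k * u"
    using \<kappa>' k u by (intro mult_right_mono mult_left_le) auto
  ultimately have "u\<^sup>2 \<le> c + l + k * u"
    by (simp add: u_def norm_power)
  \<comment> \<open>Absorbing k u into (k^2 + u^2)/2 gives u^2 \<le> 2c + 2l + k^2; adding k u once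
    more yields the coefficients 3, 3, 2 below.\<close>
  moreover have "2 * (k * u) \<le> k\<^sup>2 + u\<^sup>2"
    using zero_le_power2[of "k - u"] by (simp add: power2_diff)
  ultimately have "u\<^sup>2 + k * \<kappa>' * u \<le> 3 * c + 3 * l + 2 * k\<^sup>2"
    using ku by linarith
  also have "\<dots> \<le> (3 * c + 3 + 2 * k\<^sup>2) * (1 + l)"
    using c l by (simp add: algebra_simps)
  finally have "4 * \<beta> * \<kappa>'\<^sup>2 * (u\<^sup>2 + k * \<kappa>' * u) \<le> 4 * \<beta> * \<kappa>'\<^sup>2 * ((3 * c + 3 + 2 * k\<^sup>2) * (1 + l))"
    using \<beta> by (intro mult_left_mono) auto
  with noise_le1 have "(2 * \<beta> / (real n * \<beta> * \<rho>))\<^sup>2 * loop_noise n \<beta> (edge_point n \<beta> \<rho> x s) X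
      \<le> 4 * \<beta> * \<kappa>'\<^sup>2 * ((3 * c + 3 + 2 * k\<^sup>2) * (1 + l))"
    unfolding k_def \<kappa>'_def u_def by (rule order_trans)
  also have "\<dots> = edge_const \<beta> x s * \<kappa>'\<^sup>2 * (1 + l)"
    unfolding edge_const_def c_def[symmetric] k_def[symmetric] by (simp only: mult_ac)
  finally show ?thesis unfolding \<kappa>'_def l_def .
qed

text \<open>With \<zeta> = x - i s one has z - lambda_k = 2 sqrt (n \<beta>) \<rho> (\<theta>_k -
  \<zeta>), so the sum of squared resolvents is a Poisson sum over the edge coordinates. The summand
  sqrt \<rho> * s comes from z/2 and disappears in the limit.\<close>

lemma Im_edge_disc: "Im (edge_disc n \<beta> \<rho> x s X) = sqrt \<rho> * s + poisson_avg n \<beta> \<rho> x s X / 2"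
proof -
  let ?z = "edge_point n \<beta> \<rho> x s"
  define q where "q = sqrt (real n * \<beta>)"
  have q: "q > 0" "q\<^sup>2 = real n * \<beta>" using n \<beta> by (auto simp: q_def)
  define p where "p = sqrt \<rho>"
  have p: "p > 0" "\<rho> = p\<^sup>2" using \<rho> by (auto simp: p_def)
  have R: "(norm (resolvent ?z X k))\<^sup>2 = 1 / (4 * q\<^sup>2 * \<rho>\<^sup>2 * ((edge_coord n \<beta> \<rho> X k - x)\<^sup>2 + s\<^sup>2))" for k
  proof -
    have "?z - of_real (X k) = of_real (2 * q * \<rho>) * Complex (edge_coord n \<beta> \<rho> X k - x) s"
      unfolding edge_point_def edge_coord_def rescaled_eigenvalue_def q_def[symmetric]
      using \<rho> q(1) by (simp add: complex_eq_iff field_simps)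
    then have "(norm (?z - of_real (X k)))\<^sup>2 = (2 * q * \<rho>)\<^sup>2 * ((edge_coord n \<beta> \<rho> X k - x)\<^sup>2 + s\<^sup>2)"
      by (simp add: norm_mult power_mult_distrib cmod_power2)
    then show ?thesis
      by (simp add: resolvent_def norm_divide power_divide power_mult_distrib)
  qed
  have B: "res_norm2 n ?z X = 1 / (4 * q\<^sup>2 * \<rho>\<^sup>2 * s) * (\<Sum>k\<in>{1..n}. s / ((edge_coord n \<beta> \<rho> X k - x)\<^sup>2 + s\<^sup>2))"
    unfolding res_norm2_def R sum_distrib_left using s by (intro sum.cong) (auto simp: field_simps)
  define W where "W = (\<Sum>k\<in>{1..n}. s / ((edge_coord n \<beta> \<rho> X k - x)\<^sup>2 + s\<^sup>2))"
  have st: "sqrt (real n * \<beta> * \<rho>) = q * p" by (simp add: q_def p_def real_sqrt_mult)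
  have Im: "Im ?z = 2 * q * \<rho> * s" by (simp add: Im_edge_point q_def)
  have pr: "\<rho> powr (3/2) = p ^ 3" using \<rho> by (simp add: powr_three_halves p_def power3_eq_cube)
  have nq: "real n = q\<^sup>2 / \<beta>" using q \<beta> by simp
  have "Im (edge_disc n \<beta> \<rho> x s X) = (Im ?z / 2 + \<beta> * Im ?z * res_norm2 n ?z X) / (q * p)"
    unfolding edge_disc_def st by (simp only: Im_divide_of_real Im_loop_disc)
  also have "\<dots> = p * s + 1 / (real n * p ^ 3) * W / 2"
    unfolding Im B W_def[symmetric] unfolding p(2) nq using q(1) p(1) s \<beta> by (simp add: field_simps power2_eq_square power3_eq_cube)
  finally show ?thesis
    unfolding poisson_avg_def pr W_def p_def[symmetric] .
qed

end

lemma edge_error_measurable [measurable]: "edge_error n \<beta> \<rho> x s \<in> borel_measurable (config_lborel n)"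
  unfolding edge_error_def[abs_def] by measurable

lemma edge_error_nonneg: "\<beta> \<ge> 0 \<Longrightarrow> \<rho> \<ge> 0 \<Longrightarrow> edge_error n \<beta> \<rho> x s X \<ge> 0"
  by (simp add: edge_error_def)

lemma edge_const_nonneg: "\<beta> \<ge> 0 \<Longrightarrow> edge_const \<beta> x s \<ge> 0"
  by (simp add: edge_const_def)

section \<open>Moments of the edge error\<close>

lemma edge_error_integrable:
  assumes "prob_space M" and X: "gaussian_beta_ensemble M n \<beta> X"
    and n: "n \<ge> 1" and \<beta>: "\<beta> \<ge> 1" and \<rho>: "0 < \<rho>" and s: "s > 0"
  shows "integrable M (\<lambda>\<omega>. edge_error n \<beta> \<rho> x s (X \<omega>) ^ q)"
proof -
  interpret prob_space M by fact
  note gbe_measurable[OF X, measurable]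
  obtain C where C: "\<And>X. norm (loop_expr n \<beta> (edge_point n \<beta> \<rho> x s) X) \<le> C"
    using loop_expr_bounded[OF Im_edge_point_pos[OF n \<beta> \<rho> s]] by blast
  show ?thesis
  proof (rule integrable_const_bound[where B="(2 * \<beta> / (real n * \<beta> * \<rho>) * C) ^ q"])
    have "norm (edge_error n \<beta> \<rho> x s Y ^ q) \<le> (2 * \<beta> / (real n * \<beta> * \<rho>) * C) ^ q" for Y
      using edge_error_nonneg[of \<beta> \<rho> n x s Y] \<beta> \<rho> C unfolding norm_power
      by (intro power_mono) (auto simp: edge_error_def intro!: divide_right_mono)
    then show "AE \<omega> in M. norm (edge_error n \<beta> \<rho> x s (X \<omega>) ^ q) \<le> (2 * \<beta> / (real n * \<beta> * \<rho>) * C) ^ q" by simp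
  qed measurable
qed

text \<open>The linear bound of \<open>edge_noise_le\<close> would introduce an odd moment; 1 + l
  \<le> 3/2 + l^2/2 replaces it by even ones. The top moment then reappears on the right with
  coefficient at most 1/2 and is absorbed, which doubles 3/2 to 3.\<close>

lemma edge_error_moment_step:
  assumes M: "prob_space M" and X: "gaussian_beta_ensemble M n \<beta> X"
    and n: "n \<ge> 1" and \<beta>: "\<beta> \<ge> 1" and \<rho>: "0 < \<rho>" "\<rho> \<le> 1" and s: "s > 0"
    and \<kappa>: "edge_kappa n \<beta> \<rho> s \<le> 1" "(2 * real q + 1) * edge_const \<beta> x s * (edge_kappa n \<beta> \<rho> s)\<^sup>2 \<le> 1"
  shows "(\<integral>\<omega>. edge_error n \<beta> \<rho> x s (X \<omega>) ^ (2 * q + 2) \<partial>M) \<le>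
    3 * ((2 * real q + 1) * edge_const \<beta> x s * (edge_kappa n \<beta> \<rho> s)\<^sup>2) * (\<integral>\<omega>. edge_error n \<beta> \<rho> x s (X \<omega>) ^ (2 * q) \<partial>M)"
proof -
  let ?z = "edge_point n \<beta> \<rho> x s"
  define t where "t = 2 * \<beta> / (real n * \<beta> * \<rho>)"
  define K where "K = edge_const \<beta> x s * (edge_kappa n \<beta> \<rho> s)\<^sup>2"
  define l where "l = (\<lambda>\<omega>. edge_error n \<beta> \<rho> x s (X \<omega>))"
  have t: "t \<ge> 0" using \<beta> \<rho> by (simp add: t_def)
  have K: "K \<ge> 0" using \<beta> by (simp add: K_def edge_const_nonneg)
  have l: "l \<omega> = t * norm (loop_expr n \<beta> ?z (X \<omega>))" for \<omega>
    by (simp add: l_def edge_error_def t_def)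
  have l0: "l \<omega> \<ge> 0" for \<omega> using t by (simp add: l)
  have int: "integrable M (\<lambda>\<omega>. l \<omega> ^ j)" for j
    unfolding l_def by (rule edge_error_integrable[OF M X n \<beta> \<rho>(1) s])
  have "(\<integral>\<omega>. l \<omega> ^ (2 * q + 2) \<partial>M) = t ^ (2 * q + 2) * (\<integral>\<omega>. norm (loop_expr n \<beta> ?z (X \<omega>)) ^ (2 * q + 2) \<partial>M)"
    unfolding l power_mult_distrib by simp
  also have "\<dots> \<le> t ^ (2 * q + 2) * ((2 * real q + 1) * (\<integral>\<omega>. norm (loop_expr n \<beta> ?z (X \<omega>)) ^ (2 * q) * loop_noise n \<beta> ?z (X \<omega>) \<partial>M))"
    by (intro mult_left_mono loop_moment_le[OF M X \<beta>] Im_edge_point_pos n \<beta> \<rho> s) (use t in auto)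
  also have "\<dots> = (2 * real q + 1) * (\<integral>\<omega>. t ^ (2 * q + 2) * (norm (loop_expr n \<beta> ?z (X \<omega>)) ^ (2 * q) * loop_noise n \<beta> ?z (X \<omega>)) \<partial>M)"
    by simp
  also have "\<dots> = (2 * real q + 1) * (\<integral>\<omega>. l \<omega> ^ (2 * q) * (t\<^sup>2 * loop_noise n \<beta> ?z (X \<omega>)) \<partial>M)"
    unfolding l power_mult_distrib power_add by (simp only: mult_ac)
  also have "\<dots> \<le> (2 * real q + 1) * (\<integral>\<omega>. K * (3 / 2 * l \<omega> ^ (2 * q) + 1 / 2 * l \<omega> ^ (2 * q + 2)) \<partial>M)"
  proof (rule mult_left_mono[OF integral_mono'])
    show "integrable M (\<lambda>\<omega>. K * (3 / 2 * l \<omega> ^ (2 * q) + 1 / 2 * l \<omega> ^ (2 * q + 2)))"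
      by (intro integrable_mult_right Bochner_Integration.integrable_add int)
    fix \<omega>
    have "t\<^sup>2 * loop_noise n \<beta> ?z (X \<omega>) \<le> K * (1 + l \<omega>)"
      unfolding t_def K_def l_def by (rule edge_noise_le[OF n \<beta> \<rho>(1) s \<rho>(2) \<kappa>(1)])
    then have "l \<omega> ^ (2 * q) * (t\<^sup>2 * loop_noise n \<beta> ?z (X \<omega>)) \<le> l \<omega> ^ (2 * q) * (K * (1 + l \<omega>))"
      by (rule mult_left_mono) (simp add: l0)
    also have "\<dots> = K * (l \<omega> ^ (2 * q) * (1 + l \<omega>))" by simp
    also have "\<dots> \<le> K * (l \<omega> ^ (2 * q) * (3 / 2 + 1 / 2 * (l \<omega>)\<^sup>2))"
      using zero_le_power2[of "l \<omega> - 1"] l0 K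
      by (intro mult_left_mono) (auto simp: power2_diff)
    finally show "l \<omega> ^ (2 * q) * (t\<^sup>2 * loop_noise n \<beta> ?z (X \<omega>)) \<le> K * (3 / 2 * l \<omega> ^ (2 * q) + 1 / 2 * l \<omega> ^ (2 * q + 2))"
      by (simp add: algebra_simps power_add power2_eq_square)
    show "0 \<le> K * (3 / 2 * l \<omega> ^ (2 * q) + 1 / 2 * l \<omega> ^ (2 * q + 2))"
      using K l0 by (intro mult_nonneg_nonneg add_nonneg_nonneg) auto
  qed simp
  also have "\<dots> = ((2 * real q + 1) * K) * (3 / 2 * (\<integral>\<omega>. l \<omega> ^ (2 * q) \<partial>M) + 1 / 2 * (\<integral>\<omega>. l \<omega> ^ (2 * q + 2) \<partial>M))"
    using int by (simp add: Bochner_Integration.integral_add integrable_mult_right del: power_Suc add_2_eq_Suc')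
  finally have 1: "(\<integral>\<omega>. l \<omega> ^ (2 * q + 2) \<partial>M) \<le> ((2 * real q + 1) * K) * (3 / 2 * (\<integral>\<omega>. l \<omega> ^ (2 * q) \<partial>M) + 1 / 2 * (\<integral>\<omega>. l \<omega> ^ (2 * q + 2) \<partial>M))" .
  \<comment> \<open>The smallness assumption on \<kappa> is used here: the coefficient of the top
    moment is at most 1, and half of it moves to the left.\<close>
  have 2: "((2 * real q + 1) * K) * (\<integral>\<omega>. l \<omega> ^ (2 * q + 2) \<partial>M) \<le> (\<integral>\<omega>. l \<omega> ^ (2 * q + 2) \<partial>M)"
    using \<kappa>(2) K l0 by (intro mult_left_le_one_le Bochner_Integration.integral_nonneg) (auto simp: K_def mult.assoc)
  have "(\<integral>\<omega>. l \<omega> ^ (2 * q + 2) \<partial>M) \<le> 3 * ((2 * real q + 1) * K) * (\<integral>\<omega>. l \<omega> ^ (2 * q) \<partial>M)"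
    using 1 2 unfolding distrib_left by linarith
  then show ?thesis by (simp add: K_def l_def mult.assoc)
qed

text \<open>The step is iterated p times from the moment of order 0, which is 1 on a probability
  space; each 2q+1 is enlarged to 2p+1.\<close>

lemma edge_error_moment:
  assumes M: "prob_space M" and X: "gaussian_beta_ensemble M n \<beta> X"
    and n: "n \<ge> 1" and \<beta>: "\<beta> \<ge> 1" and \<rho>: "0 < \<rho>" "\<rho> \<le> 1" and s: "s > 0"
    and \<kappa>: "edge_kappa n \<beta> \<rho> s \<le> 1" "(2 * real p + 1) * edge_const \<beta> x s * (edge_kappa n \<beta> \<rho> s)\<^sup>2 \<le> 1"
  shows "(\<integral>\<omega>. edge_error n \<beta> \<rho> x s (X \<omega>) ^ (2 * p) \<partial>M) \<le>
    (3 * ((2 * real p + 1) * edge_const \<beta> x s * (edge_kappa n \<beta> \<rho> s)\<^sup>2)) ^ p"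
proof -
  interpret prob_space M by fact
  define K where "K = edge_const \<beta> x s * (edge_kappa n \<beta> \<rho> s)\<^sup>2"
  have K: "K \<ge> 0" using \<beta> by (simp add: K_def edge_const_nonneg)
  have "(\<integral>\<omega>. edge_error n \<beta> \<rho> x s (X \<omega>) ^ (2 * q) \<partial>M) \<le> (3 * ((2 * real p + 1) * K)) ^ q" if "q \<le> p" for q
    using that
  proof (induction q)
    case 0
    then show ?case by (simp add: prob_space)
  next
    case (Suc q)
    have le: "(2 * real q + 1) * K \<le> (2 * real p + 1) * K"
      using Suc.prems K by (intro mult_right_mono) auto
    have I0: "0 \<le> (\<integral>\<omega>. edge_error n \<beta> \<rho> x s (X \<omega>) ^ (2 * q) \<partial>M)"
      using edge_error_nonneg \<beta> \<rho> by (intro Bochner_Integration.integral_nonneg) auto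
    have "(\<integral>\<omega>. edge_error n \<beta> \<rho> x s (X \<omega>) ^ (2 * q + 2) \<partial>M) \<le>
      3 * ((2 * real q + 1) * edge_const \<beta> x s * (edge_kappa n \<beta> \<rho> s)\<^sup>2) * (\<integral>\<omega>. edge_error n \<beta> \<rho> x s (X \<omega>) ^ (2 * q) \<partial>M)"
    proof (rule edge_error_moment_step[OF M X n \<beta> \<rho> s \<kappa>(1)])
      show "(2 * real q + 1) * edge_const \<beta> x s * (edge_kappa n \<beta> \<rho> s)\<^sup>2 \<le> 1"
        using le \<kappa>(2) unfolding K_def mult.assoc by linarith
    qed
    also have "\<dots> = 3 * ((2 * real q + 1) * K) * (\<integral>\<omega>. edge_error n \<beta> \<rho> x s (X \<omega>) ^ (2 * q) \<partial>M)"
      by (simp add: K_def mult.assoc)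
    also have "\<dots> \<le> (3 * ((2 * real p + 1) * K)) * (3 * ((2 * real p + 1) * K)) ^ q"
      using Suc le K I0 by (intro mult_mono) auto
    finally show ?case by (simp add: add.commute)
  qed
  from this[OF order_refl] show ?thesis by (simp add: K_def mult.assoc)
qed

section \<open>Decay of the error along the sequence\<close>

text \<open>The exponent 2/3 is critical: at \<rho> = n^(-2/3) the quantity n \<rho>^(3/2) equals 1,
  and a margin \<epsilon> in the exponent turns it into the power n^(3 \<epsilon>/2).\<close>

lemma edge_kappa_le:
  assumes \<beta>: "\<beta> \<ge> 1" and s: "s > 0" and n: "n \<ge> 1" and r: "\<rho> > real n powr (\<epsilon> - 2/3)"
  shows "edge_kappa n \<beta> \<rho> s \<le> 1 / (2 * \<beta> * s) * real n powr (- (3/2 * \<epsilon>))"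
proof -
  have n0: "real n > 0" using n by simp
  have "(real n powr (\<epsilon> - 2/3)) powr (3/2) \<le> \<rho> powr (3/2)"
    using r by (intro powr_mono2) auto
  then have "real n powr (3/2 * \<epsilon> - 1) \<le> \<rho> powr (3/2)"
    by (simp add: powr_powr algebra_simps)
  then have "real n * real n powr (3/2 * \<epsilon> - 1) \<le> real n * \<rho> powr (3/2)"
    by (rule mult_left_mono) simp
  moreover have "real n * real n powr (3/2 * \<epsilon> - 1) = real n powr (3/2 * \<epsilon>)"
    using n0 by (simp add: powr_mult_base)
  ultimately have le: "real n powr (3/2 * \<epsilon>) \<le> real n * \<rho> powr (3/2)" by simp
  have "edge_kappa n \<beta> \<rho> s = 1 / (2 * \<beta> * s) * (1 / (real n * \<rho> powr (3/2)))"
    by (simp add: edge_kappa_def)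
  also have "\<dots> \<le> 1 / (2 * \<beta> * s) * (1 / real n powr (3/2 * \<epsilon>))"
    using le n0 \<beta> s by (intro mult_left_mono divide_left_mono mult_pos_pos) (auto intro: less_le_trans)
  finally show ?thesis by (simp add: powr_minus_divide)
qed

lemma edge_kappa_tendsto_0:
  assumes \<beta>: "\<beta> \<ge> 1" and s: "s > 0" and \<epsilon>: "\<epsilon> > 0"
    and r: "\<forall>\<^sub>F n in sequentially. r n > real n powr (\<epsilon> - 2/3)"
  shows "(\<lambda>n. edge_kappa n \<beta> (r n) s) \<longlonglongrightarrow> 0"
proof (rule tendsto_sandwich[OF _ _ tendsto_const])
  show "\<forall>\<^sub>F n in sequentially. 0 \<le> edge_kappa n \<beta> (r n) s"
    using \<beta> s by (intro always_eventually) (auto simp: edge_kappa_def)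
  show "\<forall>\<^sub>F n in sequentially. edge_kappa n \<beta> (r n) s \<le> 1 / (2 * \<beta> * s) * real n powr (- (3/2 * \<epsilon>))"
    using r eventually_ge_at_top[of 1] by eventually_elim (rule edge_kappa_le[OF \<beta> s])
  have "(\<lambda>n. real n powr (- (3/2 * \<epsilon>))) \<longlonglongrightarrow> 0"
    using \<epsilon> by (intro tendsto_neg_powr filterlim_real_sequentially) auto
  then show "(\<lambda>n. 1 / (2 * \<beta> * s) * real n powr (- (3/2 * \<epsilon>))) \<longlonglongrightarrow> 0"
    by (rule tendsto_mult_right_zero)
qed

lemma edge_error_AE_tendsto_0:
  assumes \<beta>: "\<beta> \<ge> 1" and s: "s > 0" and \<epsilon>: "\<epsilon> > 0"
    and r: "\<forall>\<^sub>F n in sequentially. r n > real n powr (\<epsilon> - 2/3)" and r0: "r \<longlonglongrightarrow> 0"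
    and P: "prob_space P" and \<Lambda>: "\<And>n. n \<ge> 1 \<Longrightarrow> gaussian_beta_ensemble P n \<beta> (\<Lambda> n)"
  shows "AE \<omega> in P. (\<lambda>n. edge_error n \<beta> (r n) x s (\<Lambda> n \<omega>)) \<longlonglongrightarrow> 0"
proof -
  interpret prob_space P by fact
  \<comment> \<open>The moment of order 2p decays like \<kappa>^(2p), that is n^(-3 \<epsilon> p),
    and this p makes 3 \<epsilon> p \<ge> 2, so that n^(-2) is a summable bound. The successor keeps
    2p positive, so the power can be undone at the end.\<close>
  define p where "p = Suc (nat \<lceil>2 / (3 * \<epsilon>)\<rceil>)"
  have "2 / (3 * \<epsilon>) \<le> real p" unfolding p_def by linarith
  then have p: "2 \<le> 3 * \<epsilon> * real p" using \<epsilon> by (simp add: field_simps)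
  define K where "K = (2 * real p + 1) * edge_const \<beta> x s"
  have K: "K \<ge> 0" using \<beta> by (simp add: K_def edge_const_nonneg)
  define A where "A = (3 * K * (1 / (2 * \<beta> * s))\<^sup>2) ^ p"
  have \<kappa>0: "(\<lambda>n. edge_kappa n \<beta> (r n) s) \<longlonglongrightarrow> 0"
    by (rule edge_kappa_tendsto_0[OF \<beta> s \<epsilon> r])
  have "(\<lambda>n. K * (edge_kappa n \<beta> (r n) s)\<^sup>2) \<longlonglongrightarrow> K * 0\<^sup>2"
    by (intro tendsto_intros \<kappa>0)
  then have "\<forall>\<^sub>F n in sequentially. K * (edge_kappa n \<beta> (r n) s)\<^sup>2 < 1"
    by (rule order_tendstoD) simp
  moreover have "\<forall>\<^sub>F n in sequentially. edge_kappa n \<beta> (r n) s < 1"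
    using \<kappa>0 by (rule order_tendstoD) simp
  moreover have "\<forall>\<^sub>F n in sequentially. r n < 1"
    using r0 by (rule order_tendstoD) simp
  ultimately have "\<forall>\<^sub>F n in sequentially. n \<ge> 1 \<and> r n > 0 \<and> r n < 1 \<and>
      (\<integral>\<omega>. edge_error n \<beta> (r n) x s (\<Lambda> n \<omega>) ^ (2 * p) \<partial>P) \<le> A * (1 / (real n)\<^sup>2)"
    using r eventually_ge_at_top[of 1]
  proof eventually_elim
    case (elim n)
    have n0: "real n > 0" using elim by simp
    have rn: "r n > 0" using elim(4) by (rule le_less_trans[rotated]) simp
    let ?\<kappa> = "edge_kappa n \<beta> (r n) s"
    have "(\<integral>\<omega>. edge_error n \<beta> (r n) x s (\<Lambda> n \<omega>) ^ (2 * p) \<partial>P) \<le> (3 * ((2 * real p + 1) * edge_const \<beta> x s * ?\<kappa>\<^sup>2)) ^ p"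
      using elim rn by (intro edge_error_moment[OF P \<Lambda> _ \<beta> _ _ s]) (auto simp: K_def)
    also have "\<dots> \<le> (3 * (K * (1 / (2 * \<beta> * s) * real n powr (- (3/2 * \<epsilon>)))\<^sup>2)) ^ p"
      unfolding K_def[symmetric] using K edge_kappa_le[OF \<beta> s elim(5,4)] edge_kappa_pos[OF elim(5) \<beta> rn s]
      by (intro power_mono mult_left_mono) auto
    also have "\<dots> = A * ((real n powr (- (3/2 * \<epsilon>)))\<^sup>2) ^ p"
      unfolding A_def by (simp only: power_mult_distrib mult_ac)
    also have "((real n powr (- (3/2 * \<epsilon>)))\<^sup>2) ^ p = real n powr (- (3 * \<epsilon> * real p))"
      using n0 by (simp add: powr_powr mult_ac flip: powr_realpow power_mult)
    also have "A * real n powr (- (3 * \<epsilon> * real p)) \<le> A * real n powr (- 2)"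
      using p elim K by (intro mult_left_mono powr_mono) (auto simp: A_def)
    also have "real n powr (- 2) = 1 / (real n)\<^sup>2"
      using n0 by (simp add: powr_minus_divide)
    finally have "(\<integral>\<omega>. edge_error n \<beta> (r n) x s (\<Lambda> n \<omega>) ^ (2 * p) \<partial>P) \<le> A * (1 / (real n)\<^sup>2)" .
    then show ?case using elim rn by simp
  qed
  then obtain n0 where n0: "\<And>n. n \<ge> n0 \<Longrightarrow> n \<ge> 1 \<and> r n > 0 \<and> r n < 1 \<and>
      (\<integral>\<omega>. edge_error n \<beta> (r n) x s (\<Lambda> n \<omega>) ^ (2 * p) \<partial>P) \<le> A * (1 / (real n)\<^sup>2)"
    unfolding eventually_sequentially by blast
  define f where "f m \<omega> = edge_error (m + n0) \<beta> (r (m + n0)) x s (\<Lambda> (m + n0) \<omega>) ^ (2 * p)" for m \<omega>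
  have m1: "m + n0 \<ge> 1" "r (m + n0) > 0" for m using n0[of "m + n0"] by auto
  have [measurable]: "f m \<in> borel_measurable P" for m
  proof -
    note gbe_measurable[OF \<Lambda>[OF m1(1)[of m]], measurable]
    show ?thesis unfolding f_def[abs_def] by measurable
  qed
  have f0: "f m \<omega> \<ge> 0" for m \<omega>
    unfolding f_def by simp
  have A0: "A \<ge> 0" using K by (simp add: A_def)
  have sm: "summable (\<lambda>m. A * (1 / (real (m + n0))\<^sup>2))"
    by (intro summable_mult summable_ignore_initial_segment[where f="\<lambda>n. 1 / (real n)\<^sup>2"])
       (use inverse_power_summable[of 2, where 'a=real] in \<open>simp add: inverse_eq_divide\<close>)
  \<comment> \<open>The summed series has finite expectation, so it converges almost surely and its
    terms tend to 0. Only the marginal laws enter, hence the freedom in the coupling.\<close>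
  have "(\<integral>\<^sup>+\<omega>. (\<Sum>m. ennreal (f m \<omega>)) \<partial>P) = (\<Sum>m. \<integral>\<^sup>+\<omega>. ennreal (f m \<omega>) \<partial>P)"
    by (rule nn_integral_suminf) measurable
  also have "\<dots> \<le> (\<Sum>m. ennreal (A * (1 / (real (m + n0))\<^sup>2)))"
  proof (intro suminf_le summableI)
    fix m
    have "(\<integral>\<^sup>+\<omega>. ennreal (f m \<omega>) \<partial>P) = ennreal (\<integral>\<omega>. f m \<omega> \<partial>P)"
      unfolding f_def using f0[unfolded f_def] m1[of m]
      by (intro nn_integral_eq_integral edge_error_integrable[OF P \<Lambda> _ \<beta> _ s]) auto
    also have "\<dots> \<le> ennreal (A * (1 / (real (m + n0))\<^sup>2))"
      using n0[of "m + n0"] by (intro ennreal_leI) (auto simp: f_def)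
    finally show "(\<integral>\<^sup>+\<omega>. ennreal (f m \<omega>) \<partial>P) \<le> ennreal (A * (1 / (real (m + n0))\<^sup>2))" .
  qed
  also have "\<dots> < \<infinity>"
    using A0 sm by (subst suminf_ennreal2) auto
  finally have "(\<integral>\<^sup>+\<omega>. (\<Sum>m. ennreal (f m \<omega>)) \<partial>P) \<noteq> \<infinity>" by simp
  then have "AE \<omega> in P. (\<Sum>m. ennreal (f m \<omega>)) \<noteq> \<infinity>"
    by (intro nn_integral_PInf_AE) auto
  then show ?thesis
  proof eventually_elim
    case (elim \<omega>)
    then have "summable (\<lambda>m. f m \<omega>)"
      using f0 by (intro summable_suminf_not_top) auto
    then have "(\<lambda>m. edge_error (m + n0) \<beta> (r (m + n0)) x s (\<Lambda> (m + n0) \<omega>) ^ (2 * p)) \<longlonglongrightarrow> 0"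
      unfolding f_def by (rule summable_LIMSEQ_zero)
    then have "(\<lambda>m. edge_error (m + n0) \<beta> (r (m + n0)) x s (\<Lambda> (m + n0) \<omega>)) \<longlonglongrightarrow> 0"
      by (subst (asm) power_tendsto_0_iff) (auto simp: p_def)
    then show ?case by (rule LIMSEQ_offset)
  qed
qed

section \<open>From the squared discriminant to Poisson averages\<close>

text \<open>Since |t^2| - Re (t^2) = 2 (Im t)^2, the imaginary part of the root in the upper
  half-plane is a continuous function of the square, and no branch of the complex square root has to
  be chosen.\<close>

lemma Im_eq_sqrt: "Im t \<ge> 0 \<Longrightarrow> Im t = sqrt ((norm (t\<^sup>2) - Re (t\<^sup>2)) / 2)"
proof -
  assume "Im t \<ge> 0"
  have "norm (t\<^sup>2) = (Re t)\<^sup>2 + (Im t)\<^sup>2" by (simp add: norm_power cmod_power2)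
  moreover have "Re (t\<^sup>2) = (Re t)\<^sup>2 - (Im t)\<^sup>2" by (simp add: power2_eq_square)
  ultimately show ?thesis using \<open>Im t \<ge> 0\<close> by simp
qed

lemma poisson_avg_nonneg: "s \<ge> 0 \<Longrightarrow> poisson_avg n \<beta> \<rho> x s X \<ge> 0"
  unfolding poisson_avg_def by (intro mult_nonneg_nonneg sum_nonneg) auto

text \<open>A deterministic statement, later used outcome by outcome. The error in
  \<open>edge_disc_square\<close> contains \<open>edge_disc\<close> itself, so boundedness comes
  first; then the squares tend to -2 \<zeta>, and \<open>Im_eq_sqrt\<close> and
  \<open>Im_edge_disc\<close> read off the limit.\<close>

lemma poisson_avg_tendsto:
  assumes \<beta>: "\<beta> \<ge> 1" and s: "s > 0" and r: "\<And>n. n \<ge> 1 \<Longrightarrow> r n > 0" and r0: "r \<longlonglongrightarrow> 0"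
    and \<kappa>0: "(\<lambda>n. edge_kappa n \<beta> (r n) s) \<longlonglongrightarrow> 0"
    and l0: "(\<lambda>n. edge_error n \<beta> (r n) x s (X n)) \<longlonglongrightarrow> 0"
  shows "(\<lambda>n. poisson_avg n \<beta> (r n) x s (X n)) \<longlonglongrightarrow> 2 * sqrt (sqrt (x\<^sup>2 + s\<^sup>2) + x)"
proof -
  define \<zeta> where "\<zeta> = Complex x (- s)"
  define T where "T n = edge_disc n \<beta> (r n) x s (X n)" for n
  define w where "w n = - 2 * \<zeta> + of_real (r n) * \<zeta>\<^sup>2" for n
  define l where "l n = edge_error n \<beta> (r n) x s (X n)" for n
  define k where "k n = \<bar>2 - \<beta>\<bar> * edge_kappa n \<beta> (r n) s" for n
  have "(\<lambda>n. - 2 * \<zeta> + of_real (r n) * \<zeta>\<^sup>2) \<longlonglongrightarrow> - 2 * \<zeta> + of_real 0 * \<zeta>\<^sup>2"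
    by (intro tendsto_intros r0)
  then have w: "w \<longlonglongrightarrow> - 2 * \<zeta>" unfolding w_def[abs_def] by simp
  have l: "l \<longlonglongrightarrow> 0" unfolding l_def by (rule l0)
  have "k \<longlonglongrightarrow> \<bar>2 - \<beta>\<bar> * 0" unfolding k_def by (intro tendsto_intros \<kappa>0)
  then have k: "k \<longlonglongrightarrow> 0" by simp
  have T: "norm ((T n)\<^sup>2 - w n) \<le> l n + k n * norm (T n)" if "n \<ge> 1" for n
    unfolding T_def w_def l_def k_def \<zeta>_def by (rule edge_disc_square[OF that \<beta> r[OF that] s])
  \<comment> \<open>For large n the square of |T| is at most |2 \<zeta>| + 2 + |T|; a value above |2
    \<zeta>| + 4 would give (|2 \<zeta>| + 3)|T| \<le> |2 \<zeta>| + 2 although |T| \<ge> 1.\<close>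
  define B where "B = norm (2 * \<zeta>) + 4"
  have "\<forall>\<^sub>F n in sequentially. norm (w n) < norm (- 2 * \<zeta>) + 1"
    by (rule order_tendstoD(2)[OF tendsto_norm[OF w]]) simp
  moreover have "\<forall>\<^sub>F n in sequentially. l n < 1" using l by (rule order_tendstoD) simp
  moreover have "\<forall>\<^sub>F n in sequentially. k n < 1" using k by (rule order_tendstoD) simp
  ultimately have TB: "\<forall>\<^sub>F n in sequentially. norm (T n) \<le> B"
    using eventually_ge_at_top[of 1]
  proof eventually_elim
    case (elim n)
    show ?case
    proof (rule ccontr)
      assume "\<not> norm (T n) \<le> B"
      then have gt: "norm (T n) > B" by simp
      have "(norm (T n))\<^sup>2 \<le> norm (w n) + (l n + k n * norm (T n))"
        using norm_triangle_sub[of "(T n)\<^sup>2" "w n"] T[OF elim(4)] by (simp add: norm_power)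
      moreover have "k n * norm (T n) \<le> 1 * norm (T n)" using elim by (intro mult_right_mono) auto
      ultimately have "(norm (T n))\<^sup>2 \<le> norm (2 * \<zeta>) + 2 + norm (T n)" using elim by simp
      moreover have "(norm (T n))\<^sup>2 \<ge> (norm (2 * \<zeta>) + 4) * norm (T n)"
        unfolding power2_eq_square using gt by (intro mult_right_mono) (auto simp: B_def)
      moreover have "(norm (2 * \<zeta>) + 3) * 1 \<le> (norm (2 * \<zeta>) + 3) * norm (T n)"
      proof (rule mult_left_mono)
        show "1 \<le> norm (T n)" using gt norm_ge_zero[of "2 * \<zeta>"] unfolding B_def by linarith
      qed simp
      ultimately show False by (simp add: algebra_simps)
    qed
  qed
  have "(\<lambda>n. (T n)\<^sup>2 - w n) \<longlonglongrightarrow> 0"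
  proof (rule tendsto_0_le[where K=1 and f="\<lambda>n. l n + k n * B"])
    have "(\<lambda>n. l n + k n * B) \<longlonglongrightarrow> 0 + 0 * B" by (intro tendsto_intros l k)
    then show "(\<lambda>n. l n + k n * B) \<longlonglongrightarrow> 0" by simp
    show "\<forall>\<^sub>F n in sequentially. norm ((T n)\<^sup>2 - w n) \<le> norm (l n + k n * B) * 1"
      using TB eventually_ge_at_top[of 1]
    proof eventually_elim
      case (elim n)
      have "k n * norm (T n) \<le> k n * B"
        using elim edge_kappa_pos[OF elim(2) \<beta> r[OF elim(2)] s] by (intro mult_left_mono) (auto simp: k_def)
      then show ?case using T[OF elim(2)] by simp
    qed
  qed
  from tendsto_add[OF this w] have T2: "(\<lambda>n. (T n)\<^sup>2) \<longlonglongrightarrow> - 2 * \<zeta>" by simp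
  have "(\<lambda>n. 2 * (sqrt ((norm ((T n)\<^sup>2) - Re ((T n)\<^sup>2)) / 2) - sqrt (r n) * s)) \<longlonglongrightarrow>
     2 * (sqrt ((norm (- 2 * \<zeta>) - Re (- 2 * \<zeta>)) / 2) - sqrt 0 * s)"
    by (intro tendsto_intros T2 r0) auto
  also have "2 * (sqrt ((norm (- 2 * \<zeta>) - Re (- 2 * \<zeta>)) / 2) - sqrt 0 * s) = 2 * sqrt (sqrt (x\<^sup>2 + s\<^sup>2) + x)"
    unfolding norm_mult by (simp add: \<zeta>_def complex_norm)
  finally show ?thesis
  proof (rule Lim_transform_eventually)
    show "\<forall>\<^sub>F n in sequentially. 2 * (sqrt ((norm ((T n)\<^sup>2) - Re ((T n)\<^sup>2)) / 2) - sqrt (r n) * s) = poisson_avg n \<beta> (r n) x s (X n)"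
      using eventually_ge_at_top[of 1]
    proof eventually_elim
      case (elim n)
      note I = Im_edge_disc[OF elim \<beta> r[OF elim] s, of x "X n"]
      have "0 \<le> Im (T n)"
        unfolding T_def I using r[OF elim] s poisson_avg_nonneg[of s n \<beta> "r n" x "X n"] by simp
      from Im_eq_sqrt[OF this] I show ?case by (simp add: T_def)
    qed
  qed
qed

section \<open>Poisson integrals\<close>

text \<open>The Poisson kernel of the upper half-plane at height s, multiplied by pi.\<close>

definition poisson :: "real \<Rightarrow> real \<Rightarrow> real" where
  "poisson s t = s / (t\<^sup>2 + s\<^sup>2)"

lemma poisson_nonneg: "s > 0 \<Longrightarrow> poisson s t \<ge> 0"
  by (simp add: poisson_def)

lemma poisson_denom_pos: "s > 0 \<Longrightarrow> t\<^sup>2 + s\<^sup>2 > (0::real)"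
  by (simp add: add_nonneg_pos)

lemma poisson_continuous: "s > 0 \<Longrightarrow> continuous_on UNIV (\<lambda>x. poisson s (t - x))"
  unfolding poisson_def using poisson_denom_pos[of s] by (intro continuous_intros) (auto simp: less_imp_neq[THEN not_sym])

lemma poisson_measurable [measurable]: "poisson s \<in> borel_measurable borel"
  unfolding poisson_def[abs_def] by measurable

text \<open>From 2 s |t| \<le> t^2 + s^2 one obtains a bound relative to the kernels themselves. It
  can therefore be summed against any positive measure, whatever its total mass, to compare Poisson
  integrals at nearby points.\<close>

lemma poisson_harnack:
  assumes s: "s > 0"
  shows "\<bar>poisson s t - poisson s t'\<bar> \<le> \<bar>t - t'\<bar> / (2 * s) * (poisson s t + poisson s t')"
proof -
  let ?p = "t\<^sup>2 + s\<^sup>2" and ?q = "t'\<^sup>2 + s\<^sup>2"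
  have pq: "?p > 0" "?q > 0" using poisson_denom_pos[OF s] by auto
  have "2 * s * \<bar>t\<bar> \<le> ?p" "2 * s * \<bar>t'\<bar> \<le> ?q"
    using zero_le_power2[of "\<bar>t\<bar> - s"] zero_le_power2[of "\<bar>t'\<bar> - s"] by (simp_all add: power2_diff mult_ac)
  then have "2 * s * \<bar>t + t'\<bar> \<le> ?p + ?q"
    using mult_left_mono[OF abs_triangle_ineq[of t t'], of "2 * s"] s by (simp add: distrib_left)
  then have le: "\<bar>t - t'\<bar> * (2 * s * \<bar>t + t'\<bar>) \<le> \<bar>t - t'\<bar> * (?p + ?q)"
    by (rule mult_left_mono) simp
  have "poisson s t - poisson s t' = s * ((t' - t) * (t + t')) / (?p * ?q)"
  proof -
    have "s * ?q - s * ?p = s * ((t' - t) * (t + t'))" by (simp add: power2_eq_square algebra_simps)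
    then show ?thesis unfolding poisson_def using pq by (subst diff_frac_eq) auto
  qed
  then have "\<bar>poisson s t - poisson s t'\<bar> = s * (\<bar>t - t'\<bar> * \<bar>t + t'\<bar>) / (?p * ?q)"
    using s pq by (simp add: abs_mult abs_minus_commute)
  also have "\<dots> = \<bar>t - t'\<bar> * (2 * s * \<bar>t + t'\<bar>) / (2 * (?p * ?q))"
  proof -
    have "s * (X * Y) / W = X * (2 * s * Y) / (2 * W)" for X Y W :: real by simp
    then show ?thesis .
  qed
  also have "\<dots> \<le> \<bar>t - t'\<bar> * (?p + ?q) / (2 * (?p * ?q))"
    using le pq by (intro divide_right_mono) auto
  also have "\<dots> = \<bar>t - t'\<bar> / (2 * s) * (poisson s t + poisson s t')"
  proof -
    have "X * (p + q) / (2 * (p * q)) = X / (2 * s) * (s / p + s / q)" if "p > 0" "q > 0" for X p q :: real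
      using that s by (simp add: field_simps)
    from this[OF pq] show ?thesis unfolding poisson_def .
  qed
  finally show ?thesis .
qed

lemma one_plus_square_le:
  fixes t x D :: real
  assumes D: "D > 0" "D \<le> y" "(t - x)\<^sup>2 \<le> y" and x: "\<bar>x\<bar> \<le> M"
  shows "1 + t\<^sup>2 \<le> (2 + (1 + 2 * M\<^sup>2) / D) * y"
proof -
  have "0 \<le> (t - 2 * x)\<^sup>2" by simp
  then have "t\<^sup>2 \<le> 2 * (t - x)\<^sup>2 + 2 * x\<^sup>2" by (simp add: power2_eq_square algebra_simps)
  moreover have "x\<^sup>2 \<le> M\<^sup>2" using x by (metis abs_ge_zero power2_abs power_mono)
  ultimately have "1 + t\<^sup>2 \<le> 2 * y + (1 + 2 * M\<^sup>2)" using D by linarith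
  also have "(1 + 2 * M\<^sup>2) \<le> (1 + 2 * M\<^sup>2) / D * y"
    using D by (simp add: pos_le_divide_eq mult_left_mono)
  finally show ?thesis by (simp add: distrib_right)
qed

text \<open>The parameter y serves two purposes. With y = (t - x)^2 and D the squared distance from
  x, the bound is of order s and handles tails; with y = (t - x)^2 + s^2 and D = s^2 it holds for
  every t. Both compare with \<open>poisson 1\<close>, whose average is bounded.\<close>

lemma poisson_le_gen:
  assumes s: "s > 0" and D: "D > 0" "D \<le> y" "(t - x)\<^sup>2 \<le> y" "y \<le> (t - x)\<^sup>2 + s\<^sup>2" and x: "\<bar>x\<bar> \<le> M"
  shows "poisson s (t - x) \<le> s * (2 + (1 + 2 * M\<^sup>2) / D) * poisson 1 t"
proof -
  have y: "y > 0" using D by linarith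
  have t: "1 + t\<^sup>2 > 0" by (simp add: add_pos_nonneg)
  have "poisson s (t - x) \<le> s / y"
    unfolding poisson_def using D s y by (intro divide_left_mono) (auto intro: mult_pos_pos)
  also have "\<dots> \<le> s * (2 + (1 + 2 * M\<^sup>2) / D) / (1 + t\<^sup>2)"
    using one_plus_square_le[OF D(1-3) x] y t s
    by (simp add: pos_divide_le_eq pos_le_divide_eq mult.assoc mult_left_mono)
  finally show ?thesis by (simp add: poisson_def add.commute)
qed

section \<open>The harmonic measure of an interval\<close>

text \<open>The angle which the interval subtends at t + i s, that is pi times its harmonic measure;
  as s tends to 0 it approximates pi times the indicator. For a > b it is 0.\<close>

definition poisson_arc :: "real \<Rightarrow> real \<Rightarrow> real \<Rightarrow> real \<Rightarrow> real" where
  "poisson_arc s a b t = (\<integral>x. indicator {a..b} x * poisson s (t - x) \<partial>lborel)"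

lemma set_integrable_cont:
  fixes f :: "real \<Rightarrow> real"
  assumes "continuous_on {a..b} f"
  shows "integrable lborel (\<lambda>x. indicator {a..b} x * f x)"
  using borel_integrable_atLeastAtMost'[OF assms] by (simp add: set_integrable_def)

lemma poisson_arc_integrable:
  "s > 0 \<Longrightarrow> integrable lborel (\<lambda>x. indicator {a..b} x * poisson s (t - x))"
  by (intro set_integrable_cont continuous_on_subset[OF poisson_continuous]) auto

lemma poisson_arc_eq:
  assumes s: "s > 0" and ab: "a \<le> b"
  shows "poisson_arc s a b t = arctan ((b - t) / s) - arctan ((a - t) / s)"
proof -
  have "(\<integral>x. indicator {a..b} x *\<^sub>R poisson s (t - x) \<partial>lborel) = arctan ((b - t) / s) - arctan ((a - t) / s)"
  proof (rule integral_FTC_Icc[OF ab])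
    fix x assume "a \<le> x" "x \<le> b"
    have "((\<lambda>x. arctan ((x - t) / s)) has_real_derivative poisson s (t - x)) (at x)"
      using s poisson_denom_pos[OF s, of "t - x"] poisson_denom_pos[OF s, of "x - t"]
      by (auto intro!: derivative_eq_intros simp: poisson_def field_simps power2_eq_square)
    then show "((\<lambda>x. arctan ((x - t) / s)) has_vector_derivative poisson s (t - x)) (at x within {a..b})"
      by (simp add: has_real_derivative_iff_has_vector_derivative has_vector_derivative_at_within)
  qed (use poisson_continuous[OF s, of t] in \<open>auto intro: continuous_on_subset\<close>)
  then show ?thesis by (simp add: poisson_arc_def)
qed

lemma poisson_arc_le_pi:
  assumes s: "s > 0" shows "poisson_arc s a b t \<le> pi"
proof (cases "a \<le> b")
  case True
  show ?thesis
    unfolding poisson_arc_eq[OF s True] using arctan_ubound[of "(b - t) / s"] arctan_lbound[of "(a - t) / s"] by linarith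
qed (simp add: poisson_arc_def)

lemma poisson_arc_nonneg:
  assumes s: "s > 0" shows "poisson_arc s a b t \<ge> 0"
  unfolding poisson_arc_def using s by (intro Bochner_Integration.integral_nonneg mult_nonneg_nonneg poisson_nonneg) auto

text \<open>Enlarging the interval by \<delta> keeps t at distance at least \<delta> from both ends,
  so each half of the angle is at least arctan (\<delta>/s), which tends to pi/2 with s.\<close>

lemma poisson_arc_ge:
  assumes s: "s > 0" and \<delta>: "\<delta> > 0" and t: "t \<in> {a..b}"
  shows "2 * arctan (\<delta> / s) \<le> poisson_arc s (a - \<delta>) (b + \<delta>) t"
proof -
  have "arctan (\<delta> / s) \<le> arctan ((b + \<delta> - t) / s)"
    using s t by (subst arctan_le_iff) (auto intro: divide_right_mono)
  moreover have "arctan ((a - \<delta> - t) / s) \<le> arctan (- (\<delta> / s))"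
    using s t divide_right_mono[of "a - \<delta> - t" "- \<delta>" s] by (subst arctan_le_iff) auto
  ultimately show ?thesis
    using s \<delta> t by (subst poisson_arc_eq) (auto simp: arctan_minus)
qed

text \<open>The counterpart of \<open>poisson_arc_ge\<close>: after shrinking by \<delta>, points
  outside the original interval are at distance at least \<delta> from the domain of integration, so
  \<open>poisson_le_gen\<close> makes their contribution O(s) times
  \<open>poisson 1\<close>.\<close>

lemma poisson_arc_le:
  assumes s: "s > 0" and \<delta>: "\<delta> > 0" and M: "\<bar>a\<bar> \<le> M" "\<bar>b\<bar> \<le> M" and ab: "a \<le> b"
  shows "poisson_arc s (a + \<delta>) (b - \<delta>) t \<le> pi * indicator {a..b} t
     + s * (2 + (1 + 2 * M\<^sup>2) / \<delta>\<^sup>2) * poisson 1 t * (b - a)"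
proof (cases "t \<in> {a..b}")
  case True
  have "0 \<le> s * (2 + (1 + 2 * M\<^sup>2) / \<delta>\<^sup>2) * poisson 1 t * (b - a)"
    using s ab poisson_nonneg[of 1 t] by (intro mult_nonneg_nonneg add_nonneg_nonneg divide_nonneg_nonneg) auto
  then show ?thesis using True poisson_arc_le_pi[OF s, of "a + \<delta>" "b - \<delta>" t] by simp
next
  case False
  let ?C = "s * (2 + (1 + 2 * M\<^sup>2) / \<delta>\<^sup>2) * poisson 1 t"
  have C: "?C \<ge> 0" using s poisson_nonneg[of 1 t] by (intro mult_nonneg_nonneg add_nonneg_nonneg divide_nonneg_nonneg) auto
  have "poisson_arc s (a + \<delta>) (b - \<delta>) t \<le> (\<integral>x. indicator {a..b} x * ?C \<partial>lborel)"
    unfolding poisson_arc_def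
  proof (rule integral_mono[OF poisson_arc_integrable[OF s] set_integrable_cont])
    fix x
    show "indicator {a + \<delta>..b - \<delta>} x * poisson s (t - x) \<le> indicator {a..b} x * ?C"
    proof (cases "x \<in> {a + \<delta>..b - \<delta>}")
      case True
      have "\<delta> \<le> \<bar>t - x\<bar>" using True False by auto
      then have "\<delta>\<^sup>2 \<le> (t - x)\<^sup>2" using \<delta> by (metis less_imp_le power2_abs power_mono)
      then have "poisson s (t - x) \<le> ?C"
        using \<delta> True M by (intro poisson_le_gen[OF s, where y="(t - x)\<^sup>2"]) auto
      moreover have "x \<in> {a..b}" using True \<delta> by auto
      ultimately show ?thesis using True by simp
    next
      case False
      then have "indicator {a + \<delta>..b - \<delta>} x = (0::real)" by (rule indicator_simps(2))
      then show ?thesis using C by (simp only: mult_zero_left) (simp add: indicator_def)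
    qed
  qed auto
  also have "\<dots> = ?C * (b - a)" using ab by simp
  finally show ?thesis using False by simp
qed

section \<open>The limit density and its harmonic extension\<close>

definition edge_limit_density :: "real \<Rightarrow> real" where
  "edge_limit_density x = (if x > 0 then 2 * sqrt 2 / pi * sqrt x else 0)"

text \<open>This is 2 sqrt 2 times the real part of the principal square root of x + i s, which is
  harmonic in the upper half-plane; \<open>harmonic_ext_0\<close> gives its boundary values.\<close>

definition harmonic_ext :: "real \<Rightarrow> real \<Rightarrow> real" where
  "harmonic_ext s x = 2 * sqrt (sqrt (x\<^sup>2 + s\<^sup>2) + x)"

lemma harmonic_ext_0: "harmonic_ext 0 x = pi * edge_limit_density x"
  by (simp add: harmonic_ext_def edge_limit_density_def real_sqrt_mult[symmetric])

lemma harmonic_ext_nonneg: "harmonic_ext s x \<ge> 0"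
proof -
  have "\<bar>x\<bar> \<le> sqrt (x\<^sup>2 + s\<^sup>2)" by (rule real_le_rsqrt) simp
  then have "0 \<le> sqrt (x\<^sup>2 + s\<^sup>2) + x" by linarith
  then show ?thesis by (simp add: harmonic_ext_def)
qed

lemma harmonic_ext_continuous: "continuous_on UNIV (harmonic_ext s)" "continuous_on UNIV (\<lambda>s. harmonic_ext s x)"
  unfolding harmonic_ext_def[abs_def] by (intro continuous_intros)+

lemma harmonic_ext_measurable [measurable]: "harmonic_ext s \<in> borel_measurable borel"
  by (rule borel_measurable_continuous_onI[OF harmonic_ext_continuous(1)])

lemma harmonic_ext_le:
  assumes "\<bar>s\<bar> \<le> 1" "\<bar>x\<bar> \<le> M" shows "harmonic_ext s x \<le> harmonic_ext 1 M"
proof -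
  have "x\<^sup>2 \<le> M\<^sup>2" using assms(2) by (metis abs_ge_zero power2_abs power_mono)
  moreover have "s\<^sup>2 \<le> 1\<^sup>2" using assms(1) by (metis abs_ge_zero power2_abs power_mono)
  ultimately show ?thesis
    unfolding harmonic_ext_def using assms(2) by (intro mult_left_mono real_sqrt_le_mono add_mono) auto
qed

definition harmonic_mass :: "real \<Rightarrow> real \<Rightarrow> real \<Rightarrow> real" where
  "harmonic_mass s a b = (\<integral>x. indicator {a..b} x * harmonic_ext s x \<partial>lborel)"

lemma harmonic_mass_tendsto:
  assumes "sq \<longlonglongrightarrow> 0"
  shows "(\<lambda>m. harmonic_mass (sq m) a b) \<longlonglongrightarrow> harmonic_mass 0 a b"
proof -
  define M where "M = \<bar>a\<bar> + \<bar>b\<bar>"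
  have "(\<lambda>m. \<bar>sq m\<bar>) \<longlonglongrightarrow> \<bar>0\<bar>" by (intro tendsto_intros assms)
  then have "\<forall>\<^sub>F m in sequentially. \<bar>sq m\<bar> < 1" by (rule order_tendstoD) simp
  then obtain m0 where m0: "\<And>m. m \<ge> m0 \<Longrightarrow> \<bar>sq m\<bar> < 1" unfolding eventually_sequentially by blast
  have "(\<lambda>m. harmonic_mass (sq (m + m0)) a b) \<longlonglongrightarrow> harmonic_mass 0 a b"
    unfolding harmonic_mass_def
  proof (rule integral_dominated_convergence[where w="\<lambda>x. indicator {a..b} x * harmonic_ext 1 M"])
    have "(\<lambda>m. harmonic_ext (sq (m + m0)) x) \<longlonglongrightarrow> harmonic_ext 0 x" for x
      using harmonic_ext_continuous(2)[of x] LIMSEQ_ignore_initial_segment[OF assms, of m0]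
      by (intro isCont_tendsto_compose[of 0 "\<lambda>s. harmonic_ext s x"]) (auto simp: continuous_on_eq_continuous_at)
    then show "AE x in lborel. (\<lambda>m. indicator {a..b} x * harmonic_ext (sq (m + m0)) x) \<longlonglongrightarrow> indicator {a..b} x * harmonic_ext 0 x"
      by (intro AE_I2 tendsto_mult_left)
    show "AE x in lborel. norm (indicator {a..b} x * harmonic_ext (sq (m + m0)) x) \<le> indicator {a..b} x * harmonic_ext 1 M" for m
    proof (rule AE_I2)
      fix x
      have "harmonic_ext (sq (m + m0)) x \<le> harmonic_ext 1 M" if "x \<in> {a..b}"
        using that m0[of "m + m0"] by (intro harmonic_ext_le) (auto simp: M_def)
      then show "norm (indicator {a..b} x * harmonic_ext (sq (m + m0)) x) \<le> indicator {a..b} x * harmonic_ext 1 M"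
        using harmonic_ext_nonneg[of "sq (m + m0)" x] by (auto simp: indicator_def)
    qed
    show "integrable lborel (\<lambda>x. indicator {a..b} x * harmonic_ext 1 M)"
      by (intro set_integrable_cont) auto
  qed measurable
  then show ?thesis by (rule LIMSEQ_offset)
qed

text \<open>The limit has a density and no atoms, so moving the endpoints changes the integrand in
  the limit only at \<open>a\<close> and \<open>b\<close>, a null set. This undoes the enlarging and
  shrinking by \<delta>.\<close>

lemma harmonic_mass_endpoints:
  assumes aq: "aq \<longlonglongrightarrow> a" and bq: "bq \<longlonglongrightarrow> b"
  shows "(\<lambda>m. harmonic_mass 0 (aq m) (bq m)) \<longlonglongrightarrow> harmonic_mass 0 a b"
proof -
  define M where "M = \<bar>a\<bar> + \<bar>b\<bar> + 1"
  have "\<forall>\<^sub>F m in sequentially. aq m > a - 1" "\<forall>\<^sub>F m in sequentially. bq m < b + 1"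
    using aq bq by (auto intro: order_tendstoD)
  then have "\<forall>\<^sub>F m in sequentially. aq m > a - 1 \<and> bq m < b + 1" by eventually_elim auto
  then obtain m0 where m0: "\<And>m. m \<ge> m0 \<Longrightarrow> aq m > a - 1 \<and> bq m < b + 1" unfolding eventually_sequentially by blast
  have "(\<lambda>m. harmonic_mass 0 (aq (m + m0)) (bq (m + m0))) \<longlonglongrightarrow> harmonic_mass 0 a b"
    unfolding harmonic_mass_def
  proof (rule integral_dominated_convergence[where w="\<lambda>x. indicator {a - 1..b + 1} x * harmonic_ext 1 M"])
    have "AE x in lborel. x \<noteq> a" "AE x in lborel. x \<noteq> b" by (rule AE_lborel_singleton)+
    then show "AE x in lborel. (\<lambda>m. indicator {aq (m + m0)..bq (m + m0)} x * harmonic_ext 0 x) \<longlonglongrightarrow> indicator {a..b} x * harmonic_ext 0 x"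
    proof eventually_elim
      case (elim x)
      have a: "\<forall>\<^sub>F m in sequentially. (aq (m + m0) \<le> x) = (a \<le> x)"
      proof (cases "a < x")
        case True
        then have "\<forall>\<^sub>F m in sequentially. aq (m + m0) < x"
          using LIMSEQ_ignore_initial_segment[OF aq, of m0] by (intro order_tendstoD)
        then show ?thesis by eventually_elim (use True in auto)
      next
        case False
        then have "\<forall>\<^sub>F m in sequentially. aq (m + m0) > x"
          using LIMSEQ_ignore_initial_segment[OF aq, of m0] elim by (intro order_tendstoD) auto
        then show ?thesis by eventually_elim (use False elim in auto)
      qed
      have b: "\<forall>\<^sub>F m in sequentially. (x \<le> bq (m + m0)) = (x \<le> b)"
      proof (cases "x < b")
        case True
        then have "\<forall>\<^sub>F m in sequentially. bq (m + m0) > x"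
          using LIMSEQ_ignore_initial_segment[OF bq, of m0] by (intro order_tendstoD)
        then show ?thesis by eventually_elim (use True in auto)
      next
        case False
        then have "\<forall>\<^sub>F m in sequentially. bq (m + m0) < x"
          using LIMSEQ_ignore_initial_segment[OF bq, of m0] elim by (intro order_tendstoD) auto
        then show ?thesis by eventually_elim (use False elim in auto)
      qed
      from a b have "\<forall>\<^sub>F m in sequentially. indicator {a..b} x * harmonic_ext 0 x = indicator {aq (m + m0)..bq (m + m0)} x * harmonic_ext 0 x"
        by eventually_elim (simp add: indicator_def)
      then show ?case by (rule Lim_transform_eventually[OF tendsto_const])
    qed
    show "AE x in lborel. norm (indicator {aq (m + m0)..bq (m + m0)} x * harmonic_ext 0 x) \<le> indicator {a - 1..b + 1} x * harmonic_ext 1 M" for m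
    proof (rule AE_I2)
      fix x
      have "harmonic_ext 0 x \<le> harmonic_ext 1 M" if "x \<in> {a - 1..b + 1}"
        using that by (intro harmonic_ext_le) (auto simp: M_def)
      then show "norm (indicator {aq (m + m0)..bq (m + m0)} x * harmonic_ext 0 x) \<le> indicator {a - 1..b + 1} x * harmonic_ext 1 M"
        using harmonic_ext_nonneg[of 0 x] harmonic_ext_nonneg[of 1 M] m0[of "m + m0"] by (auto simp: indicator_def)
    qed
    show "integrable lborel (\<lambda>x. indicator {a - 1..b + 1} x * harmonic_ext 1 M)"
      by (intro set_integrable_cont) auto
  qed measurable
  then show ?thesis by (rule LIMSEQ_offset)
qed

section \<open>Deterministic convergence of weighted point configurations\<close>

text \<open>Integration against n atoms of equal mass \<open>c n\<close>, detached from the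
  ensembles, so that the passage from Poisson integrals to test functions involves no
  probability.\<close>

definition atom_avg :: "(nat \<Rightarrow> real) \<Rightarrow> (nat \<Rightarrow> nat \<Rightarrow> real) \<Rightarrow> nat \<Rightarrow> (real \<Rightarrow> real) \<Rightarrow> real" where
  "atom_avg c \<theta> n f = c n * (\<Sum>k\<in>{1..n}. f (\<theta> n k))"

lemma atom_avg_add: "atom_avg c \<theta> n (\<lambda>t. f t + g t) = atom_avg c \<theta> n f + atom_avg c \<theta> n g"
  by (simp add: atom_avg_def sum.distrib distrib_left)

lemma atom_avg_diff: "atom_avg c \<theta> n (\<lambda>t. f t - g t) = atom_avg c \<theta> n f - atom_avg c \<theta> n g"
  by (simp add: atom_avg_def sum_subtractf right_diff_distrib)

lemma atom_avg_cmult: "atom_avg c \<theta> n (\<lambda>t. a * f t) = a * atom_avg c \<theta> n f"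
  by (simp add: atom_avg_def sum_distrib_left mult_ac)

lemma atom_avg_mono:
  "c n \<ge> 0 \<Longrightarrow> (\<And>t. f t \<le> g t) \<Longrightarrow> atom_avg c \<theta> n f \<le> atom_avg c \<theta> n g"
  unfolding atom_avg_def by (intro mult_left_mono sum_mono) auto

lemma atom_avg_abs: "c n \<ge> 0 \<Longrightarrow> \<bar>atom_avg c \<theta> n f\<bar> \<le> atom_avg c \<theta> n (\<lambda>t. \<bar>f t\<bar>)"
  unfolding atom_avg_def by (auto simp: abs_mult intro!: mult_left_mono sum_abs)

lemma atom_avg_sum: "atom_avg c \<theta> n (\<lambda>t. \<Sum>i\<in>I. f i t) = (\<Sum>i\<in>I. atom_avg c \<theta> n (f i))"
  unfolding atom_avg_def by (subst sum.swap) (simp add: sum_distrib_left)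

text \<open>A countable set of points is all that almost sure convergence supplies at once. By
  \<open>poisson_harnack\<close> the averages at x and at a nearby rational q differ by a small
  multiple of their sum, uniformly in n.\<close>

lemma poisson_avg_real_tendsto:
  assumes c: "\<And>n. c n \<ge> 0" and s: "s > 0"
    and H: "\<And>x. x \<in> \<rat> \<Longrightarrow> (\<lambda>n. atom_avg c \<theta> n (\<lambda>t. poisson s (t - x))) \<longlonglongrightarrow> harmonic_ext s x"
  shows "(\<lambda>n. atom_avg c \<theta> n (\<lambda>t. poisson s (t - x))) \<longlonglongrightarrow> harmonic_ext s x"
proof (rule tendstoI)
  fix e :: real assume e: "e > 0"
  let ?a = "\<lambda>n x. atom_avg c \<theta> n (\<lambda>t. poisson s (t - x))"
  let ?d = "\<lambda>q. \<bar>x - q\<bar> / (2 * s)"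
  have h: "(harmonic_ext s \<longlongrightarrow> harmonic_ext s x) (nhds x)"
    using harmonic_ext_continuous(1)[of s] by (simp add: continuous_on_eq_continuous_at isCont_def tendsto_at_iff_tendsto_nhds)
  have d: "(?d \<longlongrightarrow> \<bar>x - x\<bar> / (2 * s)) (nhds x)"
    by (intro tendsto_intros filterlim_ident) (use s in auto)
  \<comment> \<open>Once the Harnack factor is below 1/2, the average at x is at most 3 times that
    at q, so their sum is at most 4 times the latter; the summand 1 is room for the average at q to
    exceed its limit.\<close>
  have "((\<lambda>q. 4 * ?d q * (harmonic_ext s q + 1)) \<longlongrightarrow> 4 * (\<bar>x - x\<bar> / (2 * s)) * (harmonic_ext s x + 1)) (nhds x)"
    by (intro tendsto_intros d h)
  then have "\<forall>\<^sub>F q in nhds x. 4 * ?d q * (harmonic_ext s q + 1) < e / 3"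
    by (rule order_tendstoD) (use e in auto)
  moreover have "\<forall>\<^sub>F q in nhds x. ?d q < 1 / 2" using d by (rule order_tendstoD) auto
  moreover have "\<forall>\<^sub>F q in nhds x. dist (harmonic_ext s q) (harmonic_ext s x) < e / 3"
    using h by (rule tendstoD) (use e in auto)
  ultimately have "\<forall>\<^sub>F q in nhds x. 4 * ?d q * (harmonic_ext s q + 1) < e / 3 \<and> ?d q < 1 / 2 \<and> dist (harmonic_ext s q) (harmonic_ext s x) < e / 3"
    by eventually_elim auto
  then obtain \<delta> where \<delta>: "\<delta> > 0" "\<And>q. dist q x < \<delta> \<Longrightarrow> 4 * ?d q * (harmonic_ext s q + 1) < e / 3 \<and> ?d q < 1 / 2 \<and> dist (harmonic_ext s q) (harmonic_ext s x) < e / 3"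
    unfolding eventually_nhds_metric by blast
  obtain q where q: "q \<in> \<rat>" "x < q" "q < x + \<delta>"
    using Rats_dense_in_real[of x "x + \<delta>"] \<delta>(1) by auto
  then have Q: "4 * ?d q * (harmonic_ext s q + 1) < e / 3" "?d q < 1 / 2" "dist (harmonic_ext s q) (harmonic_ext s x) < e / 3"
    using \<delta>(2)[of q] by (auto simp: dist_real_def)
  have "\<forall>\<^sub>F n in sequentially. dist (?a n q) (harmonic_ext s q) < min 1 (e / 3)"
    using H[OF q(1)] by (rule tendstoD) (use e in auto)
  then show "\<forall>\<^sub>F n in sequentially. dist (?a n x) (harmonic_ext s x) < e"
  proof eventually_elim
    case (elim n)
    have "\<bar>?a n x - ?a n q\<bar> \<le> atom_avg c \<theta> n (\<lambda>t. \<bar>poisson s (t - x) - poisson s (t - q)\<bar>)"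
      using atom_avg_abs[of c n \<theta> "\<lambda>t. poisson s (t - x) - poisson s (t - q)", OF c] by (simp add: atom_avg_diff)
    also have "\<dots> \<le> atom_avg c \<theta> n (\<lambda>t. ?d q * (poisson s (t - x) + poisson s (t - q)))"
    proof (rule atom_avg_mono[OF c])
      fix t
      show "\<bar>poisson s (t - x) - poisson s (t - q)\<bar> \<le> ?d q * (poisson s (t - x) + poisson s (t - q))"
        using poisson_harnack[OF s, of "t - x" "t - q"] by (simp add: abs_minus_commute)
    qed
    also have "\<dots> = ?d q * (?a n x + ?a n q)"
      by (simp only: atom_avg_cmult atom_avg_add)
    finally have 1: "\<bar>?a n x - ?a n q\<bar> \<le> ?d q * (?a n x + ?a n q)" .
    have a0: "?a n y \<ge> 0" for y
      unfolding atom_avg_def using c s by (intro mult_nonneg_nonneg sum_nonneg poisson_nonneg) auto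
    have "?d q * (?a n x + ?a n q) \<le> 1 / 2 * (?a n x + ?a n q)"
      using Q(2) a0[of x] a0[of q] by (intro mult_right_mono) auto
    with 1 have "\<bar>?a n x - ?a n q\<bar> \<le> 1 / 2 * (?a n x + ?a n q)" by (rule order_trans)
    then have "?a n x - ?a n q \<le> 1 / 2 * (?a n x + ?a n q)" by (rule abs_le_D1)
    then have "?a n x \<le> 3 * ?a n q" by (simp add: field_simps)
    then have "?d q * (?a n x + ?a n q) \<le> ?d q * (4 * ?a n q)"
      using s by (intro mult_left_mono) auto
    also have "\<dots> \<le> ?d q * (4 * (harmonic_ext s q + 1))"
      using s elim by (intro mult_left_mono) (auto simp: dist_real_def)
    finally have "?d q * (?a n x + ?a n q) \<le> ?d q * (4 * (harmonic_ext s q + 1))" .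
    with 1 have "\<bar>?a n x - ?a n q\<bar> \<le> ?d q * (4 * (harmonic_ext s q + 1))" by (rule order_trans)
    also have "\<dots> = 4 * ?d q * (harmonic_ext s q + 1)" by (simp only: mult_ac)
    also note Q(1)
    finally have "\<bar>?a n x - ?a n q\<bar> < e / 3" .
    then show ?case using elim Q(3) unfolding dist_real_def by linarith
  qed
qed

text \<open>Exchanging the finite sum with the integral over x reduces this to dominated convergence
  on the interval; the dominating constant comes from \<open>poisson_le_gen\<close> with D = s^2 and
  the bound on the averages of \<open>poisson 1\<close>.\<close>

lemma atom_avg_poisson_arc_tendsto:
  assumes c: "\<And>n. c n \<ge> 0" and s: "s > 0"
    and H: "\<And>x. (\<lambda>n. atom_avg c \<theta> n (\<lambda>t. poisson s (t - x))) \<longlonglongrightarrow> harmonic_ext s x"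
    and B: "\<And>n. atom_avg c \<theta> n (poisson 1) \<le> B"
  shows "(\<lambda>n. atom_avg c \<theta> n (poisson_arc s a b)) \<longlonglongrightarrow> harmonic_mass s a b"
proof -
  let ?a = "\<lambda>n x. atom_avg c \<theta> n (\<lambda>t. poisson s (t - x))"
  have eq: "atom_avg c \<theta> n (poisson_arc s a b) = (\<integral>x. indicator {a..b} x * ?a n x \<partial>lborel)" for n
  proof -
    have "indicator {a..b} x * ?a n x = c n * (\<Sum>k\<in>{1..n}. indicator {a..b} x * poisson s (\<theta> n k - x))" for x
      unfolding atom_avg_def sum_distrib_left[symmetric] by (rule mult.left_commute)
    then have "(\<integral>x. indicator {a..b} x * ?a n x \<partial>lborel) = (\<integral>x. c n * (\<Sum>k\<in>{1..n}. indicator {a..b} x * poisson s (\<theta> n k - x)) \<partial>lborel)"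
      by simp
    also have "\<dots> = c n * (\<Sum>k\<in>{1..n}. poisson_arc s a b (\<theta> n k))"
      unfolding poisson_arc_def
      by (subst integral_mult_right_zero, subst Bochner_Integration.integral_sum) (auto intro: poisson_arc_integrable[OF s])
    finally show ?thesis by (simp add: atom_avg_def)
  qed
  define M where "M = \<bar>a\<bar> + \<bar>b\<bar>"
  define C where "C = s * (2 + (1 + 2 * M\<^sup>2) / s\<^sup>2)"
  have C: "C \<ge> 0" using s by (auto simp: C_def)
  have "(\<lambda>n. \<integral>x. indicator {a..b} x * ?a n x \<partial>lborel) \<longlonglongrightarrow> harmonic_mass s a b"
    unfolding harmonic_mass_def
  proof (rule integral_dominated_convergence[where w="\<lambda>x. indicator {a..b} x * (C * B)"])
    show "AE x in lborel. (\<lambda>n. indicator {a..b} x * ?a n x) \<longlonglongrightarrow> indicator {a..b} x * harmonic_ext s x"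
      by (intro AE_I2 tendsto_mult_left H)
    show "AE x in lborel. norm (indicator {a..b} x * ?a n x) \<le> indicator {a..b} x * (C * B)" for n
    proof (rule AE_I2)
      fix x
      have "?a n x \<le> C * B" if x: "x \<in> {a..b}"
      proof -
        have "?a n x \<le> atom_avg c \<theta> n (\<lambda>t. C * poisson 1 t)"
          unfolding C_def by (intro atom_avg_mono c poisson_le_gen[OF s, where y="(t - x)\<^sup>2 + s\<^sup>2" for t])
             (use s x in \<open>auto simp: M_def\<close>)
        also have "\<dots> \<le> C * B" unfolding atom_avg_cmult by (intro mult_left_mono B C)
        finally show ?thesis .
      qed
      moreover have "?a n x \<ge> 0"
        unfolding atom_avg_def using c s by (intro mult_nonneg_nonneg sum_nonneg poisson_nonneg) auto
      ultimately show "norm (indicator {a..b} x * ?a n x) \<le> indicator {a..b} x * (C * B)"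
        by (auto simp: indicator_def)
    qed
    show "integrable lborel (\<lambda>x. indicator {a..b} x * (C * B))" by (intro set_integrable_cont) auto
    show "(\<lambda>x. indicator {a..b} x * ?a n x) \<in> borel_measurable lborel" for n
      unfolding atom_avg_def by measurable
  qed measurable
  then show ?thesis by (simp add: eq)
qed

text \<open>The indicator is squeezed between multiples of \<open>poisson_arc\<close> of the
  enlarged and of the shrunken interval. The order of choices matters: \<delta> is fixed first by
  continuity in the endpoints, then the height s, and only then n is large.\<close>

lemma atom_avg_interval_tendsto:
  assumes c: "\<And>n. c n \<ge> 0" and ab: "a \<le> b"
    and H: "\<And>x m. (\<lambda>n. atom_avg c \<theta> n (\<lambda>t. poisson (1 / real (Suc m)) (t - x))) \<longlonglongrightarrow> harmonic_ext (1 / real (Suc m)) x"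
  shows "(\<lambda>n. atom_avg c \<theta> n (indicator {a..b})) \<longlonglongrightarrow> harmonic_mass 0 a b / pi"
proof -
  define sq where "sq m = 1 / real (Suc m)" for m
  have sq: "sq m > 0" for m by (simp add: sq_def)
  have sq0: "sq \<longlonglongrightarrow> 0"
    unfolding sq_def by (rule LIMSEQ_Suc[OF lim_1_over_n])
  define Y where "Y n = atom_avg c \<theta> n (poisson 1)" for n
  \<comment> \<open>Height 1 and centre 0 are the case \<open>m = 0\<close>, \<open>x = 0\<close> of
    the hypothesis. The resulting bound on the averages of 1/(1 + t^2) takes the place of
    tightness.\<close>
  have Y: "Y \<longlonglongrightarrow> harmonic_ext 1 0"
    using H[of 0 0] by (simp add: Y_def[abs_def])
  then have "Bseq Y" by (intro convergent_imp_Bseq convergentI)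
  then obtain B where "\<And>n. norm (Y n) \<le> B" unfolding Bseq_def by blast
  then have B: "Y n \<le> B" for n using abs_le_D1[of "Y n" B] by simp
  have arc: "(\<lambda>n. atom_avg c \<theta> n (poisson_arc (sq m) u v)) \<longlonglongrightarrow> harmonic_mass (sq m) u v" for m u v
    using H[of m] B by (intro atom_avg_poisson_arc_tendsto[OF c sq]) (auto simp: sq_def Y_def)
  have 1: "(\<lambda>n. pi * atom_avg c \<theta> n (indicator {a..b})) \<longlonglongrightarrow> harmonic_mass 0 a b"
  proof (rule order_tendstoI)
    fix u assume u: "harmonic_mass 0 a b < u"
    have "(\<lambda>j. harmonic_mass 0 (a - sq j) (b + sq j)) \<longlonglongrightarrow> harmonic_mass 0 a b"
      by (rule harmonic_mass_endpoints) (use tendsto_diff[OF tendsto_const sq0, of a] tendsto_add[OF tendsto_const sq0, of b] in auto)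
    then have "\<forall>\<^sub>F j in sequentially. harmonic_mass 0 (a - sq j) (b + sq j) < u" using u by (rule order_tendstoD)
    from eventually_happens'[OF sequentially_bot this] obtain j where j: "harmonic_mass 0 (a - sq j) (b + sq j) < u" by blast
    define \<delta> where "\<delta> = sq j"
    have \<delta>: "\<delta> > 0" by (simp add: \<delta>_def sq)
    have "LIM m sequentially. \<delta> / sq m :> at_top"
    proof -
      have "LIM m sequentially. \<delta> * real (Suc m) :> at_top"
        by (rule filterlim_tendsto_pos_mult_at_top[OF tendsto_const \<delta>])
           (rule filterlim_compose[OF filterlim_real_sequentially filterlim_Suc])
      then show ?thesis by (simp add: sq_def)
    qed
    then have at: "(\<lambda>m. arctan (\<delta> / sq m)) \<longlonglongrightarrow> pi / 2"
      by (rule filterlim_compose[OF tendsto_arctan_at_top])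
    have "(\<lambda>m. pi / (2 * arctan (\<delta> / sq m)) * harmonic_mass (sq m) (a - \<delta>) (b + \<delta>)) \<longlonglongrightarrow> pi / (2 * (pi / 2)) * harmonic_mass 0 (a - \<delta>) (b + \<delta>)"
      by (intro tendsto_intros at harmonic_mass_tendsto[OF sq0]) auto
    then have "\<forall>\<^sub>F m in sequentially. pi / (2 * arctan (\<delta> / sq m)) * harmonic_mass (sq m) (a - \<delta>) (b + \<delta>) < u"
      by (rule order_tendstoD) (use j in \<open>simp add: \<delta>_def\<close>)
    from eventually_happens'[OF sequentially_bot this] obtain m where m: "pi / (2 * arctan (\<delta> / sq m)) * harmonic_mass (sq m) (a - \<delta>) (b + \<delta>) < u" by blast
    \<comment> \<open>The guaranteed value of the enlarged arc on the interval; it is close to pi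
      because s is small compared with \<delta>.\<close>
    define A where "A = 2 * arctan (\<delta> / sq m)"
    have A: "A > 0" using \<delta> sq[of m] by (simp add: A_def)
    have "(\<lambda>n. pi / A * atom_avg c \<theta> n (poisson_arc (sq m) (a - \<delta>) (b + \<delta>))) \<longlonglongrightarrow> pi / A * harmonic_mass (sq m) (a - \<delta>) (b + \<delta>)"
      by (intro tendsto_intros arc)
    then have "\<forall>\<^sub>F n in sequentially. pi / A * atom_avg c \<theta> n (poisson_arc (sq m) (a - \<delta>) (b + \<delta>)) < u"
      by (rule order_tendstoD) (use m in \<open>simp add: A_def\<close>)
    then show "\<forall>\<^sub>F n in sequentially. pi * atom_avg c \<theta> n (indicator {a..b}) < u"
    proof eventually_elim
      case (elim n)
      have "A * atom_avg c \<theta> n (indicator {a..b}) = atom_avg c \<theta> n (\<lambda>t. A * indicator {a..b} t)"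
        by (simp add: atom_avg_cmult)
      also have "\<dots> \<le> atom_avg c \<theta> n (poisson_arc (sq m) (a - \<delta>) (b + \<delta>))"
      proof (rule atom_avg_mono[OF c])
        fix t
        show "A * indicator {a..b} t \<le> poisson_arc (sq m) (a - \<delta>) (b + \<delta>) t"
          using poisson_arc_ge[OF sq \<delta>, of t a b m] poisson_arc_nonneg[OF sq, of m "a - \<delta>" "b + \<delta>" t]
          by (auto simp: A_def indicator_def)
      qed
      finally have "pi / A * (A * atom_avg c \<theta> n (indicator {a..b})) \<le> pi / A * atom_avg c \<theta> n (poisson_arc (sq m) (a - \<delta>) (b + \<delta>))"
        using A by (intro mult_left_mono) auto
      moreover have "pi / A * (A * atom_avg c \<theta> n (indicator {a..b})) = pi * atom_avg c \<theta> n (indicator {a..b})"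
        using A by simp
      ultimately show ?case using elim by linarith
    qed
  next
    fix l assume l: "l < harmonic_mass 0 a b"
    have "(\<lambda>j. harmonic_mass 0 (a + sq j) (b - sq j)) \<longlonglongrightarrow> harmonic_mass 0 a b"
      by (rule harmonic_mass_endpoints) (use tendsto_add[OF tendsto_const sq0, of a] tendsto_diff[OF tendsto_const sq0, of b] in auto)
    then have "\<forall>\<^sub>F j in sequentially. l < harmonic_mass 0 (a + sq j) (b - sq j)" using l by (rule order_tendstoD)
    from eventually_happens'[OF sequentially_bot this] obtain j where j: "l < harmonic_mass 0 (a + sq j) (b - sq j)" by blast
    define \<delta> where "\<delta> = sq j"
    have \<delta>: "\<delta> > 0" by (simp add: \<delta>_def sq)
    define M where "M = \<bar>a\<bar> + \<bar>b\<bar>"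
    \<comment> \<open>The coefficient from \<open>poisson_arc_le\<close> without its factor s, so
      that the tail correction is s K times a convergent sequence.\<close>
    define K where "K = (2 + (1 + 2 * M\<^sup>2) / \<delta>\<^sup>2) * (b - a)"
    have "(\<lambda>m. harmonic_mass (sq m) (a + \<delta>) (b - \<delta>) - sq m * K * harmonic_ext 1 0) \<longlonglongrightarrow> harmonic_mass 0 (a + \<delta>) (b - \<delta>) - 0 * K * harmonic_ext 1 0"
      by (intro tendsto_intros harmonic_mass_tendsto[OF sq0] sq0)
    then have "\<forall>\<^sub>F m in sequentially. l < harmonic_mass (sq m) (a + \<delta>) (b - \<delta>) - sq m * K * harmonic_ext 1 0"
      by (rule order_tendstoD) (use j in \<open>simp add: \<delta>_def\<close>)
    from eventually_happens'[OF sequentially_bot this] obtain m where m: "l < harmonic_mass (sq m) (a + \<delta>) (b - \<delta>) - sq m * K * harmonic_ext 1 0" by blast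
    have "(\<lambda>n. atom_avg c \<theta> n (poisson_arc (sq m) (a + \<delta>) (b - \<delta>)) - sq m * K * Y n) \<longlonglongrightarrow> harmonic_mass (sq m) (a + \<delta>) (b - \<delta>) - sq m * K * harmonic_ext 1 0"
      by (intro tendsto_intros arc Y)
    then have "\<forall>\<^sub>F n in sequentially. l < atom_avg c \<theta> n (poisson_arc (sq m) (a + \<delta>) (b - \<delta>)) - sq m * K * Y n"
      using m by (rule order_tendstoD)
    then show "\<forall>\<^sub>F n in sequentially. l < pi * atom_avg c \<theta> n (indicator {a..b})"
    proof eventually_elim
      case (elim n)
      have "atom_avg c \<theta> n (poisson_arc (sq m) (a + \<delta>) (b - \<delta>)) \<le> atom_avg c \<theta> n (\<lambda>t. pi * indicator {a..b} t + sq m * K * poisson 1 t)"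
      proof (rule atom_avg_mono[OF c])
        fix t
        show "poisson_arc (sq m) (a + \<delta>) (b - \<delta>) t \<le> pi * indicator {a..b} t + sq m * K * poisson 1 t"
          using poisson_arc_le[OF sq \<delta> _ _ ab, of M m t] by (simp add: K_def M_def mult_ac)
      qed
      also have "\<dots> = pi * atom_avg c \<theta> n (indicator {a..b}) + sq m * K * Y n"
        by (simp add: atom_avg_add atom_avg_cmult Y_def)
      finally show ?case using elim by linarith
    qed
  qed
  then have "(\<lambda>n. pi * atom_avg c \<theta> n (indicator {a..b}) / pi) \<longlonglongrightarrow> harmonic_mass 0 a b / pi"
    by (intro tendsto_intros) auto
  then show ?thesis by simp
qed

section \<open>From intervals to continuous integrands\<close>

definition edge_limit_int :: "(real \<Rightarrow> real) \<Rightarrow> real" where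
  "edge_limit_int f = (\<integral>x. edge_limit_density x * f x \<partial>lborel)"

lemma edge_limit_density_cont: "continuous_on UNIV edge_limit_density"
proof -
  have "edge_limit_density = (\<lambda>x. harmonic_ext 0 x / pi)" by (simp add: harmonic_ext_0 fun_eq_iff)
  moreover have "continuous_on UNIV (\<lambda>x. harmonic_ext 0 x / pi)"
    by (intro continuous_on_divide continuous_on_const harmonic_ext_continuous(1)) auto
  ultimately show ?thesis by (simp only:)
qed

lemma edge_limit_density_nonneg: "edge_limit_density x \<ge> 0"
  by (simp add: edge_limit_density_def)

lemma edge_limit_density_measurable [measurable]: "edge_limit_density \<in> borel_measurable borel"
  by (rule borel_measurable_continuous_onI[OF edge_limit_density_cont])

lemma edge_limit_int_indicator: "edge_limit_int (indicator {a..b}) = harmonic_mass 0 a b / pi"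
  by (simp add: edge_limit_int_def harmonic_mass_def harmonic_ext_0 mult_ac)

lemma edge_limit_integrable:
  assumes [measurable]: "f \<in> borel_measurable borel" and f: "\<And>x. \<bar>f x\<bar> \<le> C * indicator {a..b} x"
  shows "integrable lborel (\<lambda>x. edge_limit_density x * f x)"
proof (rule Bochner_Integration.integrable_bound)
  show "integrable lborel (\<lambda>x. indicator {a..b} x * (C * edge_limit_density x))"
    by (intro set_integrable_cont continuous_intros continuous_on_subset[OF edge_limit_density_cont]) auto
  show "AE x in lborel. norm (edge_limit_density x * f x) \<le> norm (indicator {a..b} x * (C * edge_limit_density x))"
  proof (rule AE_I2)
    fix x
    have "edge_limit_density x * \<bar>f x\<bar> \<le> edge_limit_density x * (C * indicator {a..b} x)"
      by (intro mult_left_mono f edge_limit_density_nonneg)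
    then show "norm (edge_limit_density x * f x) \<le> norm (indicator {a..b} x * (C * edge_limit_density x))"
      unfolding real_norm_def
      by (intro order_trans[OF _ abs_ge_self]) (simp add: abs_mult abs_of_nonneg[OF edge_limit_density_nonneg] mult_ac)
  qed
qed measurable

text \<open>Uniform approximation by step functions reduces continuous integrands to intervals; the cells
  are written as differences of the indicators of \<open>{a..t}\<close>, so that they telescope.\<close>

lemma atom_avg_continuous_tendsto:
  assumes c: "\<And>n. c n \<ge> 0" and ab: "a \<le> b" and f: "continuous_on {a..b} f"
    and I: "\<And>a b. a \<le> b \<Longrightarrow> (\<lambda>n. atom_avg c \<theta> n (indicator {a..b})) \<longlonglongrightarrow> edge_limit_int (indicator {a..b})"
  shows "(\<lambda>n. atom_avg c \<theta> n (\<lambda>t. indicator {a..b} t * f t)) \<longlonglongrightarrow> edge_limit_int (\<lambda>t. indicator {a..b} t * f t)"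
proof (rule tendstoI)
  fix e :: real assume e: "e > 0"
  let ?F = "\<lambda>t. indicator {a..b} t * f t"
  define J where "J = edge_limit_int (indicator {a..b})"
  have J0: "J \<ge> 0" unfolding J_def edge_limit_int_def
    by (intro Bochner_Integration.integral_nonneg mult_nonneg_nonneg edge_limit_density_nonneg) auto
  \<comment> \<open>The mass of the interval is eventually below J + 1, so replacing the integrand
    by the step function costs at most e/4 for the atoms and e/4 for the limit; convergence for the
    step function uses a further e/4.\<close>
  define \<epsilon> where "\<epsilon> = e / (4 * (J + 1))"
  have \<epsilon>: "\<epsilon> > 0" using e J0 by (simp add: \<epsilon>_def)
  have "uniformly_continuous_on {a..b} f" using f by (intro compact_uniformly_continuous) auto
  then obtain \<delta> where \<delta>: "\<delta> > 0" "\<And>x y. x \<in> {a..b} \<Longrightarrow> y \<in> {a..b} \<Longrightarrow> dist y x < \<delta> \<Longrightarrow> dist (f y) (f x) < \<epsilon>"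
    unfolding uniformly_continuous_on_def using \<epsilon> by metis
  obtain N where N: "real N * \<delta> > b - a" using \<delta>(1) reals_Archimedean3 by blast
  have N0: "N > 0" using N ab by (cases N) auto
  define h where "h = (b - a) / real N"
  have h: "0 \<le> h" "h < \<delta>" using N N0 ab by (auto simp: h_def field_simps)
  define t where "t i = a + real i * h" for i
  have t0: "t 0 = a" and tN: "t N = b" using N0 by (auto simp: t_def h_def)
  have tSuc: "t (Suc i) = t i + h" for i by (simp add: t_def algebra_simps)
  have tm: "t i \<le> t j" if "i \<le> j" for i j using that h by (auto simp: t_def intro!: mult_right_mono)
  have tab: "t i \<in> {a..b}" if "i \<le> N" for i using tm[of 0 i] tm[of i N] that t0 tN by auto
  define X where "X i x = (indicator {a..t (Suc i)} x - indicator {a..t i} x :: real)" for i x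
  have X0: "X i x \<ge> 0" for i x using tm[of i "Suc i"] by (auto simp: X_def indicator_def)
  \<comment> \<open>The cells are open on the left, so the point \<open>a\<close> is in none of them
    and has its own summand; there the step function agrees with \<open>f\<close>.\<close>
  define g where "g x = f a * indicator {a..a} x + (\<Sum>i<N. f (t (Suc i)) * X i x)" for x
  have tele: "indicator {a..b} x = indicator {a..a} x + (\<Sum>i<N. X i x)" for x :: real
    unfolding X_def using sum_lessThan_telescope[of "\<lambda>i. indicator {a..t i} x :: real" N] by (simp add: t0 tN)
  have fg: "\<bar>?F x - g x\<bar> \<le> \<epsilon> * indicator {a..b} x" for x
  proof -
    have "?F x - g x = (f x - f a) * indicator {a..a} x + (\<Sum>i<N. (f x - f (t (Suc i))) * X i x)"
      unfolding tele g_def by (simp add: algebra_simps sum_distrib_left sum_subtractf)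
    also have "(f x - f a) * indicator {a..a} x = 0" by (auto simp: indicator_def)
    also have "\<bar>0 + (\<Sum>i<N. (f x - f (t (Suc i))) * X i x)\<bar> \<le> (\<Sum>i<N. \<epsilon> * X i x)"
      unfolding add_0
    proof (intro order_trans[OF sum_abs] sum_mono)
      fix i assume i: "i \<in> {..<N}"
      show "\<bar>(f x - f (t (Suc i))) * X i x\<bar> \<le> \<epsilon> * X i x"
      proof (cases "X i x = 0")
        case False
        have not_in: "x \<notin> {a..t i}"
        proof
          assume "x \<in> {a..t i}"
          moreover from this have "x \<in> {a..t (Suc i)}" using tm[of i "Suc i"] by simp
          ultimately show False using False by (simp add: X_def)
        qed
        then have "x \<in> {a..t (Suc i)}" using False unfolding X_def by (cases "x \<in> {a..t (Suc i)}") simp_all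
        with not_in have x: "a \<le> x" "t i < x" "x \<le> t (Suc i)" by auto
        have "dist (f x) (f (t (Suc i))) < \<epsilon>"
          using x h tSuc[of i] tab[of "Suc i"] i by (intro \<delta>(2)) (auto simp: dist_real_def)
        then show ?thesis using X0[of i x] by (auto simp: abs_mult dist_real_def intro!: mult_right_mono)
      qed simp
    qed
    also have "\<dots> = \<epsilon> * (\<Sum>i<N. X i x)" by (simp add: sum_distrib_left)
    also have "\<dots> \<le> \<epsilon> * indicator {a..b} x"
    proof (rule mult_left_mono)
      have "0 \<le> (indicator {a..a} x :: real)" by simp
      then show "(\<Sum>i<N. X i x) \<le> indicator {a..b} x" using tele[of x] by linarith
    qed (use \<epsilon> in simp)
    finally show ?thesis .
  qed
  have [measurable]: "?F \<in> borel_measurable borel"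
    using borel_measurable_continuous_on_indicator[OF _ f] by simp
  have [measurable]: "g \<in> borel_measurable borel" unfolding g_def[abs_def] X_def[abs_def] by measurable
  have intX: "integrable lborel (\<lambda>x. edge_limit_density x * indicator {u..v} x)" for u v :: real
    by (rule edge_limit_integrable[where C=1 and a=u and b=v]) (auto simp: indicator_def)
  have gdec: "edge_limit_int g = f a * edge_limit_int (indicator {a..a}) +
      (\<Sum>i<N. f (t (Suc i)) * (edge_limit_int (indicator {a..t (Suc i)}) - edge_limit_int (indicator {a..t i})))"
    and intg: "integrable lborel (\<lambda>x. edge_limit_density x * g x)"
  proof -
    have eq: "edge_limit_density x * g x = f a * (edge_limit_density x * indicator {a..a} x) +
      (\<Sum>i<N. f (t (Suc i)) * (edge_limit_density x * indicator {a..t (Suc i)} x - edge_limit_density x * indicator {a..t i} x))" for x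
      unfolding g_def X_def by (simp add: distrib_left sum_distrib_left right_diff_distrib mult_ac)
    show "edge_limit_int g = f a * edge_limit_int (indicator {a..a}) +
      (\<Sum>i<N. f (t (Suc i)) * (edge_limit_int (indicator {a..t (Suc i)}) - edge_limit_int (indicator {a..t i})))"
      unfolding edge_limit_int_def eq
      by (simp add: Bochner_Integration.integral_add Bochner_Integration.integral_diff Bochner_Integration.integral_sum intX
          Bochner_Integration.integrable_sum Bochner_Integration.integrable_diff integrable_mult_right
          del: atLeastAtMost_singleton)
    show "integrable lborel (\<lambda>x. edge_limit_density x * g x)"
      unfolding eq by (intro Bochner_Integration.integrable_add Bochner_Integration.integrable_sum
        integrable_mult_right Bochner_Integration.integrable_diff intX)
  qed
  have "atom_avg c \<theta> n g = f a * atom_avg c \<theta> n (indicator {a..a}) +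
      (\<Sum>i<N. f (t (Suc i)) * (atom_avg c \<theta> n (indicator {a..t (Suc i)}) - atom_avg c \<theta> n (indicator {a..t i})))" for n
    unfolding g_def X_def atom_avg_add atom_avg_sum atom_avg_cmult atom_avg_diff ..
  moreover have "(\<lambda>n. f a * atom_avg c \<theta> n (indicator {a..a}) +
      (\<Sum>i<N. f (t (Suc i)) * (atom_avg c \<theta> n (indicator {a..t (Suc i)}) - atom_avg c \<theta> n (indicator {a..t i}))))
    \<longlonglongrightarrow> edge_limit_int g"
    unfolding gdec by (intro tendsto_intros I) (use tab in \<open>auto\<close>)
  ultimately have "(\<lambda>n. atom_avg c \<theta> n g) \<longlonglongrightarrow> edge_limit_int g" by simp
  then have "\<forall>\<^sub>F n in sequentially. dist (atom_avg c \<theta> n g) (edge_limit_int g) < e / 4"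
    by (rule tendstoD) (use e in auto)
  moreover have "\<forall>\<^sub>F n in sequentially. atom_avg c \<theta> n (indicator {a..b}) < J + 1"
    using I[OF ab] by (rule order_tendstoD) (simp add: J_def)
  ultimately show "\<forall>\<^sub>F n in sequentially. dist (atom_avg c \<theta> n ?F) (edge_limit_int ?F) < e"
  proof eventually_elim
    case (elim n)
    have \<epsilon>J: "\<epsilon> * (J + 1) = e / 4"
    proof -
      have "e / (4 * y) * y = e / 4" if "y > 0" for y :: real using that by simp
      from this[of "J + 1"] J0 show ?thesis by (simp only: \<epsilon>_def)
    qed
    have "\<bar>atom_avg c \<theta> n ?F - atom_avg c \<theta> n g\<bar> \<le> atom_avg c \<theta> n (\<lambda>x. \<bar>?F x - g x\<bar>)"
      unfolding atom_avg_diff[symmetric] by (rule atom_avg_abs[OF c])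
    also have "\<dots> \<le> atom_avg c \<theta> n (\<lambda>x. \<epsilon> * indicator {a..b} x)" by (intro atom_avg_mono c fg)
    also have "\<dots> = \<epsilon> * atom_avg c \<theta> n (indicator {a..b})" by (simp add: atom_avg_cmult)
    also have "\<dots> \<le> \<epsilon> * (J + 1)" using elim \<epsilon> by (intro mult_left_mono) auto
    finally have 1: "\<bar>atom_avg c \<theta> n ?F - atom_avg c \<theta> n g\<bar> \<le> e / 4" unfolding \<epsilon>J .
    have intd: "integrable lborel (\<lambda>x. edge_limit_density x * (?F x - g x))"
      by (rule edge_limit_integrable[OF _ fg]) measurable
    have intF: "integrable lborel (\<lambda>x. edge_limit_density x * ?F x)"
      using Bochner_Integration.integrable_add[OF intd intg] by (simp add: algebra_simps)
    have "edge_limit_int ?F - edge_limit_int g = (\<integral>x. edge_limit_density x * (?F x - g x) \<partial>lborel)"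
      unfolding edge_limit_int_def right_diff_distrib
      by (rule Bochner_Integration.integral_diff[symmetric, OF intF intg])
    also have "\<bar>\<dots>\<bar> \<le> (\<integral>x. \<epsilon> * (edge_limit_density x * indicator {a..b} x) \<partial>lborel)"
    proof (rule integral_abs_bound_integral[OF intd integrable_mult_right[OF intX]])
      fix x
      have "edge_limit_density x * \<bar>?F x - g x\<bar> \<le> edge_limit_density x * (\<epsilon> * indicator {a..b} x)"
        by (intro mult_left_mono fg edge_limit_density_nonneg)
      then show "\<bar>edge_limit_density x * (?F x - g x)\<bar> \<le> \<epsilon> * (edge_limit_density x * indicator {a..b} x)"
        by (simp add: abs_mult abs_of_nonneg[OF edge_limit_density_nonneg] mult_ac)
    qed
    also have "\<dots> = \<epsilon> * J" by (simp add: J_def edge_limit_int_def)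
    also have "\<dots> \<le> \<epsilon> * (J + 1)" using \<epsilon> by (intro mult_left_mono) auto
    finally have 2: "\<bar>edge_limit_int ?F - edge_limit_int g\<bar> \<le> e / 4" unfolding \<epsilon>J .
    show ?case using 1 2 elim(1) e unfolding dist_real_def by linarith
  qed
qed

section \<open>The edge measures\<close>

definition edge_scale :: "(nat \<Rightarrow> real) \<Rightarrow> nat \<Rightarrow> real" where
  "edge_scale r n = 1 / (real n * r n powr (3/2))"

definition edge_coords :: "real \<Rightarrow> (nat \<Rightarrow> real) \<Rightarrow> (nat \<Rightarrow> nat \<Rightarrow> real) \<Rightarrow> nat \<Rightarrow> nat \<Rightarrow> real" where
  "edge_coords \<beta> r X n = edge_coord n \<beta> (r n) (X n)"

lemma poisson_avg_eq_atom_avg: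
  "poisson_avg n \<beta> (r n) x s (X n) = atom_avg (edge_scale r) (edge_coords \<beta> r X) n (\<lambda>t. poisson s (t - x))"
  by (simp add: poisson_avg_def atom_avg_def edge_scale_def edge_coords_def poisson_def)

text \<open>The exceptional set must not depend on the interval or on the integrand. It is therefore
  collected over rational x and heights 1/(m+1) only, and everything after that is
  deterministic.\<close>

lemma edge_AE_tendsto:
  assumes \<beta>: "\<beta> \<ge> 1" and \<epsilon>: "\<epsilon> > 0" and r_pos: "\<forall>n\<ge>1. r n > 0"
    and rate: "\<forall>\<^sub>F n in sequentially. r n > real n powr (\<epsilon> - 2/3)" and r0: "r \<longlonglongrightarrow> 0"
    and P: "prob_space P" and gbe: "\<forall>n\<ge>1. gaussian_beta_ensemble P n \<beta> (\<Lambda> n)"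
  shows "AE \<omega> in P. \<forall>a b f. a \<le> b \<longrightarrow> continuous_on {a..b} f \<longrightarrow>
    (\<lambda>n. atom_avg (edge_scale r) (edge_coords \<beta> r (\<lambda>n. \<Lambda> n \<omega>)) n (\<lambda>t. indicator {a..b} t * f t))
      \<longlonglongrightarrow> edge_limit_int (\<lambda>t. indicator {a..b} t * f t)"
proof -
  have r: "r n > 0" and \<Lambda>: "gaussian_beta_ensemble P n \<beta> (\<Lambda> n)" if "n \<ge> 1" for n
    using r_pos gbe that by auto
  have c: "edge_scale r n \<ge> 0" for n by (simp add: edge_scale_def)
  have s: "1 / real (Suc m) > 0" for m by simp
  have "AE \<omega> in P. (\<lambda>n. edge_error n \<beta> (r n) x (1 / real (Suc m)) (\<Lambda> n \<omega>)) \<longlonglongrightarrow> 0" for x m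
    by (rule edge_error_AE_tendsto_0[OF \<beta> s \<epsilon> rate r0 P \<Lambda>])
  then have "AE \<omega> in P. \<forall>x\<in>\<rat>. (\<lambda>n. edge_error n \<beta> (r n) x (1 / real (Suc m)) (\<Lambda> n \<omega>)) \<longlonglongrightarrow> 0" for m
    unfolding AE_ball_countable[OF countable_rat] by blast
  then have "AE \<omega> in P. \<forall>m. \<forall>x\<in>\<rat>. (\<lambda>n. edge_error n \<beta> (r n) x (1 / real (Suc m)) (\<Lambda> n \<omega>)) \<longlonglongrightarrow> 0"
    unfolding AE_all_countable by blast
  then show ?thesis
  proof eventually_elim
    case (elim \<omega>)
    let ?\<theta> = "edge_coords \<beta> r (\<lambda>n. \<Lambda> n \<omega>)"
    have Q: "(\<lambda>n. atom_avg (edge_scale r) ?\<theta> n (\<lambda>t. poisson (1 / real (Suc m)) (t - x))) \<longlonglongrightarrow> harmonic_ext (1 / real (Suc m)) x"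
      if x: "x \<in> \<rat>" for x m
    proof -
      have "(\<lambda>n. edge_error n \<beta> (r n) x (1 / real (Suc m)) (\<Lambda> n \<omega>)) \<longlonglongrightarrow> 0" using elim x by blast
      then show ?thesis
        unfolding poisson_avg_eq_atom_avg[symmetric] harmonic_ext_def
        by (rule poisson_avg_tendsto[OF \<beta> s _ r0 edge_kappa_tendsto_0[OF \<beta> s \<epsilon> rate], rotated]) (rule r)
    qed
    have R: "(\<lambda>n. atom_avg (edge_scale r) ?\<theta> n (\<lambda>t. poisson (1 / real (Suc m)) (t - x))) \<longlonglongrightarrow> harmonic_ext (1 / real (Suc m)) x" for x m
      by (rule poisson_avg_real_tendsto[OF c s Q])
    have I: "(\<lambda>n. atom_avg (edge_scale r) ?\<theta> n (indicator {a..b})) \<longlonglongrightarrow> edge_limit_int (indicator {a..b})" if "a \<le> b" for a b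
      unfolding edge_limit_int_indicator by (rule atom_avg_interval_tendsto[OF c that R])
    show ?case
    proof (intro allI impI)
      fix a b :: real and f :: "real \<Rightarrow> real"
      assume "a \<le> b" "continuous_on {a..b} f"
      then show "(\<lambda>n. atom_avg (edge_scale r) ?\<theta> n (\<lambda>t. indicator {a..b} t * f t)) \<longlonglongrightarrow> edge_limit_int (\<lambda>t. indicator {a..b} t * f t)"
        by (rule atom_avg_continuous_tendsto[OF c _ _ I])
    qed
  qed
qed

lemma scale_measure_eq_density: "scale_measure a N = density N (\<lambda>_. a)"
proof (rule measure_eqI)
  fix A assume "A \<in> sets (scale_measure a N)"
  then have A: "A \<in> sets N" by simp
  show "emeasure (scale_measure a N) A = emeasure (density N (\<lambda>_. a)) A"
    using A by (simp add: emeasure_density nn_integral_cmult_indicator)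
qed simp

lemma integral_edge_measure:
  assumes [measurable]: "f \<in> borel_measurable borel"
  shows "(\<integral>t. f t \<partial>edge_measure n \<beta> (r n) (X n)) = atom_avg (edge_scale r) (edge_coords \<beta> r X) n f"
proof -
  let ?N = "distr (count_space {1..n}) borel (edge_coord n \<beta> (r n) (X n))"
  have "(\<integral>t. f t \<partial>edge_measure n \<beta> (r n) (X n)) = (\<integral>t. edge_scale r n *\<^sub>R f t \<partial>?N)"
    unfolding edge_measure_def scale_measure_eq_density edge_scale_def
    by (subst integral_density) auto
  also have "\<dots> = (\<integral>k. edge_scale r n *\<^sub>R f (edge_coord n \<beta> (r n) (X n) k) \<partial>count_space {1..n})"
    by (subst integral_distr) auto
  also have "\<dots> = atom_avg (edge_scale r) (edge_coords \<beta> r X) n f"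
    by (subst lebesgue_integral_count_space_finite) (auto simp: atom_avg_def edge_coords_def sum_distrib_left)
  finally show ?thesis .
qed

lemma integral_edge_limit_measure:
  assumes [measurable]: "f \<in> borel_measurable borel"
  shows "(\<integral>t. f t \<partial>edge_limit_measure) = edge_limit_int f"
proof -
  have "edge_limit_measure = density lborel (\<lambda>x. ennreal (edge_limit_density x))"
    by (simp add: edge_limit_measure_def edge_limit_density_def)
  also have "(\<integral>t. f t \<partial>density lborel (\<lambda>x. ennreal (edge_limit_density x))) = (\<integral>x. edge_limit_density x *\<^sub>R f x \<partial>lborel)"
    by (rule integral_density) (auto simp: edge_limit_density_nonneg)
  finally show ?thesis by (simp add: edge_limit_int_def)
qed

text \<open>Half of the exponent is given up: the factor n^(-\<epsilon>/2) eventually beats the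
  constant of the O-bound.\<close>

lemma rate_from_bigo:
  fixes r :: "nat \<Rightarrow> real"
  assumes r: "\<forall>n\<ge>1. r n > 0" and \<epsilon>: "\<epsilon> > 0"
    and O: "(\<lambda>n. inverse (r n)) \<in> O(\<lambda>n. real n powr (2/3 - \<epsilon>))"
  shows "\<forall>\<^sub>F n in sequentially. r n > real n powr (\<epsilon> / 2 - 2/3)"
proof -
  obtain C where C: "C > 0" and CO: "\<forall>\<^sub>F n in sequentially. norm (inverse (r n)) \<le> C * norm (real n powr (2/3 - \<epsilon>))"
    using landau_o.bigE[OF O] by blast
  have "(\<lambda>n. C * real n powr (- (\<epsilon> / 2))) \<longlonglongrightarrow> 0"
    using \<epsilon> by (intro tendsto_mult_right_zero tendsto_neg_powr filterlim_real_sequentially) auto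
  then have "\<forall>\<^sub>F n in sequentially. C * real n powr (- (\<epsilon> / 2)) < 1"
    by (rule order_tendstoD) simp
  with CO show ?thesis
    using eventually_ge_at_top[of 1]
  proof eventually_elim
    case (elim n)
    have n: "real n > 0" using elim by simp
    have rn: "r n > 0" using r elim by simp
    have "inverse (r n) \<le> C * real n powr (2/3 - \<epsilon>)" using elim rn by simp
    also have "\<dots> = (C * real n powr (- (\<epsilon> / 2))) * real n powr (2/3 - \<epsilon> / 2)"
      using n by (simp add: powr_add[symmetric] mult.assoc)
    also have "\<dots> < 1 * real n powr (2/3 - \<epsilon> / 2)"
      using elim n by (intro mult_strict_right_mono) auto
    finally have "inverse (r n) < real n powr (2/3 - \<epsilon> / 2)" by simp
    then have "inverse (real n powr (2/3 - \<epsilon> / 2)) < inverse (inverse (r n))"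
      using rn by (intro less_imp_inverse_less) auto
    then have "inverse (real n powr (2/3 - \<epsilon> / 2)) < r n" by simp
    then show ?case by (simp add: powr_minus[symmetric])
  qed
qed

section \<open>Convergence in probability through a coupling\<close>

text \<open>Dominated convergence is applied to the indicators of the deviation events. The index is
  shifted because measurability is only known from size 1 on.\<close>

lemma AE_tendsto_imp_conv_in_prob:
  assumes P: "prob_space P" and [measurable]: "\<And>n. n \<ge> 1 \<Longrightarrow> Z n \<in> borel_measurable P"
    and AE: "AE \<omega> in P. (\<lambda>n. Z n \<omega>) \<longlonglongrightarrow> (L::real)" and e: "e > 0"
  shows "(\<lambda>n. measure P {\<omega>\<in>space P. \<bar>Z (Suc n) \<omega> - L\<bar> > e}) \<longlonglongrightarrow> 0"
proof -
  interpret prob_space P by fact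
  have [measurable]: "Z (Suc n) \<in> borel_measurable P" for n by (rule assms(2)) simp
  let ?A = "\<lambda>n. {\<omega>\<in>space P. \<bar>Z (Suc n) \<omega> - L\<bar> > e}"
  have "(\<lambda>n. \<integral>\<omega>. indicator (?A n) \<omega> \<partial>P) \<longlonglongrightarrow> (\<integral>\<omega>. 0 \<partial>P :: real)"
  proof (rule integral_dominated_convergence[where w="\<lambda>_. 1"])
    show "AE \<omega> in P. (\<lambda>n. indicator (?A n) \<omega> :: real) \<longlonglongrightarrow> 0"
      using AE
    proof eventually_elim
      case (elim \<omega>)
      from LIMSEQ_Suc[OF elim] have "\<forall>\<^sub>F n in sequentially. dist (Z (Suc n) \<omega>) L < e" using e by (rule tendstoD)
      then have "\<forall>\<^sub>F n in sequentially. (0::real) = indicator (?A n) \<omega>"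
        by eventually_elim (auto simp: dist_real_def)
      then show ?case by (rule Lim_transform_eventually[OF tendsto_const])
    qed
  qed (auto simp: indicator_def)
  then show ?thesis by simp
qed

text \<open>The coordinate projections of a product measure have the original spaces as their laws,
  so any family of ensembles can be realised jointly without changing the probability of an event at
  a single size.\<close>

lemma coupling_on_product:
  fixes M :: "nat \<Rightarrow> 'a measure"
  assumes M: "\<And>n. n \<ge> 1 \<Longrightarrow> prob_space (M n) \<and> gaussian_beta_ensemble (M n) n \<beta> (\<Lambda> n)"
  obtains P :: "(nat \<Rightarrow> 'a) measure" where "prob_space P"
    "\<And>n. n \<ge> 1 \<Longrightarrow> gaussian_beta_ensemble P n \<beta> (\<lambda>\<omega>. \<Lambda> n (\<omega> n))"
    "\<And>n. n \<ge> 1 \<Longrightarrow> (\<lambda>\<omega>. \<omega> n) \<in> measurable P (M n)"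
    "\<And>n. n \<ge> 1 \<Longrightarrow> distr P (M n) (\<lambda>\<omega>. \<omega> n) = M n"
proof -
  \<comment> \<open>The space at index 0 is unconstrained, so it is replaced by a probability space
    to make the product over all indices legitimate.\<close>
  define M' where "M' n = (if n = 0 then M 1 else M n)" for n
  have M': "prob_space (M' n)" for n using M[of 1] M[of n] by (simp add: M'_def)
  define P where "P = Pi\<^sub>M UNIV M'"
  have meas: "(\<lambda>\<omega>. \<omega> n) \<in> measurable P (M n)" if "n \<ge> 1" for n
    using measurable_component_singleton[of n UNIV M'] that by (simp add: P_def M'_def)
  have dist: "distr P (M n) (\<lambda>\<omega>. \<omega> n) = M n" if "n \<ge> 1" for n
    using distr_PiM_component[of UNIV M' n] M' that by (simp add: P_def M'_def)
  show ?thesis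
  proof (rule that[of P])
    show "prob_space P" unfolding P_def by (intro prob_space_PiM M')
    fix n :: nat assume n: "n \<ge> 1"
    note meas[OF n, measurable]
    have g: "distributed (M n) (config_lborel n) (\<Lambda> n) (\<lambda>x. ennreal (gbe_density n \<beta> x))"
      using M[OF n] by (simp add: gaussian_beta_ensemble_def)
    have [measurable]: "\<Lambda> n \<in> measurable (M n) (config_lborel n)"
      using g by (rule distributed_measurable)
    have "distr P (config_lborel n) (\<lambda>\<omega>. \<Lambda> n (\<omega> n)) = distr (distr P (M n) (\<lambda>\<omega>. \<omega> n)) (config_lborel n) (\<Lambda> n)"
      by (subst distr_distr) (auto simp: o_def)
    also have "\<dots> = density (config_lborel n) (\<lambda>x. ennreal (gbe_density n \<beta> x))"
      unfolding dist[OF n] using g by (rule distributed_distr_eq_density)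
    finally show "gaussian_beta_ensemble P n \<beta> (\<lambda>\<omega>. \<Lambda> n (\<omega> n))"
      unfolding gaussian_beta_ensemble_def distributed_def using distributed_borel_measurable[OF g] by auto
  qed (use meas dist in auto)
qed

lemma atom_avg_edge_measurable:
  assumes [measurable]: "f \<in> borel_measurable borel"
  shows "(\<lambda>Y. atom_avg (edge_scale r) (edge_coords \<beta> r (\<lambda>_. Y)) n f) \<in> borel_measurable (config_lborel n)"
  unfolding atom_avg_def edge_coords_def edge_coord_def rescaled_eigenvalue_def
proof (intro borel_measurable_times borel_measurable_const borel_measurable_sum)
  fix k assume k: "k \<in> {1..n}"
  note coord_measurable[OF k, measurable]
  show "(\<lambda>Y. f ((1 - Y k / (2 * sqrt (real n * \<beta>))) / r n)) \<in> borel_measurable (config_lborel n)"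
    by measurable
qed

theorem theorem1:
  fixes \<beta> :: real and r :: "nat \<Rightarrow> real"
  assumes "\<beta> \<ge> 1"
    and "\<And>n. n \<ge> 1 \<Longrightarrow> r n > 0"
    and "r \<longlonglongrightarrow> 0"
    and "\<exists>\<epsilon>>0. (\<lambda>n. inverse (r n)) \<in> O(\<lambda>n. real n powr (2/3 - \<epsilon>))"
  shows
    "(\<forall>(M :: nat \<Rightarrow> 'a measure) \<Lambda>.
        (\<forall>n\<ge>1. prob_space (M n) \<and> gaussian_beta_ensemble (M n) n \<beta> (\<Lambda> n)) \<longrightarrow>
        weak_conv_in_prob_on_intervals M
          (\<lambda>n \<omega>. edge_measure n \<beta> (r n) (\<Lambda> n \<omega>)) edge_limit_measure)
     \<and>
     ((\<exists>\<epsilon>>0. \<forall>\<^sub>F n in sequentially. r n > real n powr (\<epsilon> - 2/3)) \<longrightarrow>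
      (\<forall>(P :: 'b measure) \<Lambda>.
        prob_space P \<and> (\<forall>n\<ge>1. gaussian_beta_ensemble P n \<beta> (\<Lambda> n)) \<longrightarrow>
        (AE \<omega> in P. vague_conv
          (\<lambda>n. edge_measure n \<beta> (r n) (\<Lambda> n \<omega>)) edge_limit_measure)))"
proof -
  obtain \<epsilon> where \<epsilon>: "\<epsilon> > 0" "(\<lambda>n. inverse (r n)) \<in> O(\<lambda>n. real n powr (2/3 - \<epsilon>))"
    using assms(4) by blast
  have \<epsilon>2: "\<epsilon> / 2 > 0" using \<epsilon>(1) by simp
  have r_pos: "\<forall>n\<ge>1. r n > 0" using assms(2) by blast
  \<comment> \<open>From here on the rate is used with exponent \<epsilon>/2.\<close>
  note rate = rate_from_bigo[OF r_pos \<epsilon>]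
  have 1: "weak_conv_in_prob_on_intervals M (\<lambda>n \<omega>. edge_measure n \<beta> (r n) (\<Lambda> n \<omega>)) edge_limit_measure"
    if M: "\<forall>n\<ge>1. prob_space (M n) \<and> gaussian_beta_ensemble (M n) n \<beta> (\<Lambda> n)"
    for M :: "nat \<Rightarrow> 'a measure" and \<Lambda>
    unfolding weak_conv_in_prob_on_intervals_def conv_in_prob_def
  proof (intro allI impI, elim conjE)
    fix a b :: real and f :: "real \<Rightarrow> real" and e :: real
    assume ab: "a \<le> b" and f: "continuous_on {a..b} f" and e: "0 < e"
    let ?f = "\<lambda>t. indicator {a..b} t * f t"
    have mf [measurable]: "?f \<in> borel_measurable borel"
      using borel_measurable_continuous_on_indicator[OF _ f] by simp
    define G where "G n Y = atom_avg (edge_scale r) (edge_coords \<beta> r (\<lambda>_. Y)) n ?f" for n Y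
    define L where "L = edge_limit_int ?f"
    have G: "(LINT t:{a..b}|edge_measure n \<beta> (r n) Y. f t) = G n Y" for n Y
      using integral_edge_measure[OF mf, of n \<beta> r "\<lambda>_. Y"] by (simp add: set_lebesgue_integral_def G_def)
    have L: "(LINT t:{a..b}|edge_limit_measure. f t) = L"
      using integral_edge_limit_measure[OF mf] by (simp add: set_lebesgue_integral_def L_def)
    have mG: "G n \<in> borel_measurable (config_lborel n)" for n
      unfolding G_def by (rule atom_avg_edge_measurable[OF mf])
    obtain P :: "(nat \<Rightarrow> 'a) measure" where P: "prob_space P"
      and gbe: "\<forall>n\<ge>1. gaussian_beta_ensemble P n \<beta> (\<lambda>\<omega>. \<Lambda> n (\<omega> n))"
      and meas: "\<And>n. n \<ge> 1 \<Longrightarrow> (\<lambda>\<omega>. \<omega> n) \<in> measurable P (M n)"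
      and dist: "\<And>n. n \<ge> 1 \<Longrightarrow> distr P (M n) (\<lambda>\<omega>. \<omega> n) = M n"
      using coupling_on_product[of M \<beta> \<Lambda>] M by blast
    have "AE \<omega> in P. (\<lambda>n. G n (\<Lambda> n (\<omega> n))) \<longlonglongrightarrow> L"
      using edge_AE_tendsto[OF assms(1) \<epsilon>2 r_pos rate assms(3) P, of "\<lambda>n \<omega>. \<Lambda> n (\<omega> n)", OF gbe]
    proof eventually_elim
      case (elim \<omega>)
      then have "(\<lambda>n. atom_avg (edge_scale r) (edge_coords \<beta> r (\<lambda>n. \<Lambda> n (\<omega> n))) n ?f) \<longlonglongrightarrow> L"
        using ab f unfolding L_def by blast
      then show ?case by (simp add: G_def atom_avg_def edge_coords_def)
    qed
    then have "(\<lambda>n. measure P {\<omega>\<in>space P. \<bar>G (Suc n) (\<Lambda> (Suc n) (\<omega> (Suc n))) - L\<bar> > e}) \<longlonglongrightarrow> 0"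
      by (intro AE_tendsto_imp_conv_in_prob[OF P _ _ e, where Z="\<lambda>n \<omega>. G n (\<Lambda> n (\<omega> n))"])
         (auto intro: measurable_compose[OF gbe_measurable mG] gbe[rule_format])
    \<comment> \<open>Each event depends on a single coordinate, whose law under P is
      \<open>M (Suc n)\<close>, so the coupling drops out again.\<close>
    also have "(\<lambda>n. measure P {\<omega>\<in>space P. \<bar>G (Suc n) (\<Lambda> (Suc n) (\<omega> (Suc n))) - L\<bar> > e}) =
      (\<lambda>n. measure (M (Suc n)) {\<omega>\<in>space (M (Suc n)). \<bar>G (Suc n) (\<Lambda> (Suc n) \<omega>) - L\<bar> > e})"
    proof
      fix n
      let ?n = "Suc n"
      have n: "?n \<ge> 1" by simp
      note meas[OF n, measurable]
      have "gaussian_beta_ensemble (M ?n) ?n \<beta> (\<Lambda> ?n)" using M n by blast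
      note measurable_compose[OF gbe_measurable[OF this] mG, measurable]
      have "measure (M ?n) {\<omega>\<in>space (M ?n). \<bar>G ?n (\<Lambda> ?n \<omega>) - L\<bar> > e} =
        measure (distr P (M ?n) (\<lambda>\<omega>. \<omega> ?n)) {\<omega>\<in>space (M ?n). \<bar>G ?n (\<Lambda> ?n \<omega>) - L\<bar> > e}"
        unfolding dist[OF n] ..
      also have "\<dots> = measure P {\<omega>\<in>space P. \<bar>G ?n (\<Lambda> ?n (\<omega> ?n)) - L\<bar> > e}"
        using measurable_space[OF meas[OF n]]
        by (subst measure_distr) (auto intro!: arg_cong[where f="measure P"])
      finally show "measure P {\<omega>\<in>space P. \<bar>G ?n (\<Lambda> ?n (\<omega> ?n)) - L\<bar> > e} = measure (M ?n) {\<omega>\<in>space (M ?n). \<bar>G ?n (\<Lambda> ?n \<omega>) - L\<bar> > e}" ..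
    qed
    finally have "(\<lambda>n. measure (M n) {\<omega>\<in>space (M n). \<bar>G n (\<Lambda> n \<omega>) - L\<bar> > e}) \<longlonglongrightarrow> 0"
      by (rule LIMSEQ_imp_Suc)
    then show "(\<lambda>n. measure (M n) {\<omega>\<in>space (M n). e < \<bar>(LINT t:{a..b}|edge_measure n \<beta> (r n) (\<Lambda> n \<omega>). f t) - (LINT t:{a..b}|edge_limit_measure. f t)\<bar>}) \<longlonglongrightarrow> 0"
      unfolding G L .
  qed
  have 2: "AE \<omega> in P. vague_conv (\<lambda>n. edge_measure n \<beta> (r n) (\<Lambda> n \<omega>)) edge_limit_measure"
    if P: "prob_space P" and gbe: "\<forall>n\<ge>1. gaussian_beta_ensemble P n \<beta> (\<Lambda> n)"
    for P :: "'b measure" and \<Lambda>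
    using edge_AE_tendsto[OF assms(1) \<epsilon>2 r_pos rate assms(3) P gbe]
  proof eventually_elim
    case (elim \<omega>)
    show ?case
      unfolding vague_conv_def
    proof (intro allI impI, elim conjE)
      fix f :: "real \<Rightarrow> real"
      assume f: "continuous_on UNIV f" and K: "compact (closure (support_on UNIV f))"
      obtain B where B: "\<And>x. x \<in> closure (support_on UNIV f) \<Longrightarrow> norm x \<le> B"
        using compact_imp_bounded[OF K] unfolding bounded_iff by blast
      \<comment> \<open>A compactly supported function equals its restriction to a symmetric
        interval. The absolute value is needed because the bound B may be negative when the support
        is empty.\<close>
      have fB: "(\<lambda>t. indicator {-\<bar>B\<bar>..\<bar>B\<bar>} t * f t) = f"
      proof
        fix t
        have "f t = 0" if "t \<notin> {-\<bar>B\<bar>..\<bar>B\<bar>}"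
        proof (rule ccontr)
          assume "f t \<noteq> 0"
          then have "t \<in> closure (support_on UNIV f)"
            using closure_subset by (force simp: support_on_def)
          from B[OF this] that show False by auto
        qed
        then show "indicator {-\<bar>B\<bar>..\<bar>B\<bar>} t * f t = f t" by (auto simp: indicator_def)
      qed
      have "(\<lambda>n. atom_avg (edge_scale r) (edge_coords \<beta> r (\<lambda>n. \<Lambda> n \<omega>)) n (\<lambda>t. indicator {-\<bar>B\<bar>..\<bar>B\<bar>} t * f t))
        \<longlonglongrightarrow> edge_limit_int (\<lambda>t. indicator {-\<bar>B\<bar>..\<bar>B\<bar>} t * f t)"
        using elim continuous_on_subset[OF f, of "{-\<bar>B\<bar>..\<bar>B\<bar>}"] by auto
      moreover have "f \<in> borel_measurable borel" by (rule borel_measurable_continuous_onI[OF f])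
      ultimately show "(\<lambda>n. \<integral>x. f x \<partial>edge_measure n \<beta> (r n) (\<Lambda> n \<omega>)) \<longlonglongrightarrow> (\<integral>x. f x \<partial>edge_limit_measure)"
        unfolding fB
        by (simp add: integral_edge_limit_measure integral_edge_measure[where X="\<lambda>n. \<Lambda> n \<omega>"])
    qed
  qed
  show ?thesis using 1 2 by blast
qed

end
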